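(* Fix $\varepsilon>0$. Let $K_1,K_{-1}\subseteq[N]$ be disjoint, $K=K_1\cup K_{-1}$, $k=|K|$, $x_{\pm1}=\mathbb{1}_{K_1}-\mathbb{1}_{K_{-1}}$, let $A\in\mathbb{R}^{m\times N}$ be a Gaussian matrix and $b=Ax_{\pm1}$. Let $$\Delta_{\pm\mathrm{ter}}(k)=\inf_{\tau\ge0}\Big[k\int_{-\infty}^{\tau}(u-\tau)^2\phi(u)\,du+2(N-k)\int_{\tau}^{\infty}(u-\tau)^2\phi(u)\,du\Big],\quad \phi(u)=(2\pi)^{-1/2}e^{-u^2/2}.$$ If $m\ge\Delta_{\pm\mathrm{ter}}(k)+\sqrt{8\log(4/\varepsilon)N}$, then with probability larger than $1-\varepsilon$, $x_{\pm1}$ is the unique solution of $\min\|x\|_1$ subject to $Ax=b$ and $x\in[-1,1]^N$.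
   Context: $\mathbb{1}_S$ has entries $1$ on $S$, $0$ elsewhere. A Gaussian matrix is $A=m^{-1/2}[a_{ij}]$ with $a_{ij}$ i.i.d. standard normal. $\log$ is the natural logarithm. *)

theory Defs
  imports "HOL-Probability.Probability"
begin

text \<open>Index convention: [N] is rendered as {..<N} (0-based), rows of A as {..<m}.
  Vectors in R^N are functions nat => real vanishing outside {..<N}.\<close>

definition gaussian_entries :: "nat \<Rightarrow> nat \<Rightarrow> (nat \<times> nat \<Rightarrow> real) measure" where
  "gaussian_entries m N = PiM ({..<m} \<times> {..<N}) (\<lambda>_. density lborel std_normal_density)"

definition gauss_matrix :: "nat \<Rightarrow> (nat \<times> nat \<Rightarrow> real) \<Rightarrow> nat \<Rightarrow> nat \<Rightarrow> real" where
  "gauss_matrix m a i j = a (i, j) / sqrt (real m)"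

definition indic_vec :: "nat set \<Rightarrow> nat \<Rightarrow> real" where
  "indic_vec S j = (if j \<in> S then 1 else 0)"

definition mat_vec :: "nat \<Rightarrow> nat \<Rightarrow> (nat \<Rightarrow> nat \<Rightarrow> real) \<Rightarrow> (nat \<Rightarrow> real) \<Rightarrow> nat \<Rightarrow> real" where
  "mat_vec m N A x i = (if i < m then (\<Sum>j<N. A i j * x j) else 0)"

definition l1norm :: "nat \<Rightarrow> (nat \<Rightarrow> real) \<Rightarrow> real" where
  "l1norm N x = (\<Sum>j<N. \<bar>x j\<bar>)"

definition box_feasible :: "nat \<Rightarrow> nat \<Rightarrow> (nat \<Rightarrow> nat \<Rightarrow> real) \<Rightarrow> (nat \<Rightarrow> real) \<Rightarrow> (nat \<Rightarrow> real) set" where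
  "box_feasible m N A b = {x. (\<forall>j. N \<le> j \<longrightarrow> x j = 0) \<and> (\<forall>j<N. -1 \<le> x j \<and> x j \<le> 1)
       \<and> (\<forall>i<m. (\<Sum>j<N. A i j * x j) = b i)}"

definition unique_l1_box_solution :: "nat \<Rightarrow> nat \<Rightarrow> (nat \<Rightarrow> nat \<Rightarrow> real) \<Rightarrow> (nat \<Rightarrow> real) \<Rightarrow> (nat \<Rightarrow> real) \<Rightarrow> bool" where
  "unique_l1_box_solution m N A b x0 \<longleftrightarrow>
     x0 \<in> box_feasible m N A b \<and>
     (\<forall>x \<in> box_feasible m N A b. x \<noteq> x0 \<longrightarrow> l1norm N x0 < l1norm N x)"

definition Delta_pm_ter :: "nat \<Rightarrow> nat \<Rightarrow> real" where
  "Delta_pm_ter N k = (INF \<tau>\<in>{0::real..}.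
      real k * (LBINT u:{..\<tau>}. (u - \<tau>)\<^sup>2 * std_normal_density u)
    + 2 * (real N - real k) * (LBINT u:{\<tau>..}. (u - \<tau>)\<^sup>2 * std_normal_density u))"

end

theory Submission
  imports Defs "HOL-Real_Asymp.Real_Asymp"
begin

text \<open>
  The vector \<open>x0\<close> fails to be the unique minimiser exactly if the kernel of the Gaussian matrix
  \<open>G\<close> meets the compact set \<open>T\<close> of unit vectors in the descent cone. If \<open>m \<ge> N\<close>, the kernel is
  almost surely trivial. If \<open>m < N\<close>, Gordon's comparison of the processes \<open>\<parallel>G z\<parallel> + \<gamma>\<close> and
  \<open>\<parallel>g\<parallel> + \<langle>h, z\<rangle>\<close> (with \<open>g\<close>, \<open>h\<close>, \<open>\<gamma>\<close> standard Gaussian), applied to the decreasing function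
  \<open>exp (- l * t)\<close>, gives for every \<open>l > 0\<close>
  \<open>exp (l\<^sup>2 / 2) * P (ker G meets T) \<le> E (exp (- l * \<parallel>g\<parallel>)) * E (exp (l * sup {- \<langle>h, z\<rangle> | z. z \<in> T}))\<close>.
  The supremum is at most the distance of \<open>- h\<close> to \<open>\<tau>\<close> times the subdifferential (at \<open>x0\<close>) of the \<open>\<ell>\<^sub>1\<close> norm
  plus the indicator of the box; the expected square of this distance is the functional minimised in \<open>\<Delta>\<close>.
  The two moments contribute \<open>l\<^sup>2 / 4 - l * sqrt m\<close> (up to a bounded error)
  and \<open>3 / 4 * l\<^sup>2 + l * sqrt \<Delta>\<close> to the exponent, and \<open>l = sqrt m - sqrt \<Delta>\<close>, which is at least
  \<open>sqrt (2 * ln (4 / \<epsilon>))\<close>, yields the claim; the factor 4 pays for the bounded error.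
\<close>

section \<open>Gaussian integration by parts\<close>

text \<open>The interpolation argument wants finitely many indices and bounded second derivatives,
  whereas the event concerns an uncountable set, a norm that is not differentiable at 0 and an
  indicator. So the norm is regularised by \<open>\<eta>\<close>, the indicator by arctan steps, and
  the compact set is exhausted by finite pieces of a dense sequence; limits remove the last two, and
  \<open>\<eta>\<close> is paid for in the bounded error. The costs \<open>l\<^sup>2 / 4\<close> and
  \<open>3 / 4 * l\<^sup>2\<close> add up to what Gaussian concentration of two 1-Lipschitz
  functions would charge, \<open>l\<^sup>2 / 2\<close> each; here they come from a differential
  inequality for the norm and from one-dimensional integrals for the distance. After the gain
  \<open>l\<^sup>2 / 2\<close> on the left, the exponent is
  \<open>l\<^sup>2 / 2 - l * (sqrt m - sqrt \<Delta>)\<close>; the chosen \<open>l\<close> minimises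
  it, with value \<open>- l\<^sup>2 / 2\<close>. The constant 8 and the factor \<open>N\<close>
  arise from \<open>m - \<Delta> = (sqrt m - sqrt \<Delta>) * (sqrt m + sqrt \<Delta>)\<close>, the
  second factor being at most \<open>2 * sqrt N\<close> if \<open>m \<le> N\<close>. This is why
  large \<open>m\<close> is treated apart.\<close>

abbreviation std_gauss :: "real measure" where
  "std_gauss \<equiv> density lborel std_normal_density"

abbreviation gauss :: "'i set \<Rightarrow> ('i \<Rightarrow> real) measure" where
  "gauss I \<equiv> PiM I (\<lambda>_. std_gauss)"

lemma prob_space_std_gauss: "prob_space std_gauss"
  by (rule prob_space_normal_density) simp

interpretation std_gauss: prob_space std_gauss
  by (rule prob_space_std_gauss)

interpretation gauss: product_sigma_finite "\<lambda>_ :: 'i. std_gauss"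
  by unfold_locales

lemma prob_space_gauss: "prob_space (gauss I)"
  by (rule prob_space_PiM) (rule prob_space_std_gauss)

lemma sets_gauss: "sets (gauss I) = sets (PiM I (\<lambda>_. borel))"
  by (intro sets_PiM_cong) auto

lemma measurable_gauss_component:
  "i \<in> I \<Longrightarrow> (\<lambda>x. x i) \<in> borel_measurable (gauss I)"
  by (subst measurable_cong_sets[OF sets_gauss refl]) (rule measurable_component_singleton)

lemma integrable_std_gauss_iff:
  fixes f :: "real \<Rightarrow> real"
  shows "f \<in> borel_measurable borel \<Longrightarrow>
    integrable std_gauss f \<longleftrightarrow> integrable lborel (\<lambda>x. std_normal_density x * f x)"
  using integrable_density[of f lborel std_normal_density] by simp

lemma integral_std_gauss:
  fixes f :: "real \<Rightarrow> real"
  shows "f \<in> borel_measurable borel \<Longrightarrow>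
    integral\<^sup>L std_gauss f = (\<integral>x. std_normal_density x * f x \<partial>lborel)"
  using integral_density[of f lborel std_normal_density] by simp

lemma integrable_std_gauss_bounded:
  fixes f :: "real \<Rightarrow> real"
  assumes "f \<in> borel_measurable borel" "\<And>x. \<bar>f x\<bar> \<le> C"
  shows "integrable std_gauss f"
  by (rule std_gauss.integrable_const_bound[where B=C]) (use assms in auto)

lemma integrable_gauss_bounded:
  fixes f :: "_ \<Rightarrow> real"
  assumes "f \<in> borel_measurable (gauss I)" "\<And>x. x \<in> space (gauss I) \<Longrightarrow> \<bar>f x\<bar> \<le> C"
  shows "integrable (gauss I) f"
proof -
  interpret prob_space "gauss I" by (rule prob_space_gauss)
  show ?thesis by (rule integrable_const_bound[where B=C]) (use assms in auto)
qed

lemma integrable_std_gauss_id: "integrable std_gauss (\<lambda>x. \<bar>x\<bar>)" "integrable std_gauss (\<lambda>x. x)"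
  using integrable_std_normal_moment_abs[of 1] integrable_std_normal_moment[of 1]
  by (auto simp: integrable_std_gauss_iff)

lemma integrable_gauss_abs_component:
  assumes "finite I" "i \<in> I"
  shows "integrable (gauss I) (\<lambda>x. \<bar>x i\<bar>)"
proof -
  \<comment> \<open>A single coordinate is written as a product over all of \<open>I\<close> with
    the other factors equal to 1, so that integrability of products applies.\<close>
  have "integrable (gauss I) (\<lambda>x. \<Prod>j\<in>I. if j = i then \<bar>x j\<bar> else 1)"
  proof (rule gauss.product_integrable_prod)
    show "integrable std_gauss (\<lambda>y. if j = i then \<bar>y\<bar> else 1)" for j
      by (cases "j = i") (simp_all add: integrable_std_gauss_id)
  qed (fact assms)
  also have "(\<lambda>x. \<Prod>j\<in>I. if j = i then \<bar>x j\<bar> else 1) = (\<lambda>x. \<bar>x i\<bar>)"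
    using assms by (auto simp: prod.delta)
  finally show ?thesis .
qed

lemma std_normal_density_at_infinity:
  "(std_normal_density \<longlongrightarrow> 0) at_top" "(std_normal_density \<longlongrightarrow> 0) at_bot"
proof -
  have "((\<lambda>x::real. (1 / sqrt (2 * pi)) * exp (- x\<^sup>2 / 2)) \<longlongrightarrow> (1 / sqrt (2 * pi)) * 0) F"
    if "filterlim (\<lambda>x::real. - x\<^sup>2 / 2) at_bot F" for F
    by (intro tendsto_mult tendsto_const filterlim_compose[OF exp_at_bot that])
  moreover have "filterlim (\<lambda>x::real. - x\<^sup>2 / 2) at_bot at_top"
    "filterlim (\<lambda>x::real. - x\<^sup>2 / 2) at_bot at_bot"
    by real_asymp+
  ultimately show "(std_normal_density \<longlongrightarrow> 0) at_top" "(std_normal_density \<longlongrightarrow> 0) at_bot"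
    unfolding std_normal_density_def by auto
qed

lemma DERIV_std_normal_density:
  "(std_normal_density has_real_derivative - x * std_normal_density x) (at x)"
  unfolding std_normal_density_def
  by (auto intro!: derivative_eq_intros simp: field_simps)

lemma continuous_std_normal_density: "isCont std_normal_density x"
  using DERIV_std_normal_density by (rule DERIV_isCont)

lemma tendsto_at_left_PInf:
  fixes F :: "real \<Rightarrow> real"
  shows "(F \<longlongrightarrow> l) at_top \<Longrightarrow> ((F \<circ> real_of_ereal) \<longlongrightarrow> l) (at_left \<infinity>)"
  by (simp add: ereal_tendsto_simps)

lemma tendsto_at_right_MInf:
  fixes F :: "real \<Rightarrow> real"
  shows "(F \<longlongrightarrow> l) at_bot \<Longrightarrow> ((F \<circ> real_of_ereal) \<longlongrightarrow> l) (at_right (-\<infinity>))"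
  by (simp add: ereal_tendsto_simps)

text \<open>Stein's identity. The derivative of \<open>std_normal_density x * h x\<close> is
  \<open>std_normal_density x * (h' x - x * h x)\<close>, and it integrates to 0 over the line
  because the density tends to 0 at both ends while \<open>h\<close> stays bounded.\<close>

lemma std_gauss_integration_by_parts:
  fixes h h' :: "real \<Rightarrow> real"
  assumes h: "\<And>x. (h has_real_derivative h' x) (at x)" and h': "\<And>x. isCont h' x"
    and bound: "\<And>x. \<bar>h x\<bar> \<le> C" "\<And>x. \<bar>h' x\<bar> \<le> C"
  shows "(\<integral>x. x * h x \<partial>std_gauss) = (\<integral>x. h' x \<partial>std_gauss)"
proof -
  have ch: "isCont h x" for x using h by (rule DERIV_isCont)
  have mh[measurable]: "h \<in> borel_measurable borel" "h' \<in> borel_measurable borel"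
    using ch h' by (auto intro!: borel_measurable_continuous_onI continuous_at_imp_continuous_on)
  have i1: "integrable std_gauss (\<lambda>x. x * h x)"
  proof (rule Bochner_Integration.integrable_bound)
    show "integrable std_gauss (\<lambda>x. C * \<bar>x\<bar>)"
      using integrable_std_gauss_id by simp
    show "AE x in std_gauss. norm (x * h x) \<le> norm (C * \<bar>x\<bar>)"
      using order_trans[OF bound(1) abs_ge_self]
      by (intro AE_I2) (simp add: abs_mult mult.commute[of "\<bar>C\<bar>"] mult_left_mono)
  qed auto
  have i2: "integrable std_gauss h'"
    by (rule integrable_std_gauss_bounded[where C=C]) (use bound in auto)
  have I1: "integrable lborel (\<lambda>x. std_normal_density x * (x * h x))"
   and I2: "integrable lborel (\<lambda>x. std_normal_density x * h' x)"
    using i1 i2 by (simp_all add: integrable_std_gauss_iff)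
  have lim: "((\<lambda>x. std_normal_density x * h x) \<longlongrightarrow> 0) F"
    if "(std_normal_density \<longlongrightarrow> 0) F" for F
  proof (rule Lim_null_comparison)
    show "\<forall>\<^sub>F x in F. norm (std_normal_density x * h x) \<le> std_normal_density x * C"
      using bound by (intro always_eventually) (auto simp: abs_mult intro!: mult_left_mono)
    show "((\<lambda>x. std_normal_density x * C) \<longlongrightarrow> 0) F"
      using tendsto_mult_left_zero[OF that] .
  qed
  have "(LBINT x=-\<infinity>..\<infinity>. std_normal_density x * h' x - std_normal_density x * (x * h x)) = 0 - 0"
  proof (rule interval_integral_FTC_integrable[where F="\<lambda>x. std_normal_density x * h x"])
    fix x
    show "((\<lambda>x. std_normal_density x * h x) has_vector_derivative
      std_normal_density x * h' x - std_normal_density x * (x * h x)) (at x)"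
      unfolding has_real_derivative_iff_has_vector_derivative[symmetric]
      by (rule derivative_eq_intros DERIV_std_normal_density h)+ (simp add: algebra_simps)
    show "isCont (\<lambda>x. std_normal_density x * h' x - std_normal_density x * (x * h x)) x"
      by (intro continuous_intros continuous_std_normal_density h' ch)
  next
    show "set_integrable lborel (einterval (-\<infinity>) \<infinity>)
      (\<lambda>x. std_normal_density x * h' x - std_normal_density x * (x * h x))"
      using I1 I2 by (simp add: set_integrable_def)
  qed (auto intro!: tendsto_at_left_PInf tendsto_at_right_MInf lim std_normal_density_at_infinity)
  then have "(\<integral>x. std_normal_density x * h' x - std_normal_density x * (x * h x) \<partial>lborel) = 0"
    by (simp add: interval_integral_to_infinity_eq interval_lebesgue_integral_def set_lebesgue_integral_def)
  then show ?thesis using I1 I2 by (simp add: integral_std_gauss)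
qed

text \<open>Fubini isolates coordinate \<open>i\<close>, and Stein's identity is applied with the
  other coordinates frozen. The bounds are uniform, so they hold on every such slice.\<close>

lemma gauss_integration_by_parts:
  fixes h h' :: "('i \<Rightarrow> real) \<Rightarrow> real"
  assumes I: "finite I" "i \<in> I"
    and [measurable]: "h \<in> borel_measurable (gauss I)" "h' \<in> borel_measurable (gauss I)"
    and h: "\<And>x t. ((\<lambda>s. h (x(i := s))) has_real_derivative h' (x(i := t))) (at t)"
    and h': "\<And>x t. isCont (\<lambda>s. h' (x(i := s))) t"
    and bound: "\<And>x. \<bar>h x\<bar> \<le> C" "\<And>x. \<bar>h' x\<bar> \<le> C"
  shows "integrable (gauss I) (\<lambda>x. x i * h x)" "integrable (gauss I) h'"
    "(\<integral>x. x i * h x \<partial>gauss I) = (\<integral>x. h' x \<partial>gauss I)"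
proof -
  obtain J where J: "I = insert i J" "i \<notin> J" "finite J"
    using I by (metis Set.set_insert finite_insert)
  show i1: "integrable (gauss I) (\<lambda>x. x i * h x)"
  proof (rule Bochner_Integration.integrable_bound)
    show "integrable (gauss I) (\<lambda>x. C * \<bar>x i\<bar>)" using integrable_gauss_abs_component[OF I] by simp
    show "AE x in gauss I. norm (x i * h x) \<le> norm (C * \<bar>x i\<bar>)"
      using order_trans[OF bound(1) abs_ge_self]
      by (intro AE_I2) (simp add: abs_mult mult.commute[of "\<bar>C\<bar>"] mult_left_mono)
  qed (use I in measurable)
  show i2: "integrable (gauss I) h'"
    by (rule integrable_gauss_bounded[where C=C]) (use bound in auto)
  have "(\<integral>x. x i * h x \<partial>gauss I) = (\<integral>x. (\<integral>y. (x(i:=y)) i * h (x(i := y)) \<partial>std_gauss) \<partial>gauss J)"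
    unfolding J(1) by (rule gauss.product_integral_insert) (use J i1 in auto)
  also have "\<dots> = (\<integral>x. (\<integral>y. h' (x(i := y)) \<partial>std_gauss) \<partial>gauss J)"
    using std_gauss_integration_by_parts[OF h h' bound] by simp
  also have "\<dots> = (\<integral>x. h' x \<partial>gauss I)"
    unfolding J(1) by (rule gauss.product_integral_insert[symmetric]) (use J i2 in auto)
  finally show "(\<integral>x. x i * h x \<partial>gauss I) = (\<integral>x. h' x \<partial>gauss I)" .
qed

section \<open>Differentiation under the integral sign and independence of blocks\<close>

text \<open>Dominated convergence for difference quotients: by the mean value theorem each quotient
  equals \<open>f' z x\<close> at an intermediate point \<open>z\<close>, hence is dominated by
  \<open>g\<close>.\<close>

lemma has_derivative_integral:
  fixes f f' :: "real \<Rightarrow> 'a \<Rightarrow> real"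
  assumes ab: "t \<in> {a<..<b}"
    and int: "\<And>s. s \<in> {a<..<b} \<Longrightarrow> integrable M (f s)"
    and der: "\<And>s x. s \<in> {a<..<b} \<Longrightarrow> x \<in> space M \<Longrightarrow> ((\<lambda>s. f s x) has_real_derivative f' s x) (at s)"
    and [measurable]: "f' t \<in> borel_measurable M"
    and bound: "\<And>s x. s \<in> {a<..<b} \<Longrightarrow> x \<in> space M \<Longrightarrow> \<bar>f' s x\<bar> \<le> g x"
    and g: "integrable M g"
  shows "((\<lambda>s. \<integral>x. f s x \<partial>M) has_real_derivative (\<integral>x. f' t x \<partial>M)) (at t)"
  unfolding has_field_derivative_iff tendsto_at_iff_sequentially comp_def
proof (intro allI impI)
  fix X :: "nat \<Rightarrow> real" assume X: "\<forall>i. X i \<in> UNIV - {t}" "X \<longlonglongrightarrow> t"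
  have "eventually (\<lambda>n. X n \<in> {a<..<b}) sequentially"
    using X(2) ab by (intro topological_tendstoD) auto
  then obtain n0 where n0: "\<And>n. n \<ge> n0 \<Longrightarrow> X n \<in> {a<..<b}"
    by (auto simp: eventually_sequentially)
  \<comment> \<open>Dropping an initial segment puts the whole sequence into the interval; the shift
    is undone at the end.\<close>
  define Y where "Y n = X (n + n0)" for n
  have Y: "Y n \<in> {a<..<b}" "Y n \<noteq> t" for n using n0 X(1) by (auto simp: Y_def)
  have Yt: "Y \<longlonglongrightarrow> t" unfolding Y_def using X(2) by (rule LIMSEQ_ignore_initial_segment)
  have "(\<lambda>n. \<integral>x. (f (Y n) x - f t x) / (Y n - t) \<partial>M) \<longlonglongrightarrow> (\<integral>x. f' t x \<partial>M)"
  proof (rule integral_dominated_convergence[where w=g])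
    show "(\<lambda>x. (f (Y n) x - f t x) / (Y n - t)) \<in> borel_measurable M" for n
      using int[OF Y(1)[of n]] int[OF ab] by auto
    show "AE x in M. (\<lambda>n. (f (Y n) x - f t x) / (Y n - t)) \<longlonglongrightarrow> f' t x"
    proof (rule AE_I2)
      fix x assume "x \<in> space M"
      from der[OF ab this, unfolded has_field_derivative_iff tendsto_at_iff_sequentially comp_def]
      show "(\<lambda>n. (f (Y n) x - f t x) / (Y n - t)) \<longlonglongrightarrow> f' t x"
        using Y Yt by auto
    qed
    show "AE x in M. norm ((f (Y n) x - f t x) / (Y n - t)) \<le> g x" for n
    proof (rule AE_I2)
      fix x assume x: "x \<in> space M"
      have "\<exists>z. z \<in> {a<..<b} \<and> f (Y n) x - f t x = (Y n - t) * f' z x"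
      proof (cases "Y n < t")
        case True
        have "\<exists>z>Y n. z < t \<and> f t x - f (Y n) x = (t - Y n) * f' z x"
          using True Y[of n] ab by (intro MVT2) (auto intro!: der x)
        then obtain z where "Y n < z" "z < t" "f t x - f (Y n) x = (t - Y n) * f' z x" by blast
        moreover from this have "f (Y n) x - f t x = (Y n - t) * f' z x" by (simp add: algebra_simps)
        ultimately show ?thesis using Y[of n] ab by (intro exI[of _ z]) auto
      next
        case False
        then have "\<exists>z>t. z < Y n \<and> f (Y n) x - f t x = (Y n - t) * f' z x"
          using Y[of n] ab by (intro MVT2) (auto intro!: der x)
        then obtain z where "t < z" "z < Y n" "f (Y n) x - f t x = (Y n - t) * f' z x" by blast
        then show ?thesis using Y[of n] ab by (intro exI[of _ z]) auto
      qed
      then show "norm ((f (Y n) x - f t x) / (Y n - t)) \<le> g x"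
        using bound x Y[of n] by (auto simp: abs_mult)
    qed
  qed (use g in auto)
  also have "(\<lambda>n. \<integral>x. (f (Y n) x - f t x) / (Y n - t) \<partial>M)
    = (\<lambda>n. ((\<integral>x. f (Y n) x \<partial>M) - (\<integral>x. f t x \<partial>M)) / (Y n - t))"
    using int[OF Y(1)] int[OF ab] by (auto simp: Bochner_Integration.integral_diff)
  finally show "(\<lambda>n. ((\<integral>x. f (X n) x \<partial>M) - (\<integral>x. f t x \<partial>M)) / (X n - t)) \<longlonglongrightarrow> (\<integral>x. f' t x \<partial>M)"
    unfolding Y_def by (rule LIMSEQ_offset)
qed


text \<open>Independence of disjoint blocks of coordinates. Arrays are total functions, so the same
  \<open>f\<close> can be read on the large and on the small product space; the locality conditions
  say that it does not see values outside its own block.\<close>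

lemma nn_integral_gauss_Un:
  fixes f g :: "('i \<Rightarrow> real) \<Rightarrow> ennreal"
  assumes IJ: "finite I" "finite J" "I \<inter> J = {}"
    and [measurable]: "f \<in> borel_measurable (gauss (I \<union> J))" "g \<in> borel_measurable (gauss (I \<union> J))"
      "f \<in> borel_measurable (gauss I)" "g \<in> borel_measurable (gauss J)"
    and f: "\<And>x y. (\<And>i. i \<in> I \<Longrightarrow> x i = y i) \<Longrightarrow> f x = f y"
    and g: "\<And>x y. (\<And>i. i \<in> J \<Longrightarrow> x i = y i) \<Longrightarrow> g x = g y"
  shows "(\<integral>\<^sup>+x. f x * g x \<partial>gauss (I \<union> J)) = (\<integral>\<^sup>+x. f x \<partial>gauss I) * (\<integral>\<^sup>+x. g x \<partial>gauss J)"
proof -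
  have "(\<integral>\<^sup>+x. f x * g x \<partial>gauss (I \<union> J)) =
    (\<integral>\<^sup>+x. (\<integral>\<^sup>+y. f (merge I J (x, y)) * g (merge I J (x, y)) \<partial>gauss J) \<partial>gauss I)"
    by (rule gauss.product_nn_integral_fold) (use IJ in auto)
  also have "\<dots> = (\<integral>\<^sup>+x. (\<integral>\<^sup>+y. f x * g y \<partial>gauss J) \<partial>gauss I)"
  proof -
    have "f (merge I J (x, y)) = f x" "g (merge I J (x, y)) = g y" for x y
      using IJ by (intro f g; auto simp: merge_def)+
    then show ?thesis by simp
  qed
  also have "\<dots> = (\<integral>\<^sup>+x. f x \<partial>gauss I) * (\<integral>\<^sup>+x. g x \<partial>gauss J)"
    by (simp add: nn_integral_cmult nn_integral_multc)
  finally show ?thesis .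
qed

text \<open>The coordinates outside \<open>I\<close> integrate to 1; this is the product formula
  with a constant second factor.\<close>

lemma nn_integral_gauss_subset:
  fixes f :: "('i \<Rightarrow> real) \<Rightarrow> ennreal"
  assumes "finite K" "I \<subseteq> K"
    and f: "f \<in> borel_measurable (gauss K)" "f \<in> borel_measurable (gauss I)"
    and loc: "\<And>x y. (\<And>i. i \<in> I \<Longrightarrow> x i = y i) \<Longrightarrow> f x = f y"
  shows "(\<integral>\<^sup>+x. f x \<partial>gauss K) = (\<integral>\<^sup>+x. f x \<partial>gauss I)"
proof -
  interpret P: prob_space "gauss (K - I)" by (rule prob_space_gauss)
  have K: "I \<union> (K - I) = K" and fin: "finite I" using assms by (auto intro: finite_subset)
  have "(\<integral>\<^sup>+x. f x * 1 \<partial>gauss (I \<union> (K - I))) = (\<integral>\<^sup>+x. f x \<partial>gauss I) * (\<integral>\<^sup>+x. 1 \<partial>gauss (K - I))"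
    by (rule nn_integral_gauss_Un[OF fin _ _ _ _ f(2) _ loc]) (use assms(1,2) f(1) in \<open>simp_all add: Un_absorb1\<close>)
  then show ?thesis using assms(2) by (simp add: P.emeasure_space_1 Un_absorb1)
qed

section \<open>Gordon's comparison inequality\<close>

text \<open>Each coordinate \<open>p\<close> contributes to \<open>X \<theta>\<close> with an angle-dependent factor, below sine or cosine.
  Integration by parts in every coordinate turns the derivative into second derivatives of \<open>F\<close>
  weighted by the derivative of the covariance of \<open>X \<theta>\<close>.\<close>
lemma gauss_interpolation_derivative:
  fixes a :: "'t \<Rightarrow> 'i \<Rightarrow> real" and s s' :: "'i \<Rightarrow> real \<Rightarrow> real"
    and F :: "('t \<Rightarrow> real) \<Rightarrow> real" and F1 :: "'t \<Rightarrow> ('t \<Rightarrow> real) \<Rightarrow> real"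
    and F2 :: "'t \<Rightarrow> 't \<Rightarrow> ('t \<Rightarrow> real) \<Rightarrow> real"
    and I :: "'i set" and T :: "'t set" and C \<theta> :: real
  defines "X \<equiv> \<lambda>\<theta> u t. \<Sum>p\<in>I. a t p * s p \<theta> * u p"
  assumes fin: "finite I" "finite T"
    and s: "\<And>p \<theta>. (s p has_real_derivative s' p \<theta>) (at \<theta>)" "\<And>p \<theta>. \<bar>s' p \<theta>\<bar> \<le> 1"
    and meas:
      "\<And>Y. (\<And>t. t \<in> T \<Longrightarrow> Y t \<in> borel_measurable (gauss I)) \<Longrightarrow> (\<lambda>u. F (\<lambda>t. Y t u)) \<in> borel_measurable (gauss I)"
      "\<And>t Y. t \<in> T \<Longrightarrow> (\<And>t. t \<in> T \<Longrightarrow> Y t \<in> borel_measurable (gauss I)) \<Longrightarrow>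
        (\<lambda>u. F1 t (\<lambda>t. Y t u)) \<in> borel_measurable (gauss I)"
      "\<And>t t' Y. t \<in> T \<Longrightarrow> t' \<in> T \<Longrightarrow> (\<And>t. t \<in> T \<Longrightarrow> Y t \<in> borel_measurable (gauss I)) \<Longrightarrow>
        (\<lambda>u. F2 t t' (\<lambda>t. Y t u)) \<in> borel_measurable (gauss I)"
    and F_der: "\<And>c c' r. (\<And>t. t \<in> T \<Longrightarrow> (c t has_real_derivative c' t) (at r)) \<Longrightarrow>
      ((\<lambda>r. F (\<lambda>t. c t r)) has_real_derivative (\<Sum>t\<in>T. F1 t (\<lambda>t. c t r) * c' t)) (at r)"
    and F1_der: "\<And>t c c' r. t \<in> T \<Longrightarrow> (\<And>t. t \<in> T \<Longrightarrow> (c t has_real_derivative c' t) (at r)) \<Longrightarrow>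
      ((\<lambda>r. F1 t (\<lambda>t. c t r)) has_real_derivative (\<Sum>t'\<in>T. F2 t t' (\<lambda>t. c t r) * c' t')) (at r)"
    and F2_cont: "\<And>t t' c (r::real). t \<in> T \<Longrightarrow> t' \<in> T \<Longrightarrow> (\<And>t. t \<in> T \<Longrightarrow> isCont (c t) r) \<Longrightarrow>
      isCont (\<lambda>r. F2 t t' (\<lambda>t. c t r)) r"
    and bound: "\<And>x. \<bar>F x\<bar> \<le> C" "\<And>t x. t \<in> T \<Longrightarrow> \<bar>F1 t x\<bar> \<le> C"
      "\<And>t t' x. t \<in> T \<Longrightarrow> t' \<in> T \<Longrightarrow> \<bar>F2 t t' x\<bar> \<le> C"
  shows "((\<lambda>\<theta>. \<integral>u. F (X \<theta> u) \<partial>gauss I) has_real_derivative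
     (\<Sum>t\<in>T. \<Sum>t'\<in>T. (\<Sum>p\<in>I. a t p * a t' p * (s p \<theta> * s' p \<theta>)) * (\<integral>u. F2 t t' (X \<theta> u) \<partial>gauss I)))
     (at \<theta>)"
proof -
  have C0: "0 \<le> C" using bound(1)[of "\<lambda>_. 0"] by linarith
  have mX: "(\<lambda>u. X \<theta> u t) \<in> borel_measurable (gauss I)" for \<theta> t
    unfolding X_def using fin by measurable
  have mF: "(\<lambda>u. F (X \<theta> u)) \<in> borel_measurable (gauss I)" for \<theta>
    using meas(1)[of "\<lambda>t u. X \<theta> u t"] mX by simp
  have mF1: "(\<lambda>u. F1 t (X \<theta> u)) \<in> borel_measurable (gauss I)" if "t \<in> T" for \<theta> t
    using meas(2)[OF that, of "\<lambda>t u. X \<theta> u t"] mX by simp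
  have mF2: "(\<lambda>u. F2 t t' (X \<theta> u)) \<in> borel_measurable (gauss I)" if "t \<in> T" "t' \<in> T" for \<theta> t t'
    using meas(3)[OF that, of "\<lambda>t u. X \<theta> u t"] mX by simp
  have mc: "(\<lambda>u. u p) \<in> borel_measurable (gauss I)" if "p \<in> I" for p
    using that by measurable
  define f' where "f' \<theta> u = (\<Sum>t\<in>T. F1 t (X \<theta> u) * (\<Sum>p\<in>I. a t p * s' p \<theta> * u p))" for \<theta> u
  have d1: "((\<lambda>\<theta>. \<integral>u. F (X \<theta> u) \<partial>gauss I) has_real_derivative (\<integral>u. f' \<theta> u \<partial>gauss I)) (at \<theta>)"
  proof (rule has_derivative_integral[where a="\<theta> - 1" and b="\<theta> + 1"])
    show "integrable (gauss I) (\<lambda>u. F (X \<theta> u))" for \<theta>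
      by (rule integrable_gauss_bounded[OF mF bound(1)])
    show "((\<lambda>\<theta>. F (X \<theta> u)) has_real_derivative f' \<theta> u) (at \<theta>)" for \<theta> u
      unfolding f'_def
      by (rule F_der[where c="\<lambda>t \<theta>. X \<theta> u t"]) (auto simp: X_def mult_ac intro!: derivative_eq_intros s)
    show "f' \<theta> \<in> borel_measurable (gauss I)"
      unfolding f'_def by (intro borel_measurable_sum borel_measurable_times mF1 mc borel_measurable_const)
    \<comment> \<open>The bound on \<open>s'\<close> makes the dominating function independent of
      the angle; it is integrable because Gaussians have first moments.\<close>
    show "\<bar>f' \<theta> u\<bar> \<le> (\<Sum>t\<in>T. C * (\<Sum>p\<in>I. \<bar>a t p\<bar> * \<bar>u p\<bar>))" for \<theta> u
      unfolding f'_def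
    proof (intro order_trans[OF sum_abs] sum_mono)
      fix t assume t: "t \<in> T"
      have "\<bar>\<Sum>p\<in>I. a t p * s' p \<theta> * u p\<bar> \<le> (\<Sum>p\<in>I. \<bar>a t p\<bar> * \<bar>u p\<bar>)"
      proof (intro order_trans[OF sum_abs] sum_mono)
        fix p
        have "\<bar>a t p\<bar> * \<bar>u p\<bar> * \<bar>s' p \<theta>\<bar> \<le> \<bar>a t p\<bar> * \<bar>u p\<bar> * 1"
          by (intro mult_left_mono s(2)) auto
        then show "\<bar>a t p * s' p \<theta> * u p\<bar> \<le> \<bar>a t p\<bar> * \<bar>u p\<bar>"
          by (simp add: abs_mult mult_ac)
      qed
      then show "\<bar>F1 t (X \<theta> u) * (\<Sum>p\<in>I. a t p * s' p \<theta> * u p)\<bar> \<le> C * (\<Sum>p\<in>I. \<bar>a t p\<bar> * \<bar>u p\<bar>)"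
        unfolding abs_mult by (intro mult_mono bound(2) t C0) auto
    qed
    show "integrable (gauss I) (\<lambda>u. \<Sum>t\<in>T. C * (\<Sum>p\<in>I. \<bar>a t p\<bar> * \<bar>u p\<bar>))"
      by (intro Bochner_Integration.integrable_sum integrable_mult_right integrable_gauss_abs_component fin)
  qed auto
  \<comment> \<open>The Gaussian factor \<open>u p\<close> left over by the chain rule is traded for
    a derivative in direction \<open>p\<close>, which produces \<open>F2\<close> together with the
    coefficient \<open>a t' p * s p \<theta>\<close>.\<close>
  have ibp: "integrable (gauss I) (\<lambda>u. u p * F1 t (X \<theta> u))"
    "(\<integral>u. u p * F1 t (X \<theta> u) \<partial>gauss I) = (\<Sum>t'\<in>T. a t' p * s p \<theta> * (\<integral>u. F2 t t' (X \<theta> u) \<partial>gauss I))"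
    if t: "t \<in> T" and p: "p \<in> I" for t p
  proof -
    define h' where "h' u = (\<Sum>t'\<in>T. F2 t t' (X \<theta> u) * (a t' p * s p \<theta>))" for u
    \<comment> \<open>Integration by parts asks for one constant that bounds both the function and
      its partial derivative.\<close>
    define D where "D = C + (\<Sum>t'\<in>T. C * \<bar>a t' p * s p \<theta>\<bar>)"
    have D: "C \<le> D" "(\<Sum>t'\<in>T. C * \<bar>a t' p * s p \<theta>\<bar>) \<le> D"
      using C0 by (auto simp: D_def intro!: sum_nonneg)
    have Xd: "((\<lambda>r. X \<theta> (u(p := r)) t') has_real_derivative a t' p * s p \<theta>) (at r)" for u t' r
    proof -
      have "X \<theta> (u(p := r)) t' = a t' p * s p \<theta> * r + (\<Sum>q\<in>I - {p}. a t' q * s q \<theta> * u q)" for r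
        unfolding X_def using fin p by (subst sum.remove[of I p]) (auto intro!: sum.cong)
      then show ?thesis by (auto intro!: derivative_eq_intros)
    qed
    have hm: "h' \<in> borel_measurable (gauss I)"
      unfolding h'_def by (intro borel_measurable_sum borel_measurable_times mF2 t borel_measurable_const)
    have I2: "integrable (gauss I) (\<lambda>u. F2 t t' (X \<theta> u))" if "t' \<in> T" for t'
      by (rule integrable_gauss_bounded[OF mF2 bound(3)]) (use t that in auto)
    have hd: "((\<lambda>r. F1 t (X \<theta> (u(p := r)))) has_real_derivative h' (u(p := r))) (at r)" for u r
      unfolding h'_def using Xd by (intro F1_der[OF t, where c="\<lambda>t r. X \<theta> (u(p := r)) t"])
    have hc: "isCont (\<lambda>r. h' (u(p := r))) r" for u r
      unfolding h'_def using Xd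
      by (intro continuous_intros F2_cont[where c="\<lambda>t r. X \<theta> (u(p := r)) t"] t) (auto intro: DERIV_isCont)
    have b1: "\<bar>F1 t (X \<theta> u)\<bar> \<le> D" for u using bound(2)[OF t] D(1) by (rule order_trans)
    have b2: "\<bar>h' u\<bar> \<le> D" for u
      unfolding h'_def
      by (rule order_trans[OF sum_abs order_trans[OF sum_mono D(2)]])
        (auto simp: abs_mult intro!: mult_right_mono bound(3) t)
    note ibp = gauss_integration_by_parts[OF fin(1) p mF1[OF t] hm hd hc b1 b2]
    show "integrable (gauss I) (\<lambda>u. u p * F1 t (X \<theta> u))" by (rule ibp)
    show "(\<integral>u. u p * F1 t (X \<theta> u) \<partial>gauss I) = (\<Sum>t'\<in>T. a t' p * s p \<theta> * (\<integral>u. F2 t t' (X \<theta> u) \<partial>gauss I))"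
      unfolding ibp(3) unfolding h'_def
      by (subst Bochner_Integration.integral_sum) (auto intro!: I2 simp: mult.commute)
  qed
  have "(\<integral>u. f' \<theta> u \<partial>gauss I) = (\<integral>u. (\<Sum>t\<in>T. \<Sum>p\<in>I. a t p * s' p \<theta> * (u p * F1 t (X \<theta> u))) \<partial>gauss I)"
    unfolding f'_def by (simp add: sum_distrib_left mult_ac)
  also have "\<dots> = (\<Sum>t\<in>T. \<Sum>p\<in>I. a t p * s' p \<theta> * (\<integral>u. u p * F1 t (X \<theta> u) \<partial>gauss I))"
    by (simp add: Bochner_Integration.integral_sum ibp(1))
  also have "\<dots> = (\<Sum>t\<in>T. \<Sum>p\<in>I. \<Sum>t'\<in>T. a t p * a t' p * (s p \<theta> * s' p \<theta>) * (\<integral>u. F2 t t' (X \<theta> u) \<partial>gauss I))"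
    by (intro sum.cong refl) (simp add: ibp(2) sum_distrib_left mult_ac)
  also have "\<dots> = (\<Sum>t\<in>T. \<Sum>t'\<in>T. (\<Sum>p\<in>I. a t p * a t' p * (s p \<theta> * s' p \<theta>)) * (\<integral>u. F2 t t' (X \<theta> u) \<partial>gauss I))"
    by (intro sum.cong refl, subst sum.swap) (simp add: sum_distrib_right)
  finally show ?thesis using d1 by simp
qed


text \<open>All Gaussians live in one extended array indexed by \<open>{..m} \<times> {..N}\<close>: the entries with \<open>i < m\<close>,
  \<open>j < N\<close> form the matrix \<open>G\<close>, column \<open>N\<close> is the vector \<open>g\<close>, row \<open>m\<close> is the vector \<open>h\<close> and the
  corner \<open>(m, N)\<close> is the extra scalar \<open>\<gamma>\<close>. The path rotates \<open>(g, \<langle>h, z\<rangle>)\<close> into \<open>(G z, \<gamma>)\<close>; as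
  \<open>z\<close> is a unit vector, the covariances of one and the same \<open>z\<close> do not change, so that only
  mixed second derivatives for distinct \<open>z\<close> survive, and \<open>cone\<close> gives them a sign.\<close>
lemma gordon_comparison_smooth:
  fixes z :: "'l \<Rightarrow> nat \<Rightarrow> real" and \<psi> :: "(nat \<Rightarrow> real) \<Rightarrow> real"
    and \<psi>1 :: "nat \<Rightarrow> (nat \<Rightarrow> real) \<Rightarrow> real" and \<psi>2 :: "nat \<Rightarrow> nat \<Rightarrow> (nat \<Rightarrow> real) \<Rightarrow> real"
    and m N :: nat and C :: real
  defines "I \<equiv> {..m} \<times> {..N}"
  assumes L: "finite L" and unit: "\<And>l. l \<in> L \<Longrightarrow> (\<Sum>j<N. (z l j)\<^sup>2) = 1"
    and loc: "\<And>v w. (\<And>i. i \<le> m \<Longrightarrow> v i = w i) \<Longrightarrow> \<psi> v = \<psi> w"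
    and meas:
      "\<And>Y. (\<And>i. i \<le> m \<Longrightarrow> Y i \<in> borel_measurable (gauss I)) \<Longrightarrow> (\<lambda>u. \<psi> (\<lambda>i. Y i u)) \<in> borel_measurable (gauss I)"
      "\<And>i Y. i \<le> m \<Longrightarrow> (\<And>i. i \<le> m \<Longrightarrow> Y i \<in> borel_measurable (gauss I)) \<Longrightarrow>
        (\<lambda>u. \<psi>1 i (\<lambda>i. Y i u)) \<in> borel_measurable (gauss I)"
      "\<And>i i' Y. i \<le> m \<Longrightarrow> i' \<le> m \<Longrightarrow> (\<And>i. i \<le> m \<Longrightarrow> Y i \<in> borel_measurable (gauss I)) \<Longrightarrow>
        (\<lambda>u. \<psi>2 i i' (\<lambda>i. Y i u)) \<in> borel_measurable (gauss I)"
    and der: "\<And>c c' r. (\<And>i. i \<le> m \<Longrightarrow> (c i has_real_derivative c' i) (at r)) \<Longrightarrow>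
      ((\<lambda>r. \<psi> (\<lambda>i. c i r)) has_real_derivative (\<Sum>i\<le>m. \<psi>1 i (\<lambda>i. c i r) * c' i)) (at r)"
    and der1: "\<And>i c c' r. i \<le> m \<Longrightarrow> (\<And>i. i \<le> m \<Longrightarrow> (c i has_real_derivative c' i) (at r)) \<Longrightarrow>
      ((\<lambda>r. \<psi>1 i (\<lambda>i. c i r)) has_real_derivative (\<Sum>i'\<le>m. \<psi>2 i i' (\<lambda>i. c i r) * c' i')) (at r)"
    and cont: "\<And>c (r::real). (\<And>i. i \<le> m \<Longrightarrow> isCont (c i) r) \<Longrightarrow> isCont (\<lambda>r. \<psi> (\<lambda>i. c i r)) r"
      "\<And>i c (r::real). i \<le> m \<Longrightarrow> (\<And>i. i \<le> m \<Longrightarrow> isCont (c i) r) \<Longrightarrow> isCont (\<lambda>r. \<psi>1 i (\<lambda>i. c i r)) r"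
      "\<And>i i' c (r::real). i \<le> m \<Longrightarrow> i' \<le> m \<Longrightarrow> (\<And>i. i \<le> m \<Longrightarrow> isCont (c i) r) \<Longrightarrow>
        isCont (\<lambda>r. \<psi>2 i i' (\<lambda>i. c i r)) r"
    and bound: "\<And>v. 0 \<le> \<psi> v" "\<And>v. \<psi> v \<le> 1" "\<And>i v. i \<le> m \<Longrightarrow> \<bar>\<psi>1 i v\<bar> \<le> C"
      "\<And>i i' v. i \<le> m \<Longrightarrow> i' \<le> m \<Longrightarrow> \<bar>\<psi>2 i i' v\<bar> \<le> C"
    and cone: "\<And>v w. (\<Sum>i<m. \<psi>1 i v * \<psi>1 i w) \<le> \<psi>1 m v * \<psi>1 m w"
  shows "(\<integral>u. (\<Prod>l\<in>L. \<psi> (\<lambda>i. if i < m then u (i, N) else \<Sum>j<N. u (m, j) * z l j)) \<partial>gauss I) \<le>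
    (\<integral>u. (\<Prod>l\<in>L. \<psi> (\<lambda>i. if i < m then \<Sum>j<N. u (i, j) * z l j else u (m, N))) \<partial>gauss I)"
proof -
  \<comment> \<open>Index \<open>(l, i)\<close> stands for coordinate \<open>i\<close> of the
    process at the vector \<open>z l\<close>; coordinate \<open>m\<close> is the scalar
    part.\<close>
  define T where "T = L \<times> {..m}"
  define P where "P A x = (\<Prod>k\<in>A. \<psi> (\<lambda>i. x (k, i)))" for A and x :: "'l \<times> nat \<Rightarrow> real"
  define F1 where "F1 t x = \<psi>1 (snd t) (\<lambda>i. x (fst t, i)) * P (L - {fst t}) x" for t x
  define F2 where "F2 t t' x = (if fst t = fst t'
      then \<psi>2 (snd t) (snd t') (\<lambda>i. x (fst t, i)) * P (L - {fst t}) x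
      else \<psi>1 (snd t) (\<lambda>i. x (fst t, i)) * \<psi>1 (snd t') (\<lambda>i. x (fst t', i)) * P (L - {fst t} - {fst t'}) x)" for t t' x
  \<comment> \<open>Weight 1 in column \<open>N\<close> lets \<open>g\<close> and
    \<open>\<gamma>\<close> enter with a coefficient that does not depend on
    \<open>z\<close>.\<close>
  define w where "w l j = (if j < N then z l j else 1)" for l j
  define a where "a t p = (if fst p = snd t then w (fst t) (snd p) else 0)" for t :: "'l \<times> nat" and p :: "nat \<times> nat"
  \<comment> \<open>The test holds for the entries of \<open>G\<close> and for the corner
    \<open>\<gamma>\<close>: they carry the sine and are absent at angle 0. The vectors
    \<open>g\<close> and \<open>h\<close> carry the cosine and are absent at
    \<open>pi / 2\<close>.\<close>
  define s where "s p = (if fst p < m \<longleftrightarrow> snd p < N then sin else cos :: real \<Rightarrow> real)" for p :: "nat \<times> nat"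
  define s' where "s' p = (if fst p < m \<longleftrightarrow> snd p < N then cos else (\<lambda>\<theta>::real. - sin \<theta>))" for p :: "nat \<times> nat"
  define X where "X \<theta> u t = (\<Sum>p\<in>I. a t p * s p \<theta> * u p)" for \<theta> u t
  define E where "E t t' \<theta> = (\<integral>u. F2 t t' (X \<theta> u) \<partial>gauss I)" for t t' \<theta>
  \<comment> \<open>Large enough for second derivatives, for products of two first derivatives and
    for \<open>P\<close> itself.\<close>
  define D where "D = C\<^sup>2 + C + 1"
  have C0: "0 \<le> C" using bound(3)[of 0 "\<lambda>_. 0"] by linarith
  have finI: "finite I" and finT: "finite T" using L by (auto simp: I_def T_def)
  have P01: "0 \<le> P A x" "P A x \<le> 1" for A x
    unfolding P_def using bound by (auto intro!: prod_nonneg prod_le_1)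
  have mP: "(\<lambda>u. P A (\<lambda>t. Y t u)) \<in> borel_measurable (gauss I)"
    if "\<And>t. t \<in> T \<Longrightarrow> Y t \<in> borel_measurable (gauss I)" "A \<subseteq> L" for Y A
    unfolding P_def
    by (intro borel_measurable_prod meas(1)[where Y="\<lambda>i. Y (_, i)"]) (use that in \<open>auto simp: T_def\<close>)
  have dP: "((\<lambda>r. P A (\<lambda>t. c t r)) has_real_derivative
      (\<Sum>k\<in>A. (\<Sum>i\<le>m. \<psi>1 i (\<lambda>i. c (k, i) r) * c' (k, i)) * P (A - {k}) (\<lambda>t. c t r))) (at r)"
    if "\<And>t. t \<in> T \<Longrightarrow> (c t has_real_derivative c' t) (at r)" "A \<subseteq> L" for c c' r A
    unfolding P_def
    by (intro has_field_derivative_prod der[where c="\<lambda>i. c (_, i)"]) (use that in \<open>auto simp: T_def\<close>)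
  have cP: "isCont (\<lambda>r. P A (\<lambda>t. c t r)) r"
    if "\<And>t. t \<in> T \<Longrightarrow> isCont (c t) r" "A \<subseteq> L" for c and r :: real and A
    unfolding P_def
    by (intro continuous_prod cont(1)[where c="\<lambda>i. c (_, i)"]) (use that in \<open>auto simp: T_def\<close>)
    have mF2: "(\<lambda>u. F2 t t' (\<lambda>t. Y t u)) \<in> borel_measurable (gauss I)"
      if "t \<in> T" "t' \<in> T" "\<And>t. t \<in> T \<Longrightarrow> Y t \<in> borel_measurable (gauss I)" for t t' Y
    proof (cases "fst t = fst t'")
      case True then show ?thesis unfolding F2_def
        by (simp, intro borel_measurable_times mP meas(3)[where Y="\<lambda>i. Y (_, i)"]) (use that in \<open>auto simp: T_def\<close>)
    next
      case False then show ?thesis unfolding F2_def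
        by (simp, intro borel_measurable_times mP meas(2)[where Y="\<lambda>i. Y (_, i)"]) (use that in \<open>auto simp: T_def\<close>)
    qed
    have CD: "C \<le> D" "C * C \<le> D" "1 \<le> D" using C0 by (auto simp: D_def power2_eq_square)
    have bP: "\<bar>y * P A x\<bar> \<le> D" if "\<bar>y\<bar> \<le> D" for y A x
      using mult_mono[OF that P01(2)[of A x]] P01(1)[of A x] CD by (auto simp: abs_mult)
    have bF2: "\<bar>F2 t t' x\<bar> \<le> D" if "t \<in> T" "t' \<in> T" for t t' x
    proof (cases "fst t = fst t'")
      case True then show ?thesis unfolding F2_def
        by (simp, intro bP order_trans[OF bound(4) CD(1)]) (use that in \<open>auto simp: T_def\<close>)
    next
      case False
      have "\<bar>\<psi>1 (snd t) (\<lambda>i. x (fst t, i)) * \<psi>1 (snd t') (\<lambda>i. x (fst t', i))\<bar> \<le> C * C"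
        unfolding abs_mult by (intro mult_mono bound(3)) (use that C0 in \<open>auto simp: T_def\<close>)
      with False show ?thesis unfolding F2_def
        by (simp, intro bP order_trans[OF _ CD(2)]) auto
    qed
  have der_I: "((\<lambda>\<theta>. \<integral>u. P L (X \<theta> u) \<partial>gauss I) has_real_derivative
     (\<Sum>t\<in>T. \<Sum>t'\<in>T. (\<Sum>p\<in>I. a t p * a t' p * (s p \<theta> * s' p \<theta>)) * E t t' \<theta>)) (at \<theta>)" for \<theta>
    unfolding X_def E_def
  proof (rule gauss_interpolation_derivative[where F="P L" and ?F1.0=F1 and ?F2.0=F2 and C=D])
    show "finite I" "finite T" by fact+
    show "(s p has_real_derivative s' p \<theta>) (at \<theta>)" "\<bar>s' p \<theta>\<bar> \<le> 1" for p \<theta>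
      by (auto simp: s_def s'_def intro!: derivative_eq_intros)
    show "(\<lambda>u. P L (\<lambda>t. Y t u)) \<in> borel_measurable (gauss I)"
      if "\<And>t. t \<in> T \<Longrightarrow> Y t \<in> borel_measurable (gauss I)" for Y
      by (rule mP) (use that in auto)
    show "(\<lambda>u. F1 t (\<lambda>t. Y t u)) \<in> borel_measurable (gauss I)"
      if "t \<in> T" "\<And>t. t \<in> T \<Longrightarrow> Y t \<in> borel_measurable (gauss I)" for t Y
      unfolding F1_def
      by (intro borel_measurable_times mP meas(2)[where Y="\<lambda>i. Y (_, i)"]) (use that in \<open>auto simp: T_def\<close>)
    show "(\<lambda>u. F2 t t' (\<lambda>t. Y t u)) \<in> borel_measurable (gauss I)"
      if "t \<in> T" "t' \<in> T" "\<And>t. t \<in> T \<Longrightarrow> Y t \<in> borel_measurable (gauss I)" for t t' Y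
      using that by (rule mF2)
    show "((\<lambda>r. P L (\<lambda>t. c t r)) has_real_derivative (\<Sum>t\<in>T. F1 t (\<lambda>t. c t r) * c' t)) (at r)"
      if "\<And>t. t \<in> T \<Longrightarrow> (c t has_real_derivative c' t) (at r)" for c c' r
    proof -
      have "(\<Sum>t\<in>T. F1 t (\<lambda>t. c t r) * c' t) =
        (\<Sum>k\<in>L. (\<Sum>i\<le>m. \<psi>1 i (\<lambda>i. c (k, i) r) * c' (k, i)) * P (L - {k}) (\<lambda>t. c t r))"
        unfolding T_def F1_def sum.cartesian_product' by (simp add: sum_distrib_left sum_distrib_right mult_ac)
      then show ?thesis using dP[OF that, where A=L] by simp
    qed
    show "((\<lambda>r. F1 t (\<lambda>t. c t r)) has_real_derivative (\<Sum>t'\<in>T. F2 t t' (\<lambda>t. c t r) * c' t')) (at r)"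
      if t: "t \<in> T" and c: "\<And>t. t \<in> T \<Longrightarrow> (c t has_real_derivative c' t) (at r)" for t c c' r
    proof -
      obtain l i where li: "t = (l, i)" "l \<in> L" "i \<le> m" using t by (auto simp: T_def)
      let ?P = "\<lambda>A. P A (\<lambda>t. c t r)"
      have "((\<lambda>r. F1 t (\<lambda>t. c t r)) has_real_derivative
        ((\<Sum>i'\<le>m. \<psi>2 i i' (\<lambda>i. c (l, i) r) * c' (l, i')) * ?P (L - {l}) +
        (\<Sum>k\<in>L - {l}. (\<Sum>i\<le>m. \<psi>1 i (\<lambda>i. c (k, i) r) * c' (k, i)) * ?P (L - {l} - {k})) * \<psi>1 i (\<lambda>i. c (l, i) r))) (at r)"
        unfolding F1_def li fst_conv snd_conv
      proof (rule DERIV_mult)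
        show "((\<lambda>r. \<psi>1 i (\<lambda>i. c (l, i) r)) has_real_derivative
          (\<Sum>i'\<le>m. \<psi>2 i i' (\<lambda>i. c (l, i) r) * c' (l, i'))) (at r)"
          by (rule der1[where c="\<lambda>i. c (l, i)"]) (use li c in \<open>auto simp: T_def\<close>)
        show "((\<lambda>r. P (L - {l}) (\<lambda>t. c t r)) has_real_derivative
          (\<Sum>k\<in>L - {l}. (\<Sum>i\<le>m. \<psi>1 i (\<lambda>i. c (k, i) r) * c' (k, i)) * ?P (L - {l} - {k}))) (at r)"
          by (rule dP) (use c in auto)
      qed
      also have "(\<Sum>i'\<le>m. \<psi>2 i i' (\<lambda>i. c (l, i) r) * c' (l, i')) * ?P (L - {l}) =
        (\<Sum>i'\<le>m. F2 t (l, i') (\<lambda>t. c t r) * c' (l, i'))"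
        unfolding F2_def li by (simp add: sum_distrib_left sum_distrib_right mult_ac)
      also have "(\<Sum>k\<in>L - {l}. (\<Sum>i\<le>m. \<psi>1 i (\<lambda>i. c (k, i) r) * c' (k, i)) * ?P (L - {l} - {k})) * \<psi>1 i (\<lambda>i. c (l, i) r) =
        (\<Sum>k\<in>L - {l}. (\<Sum>i'\<le>m. F2 t (k, i') (\<lambda>t. c t r) * c' (k, i')))"
        unfolding sum_distrib_right
        by (intro sum.cong refl) (auto simp: F2_def li sum_distrib_left sum_distrib_right mult_ac)
      also have "(\<Sum>i'\<le>m. F2 t (l, i') (\<lambda>t. c t r) * c' (l, i')) + \<dots> =
        (\<Sum>k\<in>L. (\<Sum>i'\<le>m. F2 t (k, i') (\<lambda>t. c t r) * c' (k, i')))"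
        by (rule sum.remove[symmetric]) (use L li in auto)
      also have "\<dots> = (\<Sum>t'\<in>T. F2 t t' (\<lambda>t. c t r) * c' t')"
        unfolding T_def sum.cartesian_product' by simp
      finally show ?thesis .
    qed
    show "isCont (\<lambda>r. F2 t t' (\<lambda>t. c t r)) r"
      if "t \<in> T" "t' \<in> T" "\<And>t. t \<in> T \<Longrightarrow> isCont (c t) r" for t t' c and r :: real
    proof (cases "fst t = fst t'")
      case True then show ?thesis unfolding F2_def
        by (simp, intro continuous_mult cP cont(3)[where c="\<lambda>i. c (_, i)"]) (use that in \<open>auto simp: T_def\<close>)
    next
      case False then show ?thesis unfolding F2_def
        by (simp, intro continuous_mult cP cont(2)[where c="\<lambda>i. c (_, i)"]) (use that in \<open>auto simp: T_def\<close>)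
    qed
    show "\<bar>P L x\<bar> \<le> D" for x using bP[of 1 L x] CD by simp
    show "\<bar>F1 t x\<bar> \<le> D" if "t \<in> T" for t x
      unfolding F1_def by (rule bP, rule order_trans[OF bound(3) CD(1)]) (use that in \<open>auto simp: T_def\<close>)
    show "\<bar>F2 t t' x\<bar> \<le> D" if "t \<in> T" "t' \<in> T" for t t' x
      using that by (rule bF2)
  qed
  \<comment> \<open>This is half the derivative of the covariance. For \<open>i < m\<close> the
    covariance is \<open>(cos \<theta>)\<^sup>2 + (sin \<theta>)\<^sup>2 * \<langle>z,
    z'\<rangle>\<close>; for \<open>i = m\<close> sine and cosine change places, hence the opposite
    sign.\<close>
  have cov: "(\<Sum>p\<in>I. a (l, i) p * a (l', i') p * (s p \<theta> * s' p \<theta>)) =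
    (if i = i' then (if i < m then -1 else 1) * (sin \<theta> * cos \<theta>) * (1 - (\<Sum>j<N. z l j * z l' j)) else 0)"
    if "i \<le> m" for l i l' i' \<theta>
  proof -
    have "(\<Sum>p\<in>I. a (l, i) p * a (l', i') p * (s p \<theta> * s' p \<theta>)) =
      (\<Sum>k\<le>m. if k = i then (if i = i' then \<Sum>j\<le>N. w l j * w l' j * (s (i, j) \<theta> * s' (i, j) \<theta>) else 0) else 0)"
      unfolding I_def sum.cartesian_product' by (intro sum.cong refl) (auto simp: a_def)
    also have "\<dots> = (if i = i' then \<Sum>j\<le>N. w l j * w l' j * (s (i, j) \<theta> * s' (i, j) \<theta>) else 0)"
      using that by simp
    also have "(\<Sum>j\<le>N. w l j * w l' j * (s (i, j) \<theta> * s' (i, j) \<theta>)) =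
      (if i < m then -1 else 1) * (sin \<theta> * cos \<theta>) * (1 - (\<Sum>j<N. z l j * z l' j))"
    proof -
      have "(\<Sum>j<N. w l j * w l' j * (s (i, j) \<theta> * s' (i, j) \<theta>)) =
        (\<Sum>j<N. z l j * z l' j) * ((if i < m then 1 else -1) * (sin \<theta> * cos \<theta>))"
        unfolding sum_distrib_right by (intro sum.cong refl) (simp add: w_def s_def s'_def)
      then show ?thesis
        unfolding lessThan_Suc_atMost[symmetric] sum.lessThan_Suc
        by (simp add: w_def s_def s'_def algebra_simps)
    qed
    finally show ?thesis .
  qed
  have int2: "integrable (gauss I) (\<lambda>u. F2 t t' (X \<theta> u))" if "t \<in> T" "t' \<in> T" for t t' \<theta>
  proof (rule integrable_gauss_bounded[OF mF2[where Y="\<lambda>t u. X \<theta> u t"] bF2])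
    show "(\<lambda>u. X \<theta> u t) \<in> borel_measurable (gauss I)" for t
      unfolding X_def using finI by measurable
  qed (use that in auto)
  have "(\<integral>u. P L (X 0 u) \<partial>gauss I) \<le> (\<integral>u. P L (X (pi / 2) u) \<partial>gauss I)"
  proof (rule DERIV_nonneg_imp_nondecreasing, simp)
    fix \<theta> :: real assume \<theta>: "0 \<le> \<theta>" "\<theta> \<le> pi / 2"
    have sc: "0 \<le> sin \<theta> * cos \<theta>" using \<theta> by (auto intro!: mult_nonneg_nonneg sin_ge_zero cos_ge_zero)
    have signed: "(\<Sum>i<m. (if i < m then -1 else 1) * S * K * e i) + (if m < m then -1 else 1) * S * K * e m =
      S * K * (e m - (\<Sum>i<m. e i))" for S K :: real and e :: "nat \<Rightarrow> real"
      by (simp add: sum_negf sum_distrib_left right_diff_distrib)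
    have "(\<Sum>t\<in>T. \<Sum>t'\<in>T. (\<Sum>p\<in>I. a t p * a t' p * (s p \<theta> * s' p \<theta>)) * E t t' \<theta>) =
      (\<Sum>l\<in>L. \<Sum>i\<le>m. \<Sum>l'\<in>L. \<Sum>i'\<le>m. if i = i' then (if i < m then -1 else 1) * (sin \<theta> * cos \<theta>)
         * (1 - (\<Sum>j<N. z l j * z l' j)) * E (l, i) (l', i') \<theta> else 0)"
      unfolding T_def sum.cartesian_product' by (intro sum.cong refl) (auto simp: cov)
    also have "\<dots> = (\<Sum>l\<in>L. \<Sum>i\<le>m. \<Sum>l'\<in>L. (if i < m then -1 else 1) * (sin \<theta> * cos \<theta>)
         * (1 - (\<Sum>j<N. z l j * z l' j)) * E (l, i) (l', i) \<theta>)"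
      by (intro sum.cong refl) auto
    also have "\<dots> = (\<Sum>l\<in>L. \<Sum>l'\<in>L. \<Sum>i\<le>m. (if i < m then -1 else 1) * (sin \<theta> * cos \<theta>)
         * (1 - (\<Sum>j<N. z l j * z l' j)) * E (l, i) (l', i) \<theta>)"
      by (intro sum.cong refl) (rule sum.swap)
    also have "\<dots> = (\<Sum>l\<in>L. \<Sum>l'\<in>L. (sin \<theta> * cos \<theta>) * (1 - (\<Sum>j<N. z l j * z l' j)) *
         (E (l, m) (l', m) \<theta> - (\<Sum>i<m. E (l, i) (l', i) \<theta>)))"
      unfolding lessThan_Suc_atMost[symmetric] sum.lessThan_Suc
      by (intro sum.cong refl) (rule signed)
    also have "\<dots> \<ge> 0"
    proof (intro sum_nonneg)
      fix l l' assume l: "l \<in> L" "l' \<in> L"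
      show "0 \<le> (sin \<theta> * cos \<theta>) * (1 - (\<Sum>j<N. z l j * z l' j)) * (E (l, m) (l', m) \<theta> - (\<Sum>i<m. E (l, i) (l', i) \<theta>))"
      proof (cases "l = l'")
        case True
        then show ?thesis using unit[OF l(1)] by (simp add: power2_eq_square)
      next
        case False
        \<comment> \<open>For unit vectors \<open>1 - \<langle>z, z'\<rangle>\<close> is half the
          squared distance.\<close>
        have "0 \<le> (\<Sum>j<N. (z l j - z l' j)\<^sup>2)" by (intro sum_nonneg) auto
        also have "\<dots> = (\<Sum>j<N. (z l j)\<^sup>2) + (\<Sum>j<N. (z l' j)\<^sup>2) - 2 * (\<Sum>j<N. z l j * z l' j)"
          by (simp add: power2_diff sum.distrib sum_subtractf sum_distrib_left mult_ac)
        finally have 1: "0 \<le> 1 - (\<Sum>j<N. z l j * z l' j)" using unit l by simp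
        have i2: "integrable (gauss I) (\<lambda>u. F2 (l, i) (l', i) (X \<theta> u))" if "i \<le> m" for i
          by (rule int2) (use that l in \<open>auto simp: T_def\<close>)
        have "E (l, m) (l', m) \<theta> - (\<Sum>i<m. E (l, i) (l', i) \<theta>) =
          (\<integral>u. F2 (l, m) (l', m) (X \<theta> u) - (\<Sum>i<m. F2 (l, i) (l', i) (X \<theta> u)) \<partial>gauss I)"
          unfolding E_def
          by (subst Bochner_Integration.integral_diff[OF i2 Bochner_Integration.integrable_sum[OF i2]],
              simp, simp, subst Bochner_Integration.integral_sum[OF i2], auto)
        also have "\<dots> \<ge> 0"
        proof (rule integral_nonneg_AE, rule AE_I2)
          fix u
          let ?x = "X \<theta> u"
          have "F2 (l, m) (l', m) ?x - (\<Sum>i<m. F2 (l, i) (l', i) ?x) =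
            (\<psi>1 m (\<lambda>i. ?x (l, i)) * \<psi>1 m (\<lambda>i. ?x (l', i)) -
            (\<Sum>i<m. \<psi>1 i (\<lambda>i. ?x (l, i)) * \<psi>1 i (\<lambda>i. ?x (l', i)))) * P (L - {l} - {l'}) ?x"
            using False by (simp add: F2_def sum_distrib_right left_diff_distrib)
          also have "\<dots> \<ge> 0" using cone P01 by (intro mult_nonneg_nonneg) auto
          finally show "0 \<le> F2 (l, m) (l', m) ?x - (\<Sum>i<m. F2 (l, i) (l', i) ?x)" .
        qed
        finally show ?thesis by (rule mult_nonneg_nonneg[OF mult_nonneg_nonneg[OF sc 1]])
      qed
    qed
    finally show "\<exists>y. ((\<lambda>\<theta>. \<integral>u. P L (X \<theta> u) \<partial>gauss I) has_real_derivative y) (at \<theta>) \<and> 0 \<le> y"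
      using der_I by blast
  qed
  moreover have X_eq: "X \<theta> u (l, i) = (\<Sum>j<N. u (i, j) * z l j) * (if i < m then sin \<theta> else cos \<theta>)
      + u (i, N) * (if i < m then cos \<theta> else sin \<theta>)" if "i \<le> m" for \<theta> u l i
  proof -
    have "X \<theta> u (l, i) = (\<Sum>k\<le>m. if k = i then (\<Sum>j\<le>N. w l j * s (i, j) \<theta> * u (i, j)) else 0)"
      unfolding X_def I_def sum.cartesian_product' by (intro sum.cong refl) (auto simp: a_def)
    also have "\<dots> = (\<Sum>j\<le>N. w l j * s (i, j) \<theta> * u (i, j))" using that by simp
    also have "\<dots> = (\<Sum>j<N. u (i, j) * z l j * (if i < m then sin \<theta> else cos \<theta>)) + u (i, N) * (if i < m then cos \<theta> else sin \<theta>)"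
      unfolding lessThan_Suc_atMost[symmetric] sum.lessThan_Suc
      by (intro arg_cong2[where f="(+)"] sum.cong refl) (auto simp: w_def s_def)
    finally show ?thesis by (simp add: sum_distrib_right)
  qed
  have "P L (X 0 u) = (\<Prod>l\<in>L. \<psi> (\<lambda>i. if i < m then u (i, N) else \<Sum>j<N. u (m, j) * z l j))"
    and "P L (X (pi / 2) u) = (\<Prod>l\<in>L. \<psi> (\<lambda>i. if i < m then \<Sum>j<N. u (i, j) * z l j else u (m, N)))" for u
    unfolding P_def by (intro prod.cong refl loc; auto simp: X_eq dest: antisym)+
  ultimately show ?thesis by simp
qed

section \<open>Gordon's inequality for a regularised norm\<close>

text \<open>The Euclidean norm of \<open>v\<close> extended by one further coordinate
  \<open>\<eta>\<close>. For \<open>\<eta> > 0\<close> it stays away from 0, so it is smooth with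
  bounded first and second derivatives, and it exceeds the true norm by at most
  \<open>\<eta>\<close>.\<close>

definition smooth_norm :: "real \<Rightarrow> nat \<Rightarrow> (nat \<Rightarrow> real) \<Rightarrow> real" where
  "smooth_norm \<eta> m v = sqrt (\<eta>\<^sup>2 + (\<Sum>i<m. (v i)\<^sup>2))"

lemma smooth_norm_pos: "\<eta> > 0 \<Longrightarrow> smooth_norm \<eta> m v > 0"
  unfolding smooth_norm_def by (intro real_sqrt_gt_zero add_pos_nonneg sum_nonneg) auto

lemma smooth_norm_ge: "\<eta> > 0 \<Longrightarrow> smooth_norm \<eta> m v \<ge> \<eta>"
  unfolding smooth_norm_def by (intro real_le_rsqrt) (auto intro: sum_nonneg)

lemma smooth_norm_power2: "(smooth_norm \<eta> m v)\<^sup>2 = \<eta>\<^sup>2 + (\<Sum>i<m. (v i)\<^sup>2)"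
  unfolding smooth_norm_def by (simp add: sum_nonneg)

text \<open>The gradient of \<open>smooth_norm\<close> has length at most 1. The condition
  \<open>cone\<close> rests on this, as the scalar coordinate is added with slope exactly 1.\<close>

lemma sum_power2_div_smooth_norm_le:
  assumes "\<eta> > 0"
  shows "(\<Sum>i<m. (v i / smooth_norm \<eta> m v)\<^sup>2) \<le> 1"
proof -
  have "(\<Sum>i<m. (v i / smooth_norm \<eta> m v)\<^sup>2) = (\<Sum>i<m. (v i)\<^sup>2) / (smooth_norm \<eta> m v)\<^sup>2"
    by (simp add: power_divide sum_divide_distrib)
  also have "\<dots> \<le> 1"
    using zero_less_power[OF smooth_norm_pos[OF assms, of m v], of 2]
    by (simp add: divide_le_eq_1 smooth_norm_power2)
  finally show ?thesis .
qed

lemma abs_div_smooth_norm_le: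
  assumes "\<eta> > 0" "i < m"
  shows "\<bar>v i / smooth_norm \<eta> m v\<bar> \<le> 1"
proof -
  have "(v i / smooth_norm \<eta> m v)\<^sup>2 \<le> (\<Sum>i<m. (v i / smooth_norm \<eta> m v)\<^sup>2)"
    using assms(2) by (intro member_le_sum) auto
  also have "\<dots> \<le> 1" by (rule sum_power2_div_smooth_norm_le[OF assms(1)])
  finally show ?thesis by (simp add: abs_square_le_1)
qed

lemma DERIV_smooth_norm:
  assumes "\<eta> > 0" "\<And>i. i < m \<Longrightarrow> (c i has_real_derivative c' i) (at r)"
  shows "((\<lambda>r. smooth_norm \<eta> m (\<lambda>i. c i r)) has_real_derivative
    (\<Sum>i<m. c i r / smooth_norm \<eta> m (\<lambda>i. c i r) * c' i)) (at r)"
proof -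
  have pos: "\<eta>\<^sup>2 + (\<Sum>i<m. (c i r)\<^sup>2) > 0"
    using assms(1) by (intro add_pos_nonneg sum_nonneg) auto
  have "((\<lambda>r. \<eta>\<^sup>2 + (\<Sum>i<m. (c i r)\<^sup>2)) has_real_derivative (\<Sum>i<m. 2 * c i r * c' i)) (at r)"
  proof -
    have "((\<lambda>r. (c i r)\<^sup>2) has_real_derivative 2 * c i r * c' i) (at r)" if "i < m" for i
      using DERIV_power[OF assms(2)[OF that], of 2] by (simp add: mult_ac)
    then have "((\<lambda>r. \<Sum>i<m. (c i r)\<^sup>2) has_real_derivative (\<Sum>i<m. 2 * c i r * c' i)) (at r)"
      by (intro DERIV_sum) auto
    from DERIV_add[OF DERIV_const[of "\<eta>\<^sup>2"] this] show ?thesis by simp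
  qed
  note DERIV_chain2[OF DERIV_real_sqrt[OF pos] this]
  moreover have "inverse q / 2 * (\<Sum>i<m. 2 * c i r * c' i) = (\<Sum>i<m. c i r / q * c' i)" for q
    unfolding sum_distrib_left by (intro sum.cong refl) (cases "q = 0"; simp add: field_simps)
  ultimately show ?thesis unfolding smooth_norm_def by simp
qed

text \<open>The function \<open>\<rho>\<close> is a smooth increasing step with values between 0 and
  1, steeper for larger \<open>b\<close>. The gradient of the composed function is
  \<open>\<rho>1\<close> times a vector of length at most 1 followed by the entry 1, so
  \<open>cone\<close> is Cauchy-Schwarz.\<close>

lemma gordon_comparison_arctan:
  fixes z :: "'l \<Rightarrow> nat \<Rightarrow> real" and m N :: nat and \<eta> b c :: real
  defines "I \<equiv> {..m} \<times> {..N}"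
  defines "\<rho> \<equiv> \<lambda>a. 1 / 2 + arctan (b * a) / pi"
  assumes L: "finite L" and unit: "\<And>l. l \<in> L \<Longrightarrow> (\<Sum>j<N. (z l j)\<^sup>2) = 1"
    and \<eta>: "\<eta> > 0" and b: "b > 0"
  shows "(\<integral>u. (\<Prod>l\<in>L. \<rho> (smooth_norm \<eta> m (\<lambda>i. u (i, N)) + (\<Sum>j<N. u (m, j) * z l j) - c)) \<partial>gauss I) \<le>
    (\<integral>u. (\<Prod>l\<in>L. \<rho> (smooth_norm \<eta> m (\<lambda>i. \<Sum>j<N. u (i, j) * z l j) + u (m, N) - c)) \<partial>gauss I)"
proof -
  let ?M = "borel_measurable (gauss I)"
  define n where "n = smooth_norm \<eta> m"
  define A where "A v = n v + v m - c" for v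
  define \<rho>1 where "\<rho>1 a = b / (pi * (1 + (b * a)\<^sup>2))" for a
  define \<rho>2 where "\<rho>2 a = - 2 * b ^ 3 * a / (pi * (1 + (b * a)\<^sup>2)\<^sup>2)" for a
  define \<nu> where "\<nu> i v = (if i < m then v i / n v else 1)" for i v
  \<comment> \<open>The Hessian of the regularised norm; row and column \<open>m\<close> vanish
    because the scalar enters linearly.\<close>
  define \<nu>2 where "\<nu>2 i i' v = (if i < m \<and> i' < m then (if i = i' then 1 / n v else 0) - v i * v i' / n v ^ 3 else 0)" for i i' v
  define \<psi>1 where "\<psi>1 i v = \<rho>1 (A v) * \<nu> i v" for i v
  define \<psi>2 where "\<psi>2 i i' v = \<rho>2 (A v) * \<nu> i' v * \<nu> i v + \<rho>1 (A v) * \<nu>2 i i' v" for i i' v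
  \<comment> \<open>The summands cover, in this order, the \<open>\<rho>2\<close> term, the Hessian
    term and the first derivatives.\<close>
  define C where "C = b\<^sup>2 + b * (2 / \<eta>) + b"
  have n_pos: "n v > 0" and n_ge: "n v \<ge> \<eta>" for v
    using \<eta> by (auto simp: n_def smooth_norm_pos smooth_norm_ge)
  have q_pos: "0 < 1 + (b * a)\<^sup>2" for a by (auto intro: add_pos_nonneg)
  have q_pos': "1 + (b * a)\<^sup>2 \<noteq> 0" for a using q_pos[of a] by linarith
  have d\<rho>: "(\<rho> has_real_derivative \<rho>1 a) (at a)" for a
    unfolding \<rho>_def \<rho>1_def using b
    by (auto intro!: derivative_eq_intros simp: divide_simps)
  have d\<rho>1: "(\<rho>1 has_real_derivative \<rho>2 a) (at a)" for a
  proof -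
    have "((\<lambda>a. 1 + (b * a)\<^sup>2) has_real_derivative 2 * b\<^sup>2 * a) (at a)"
      by (auto intro!: derivative_eq_intros simp: power2_eq_square)
    note DERIV_cmult[OF DERIV_inverse'[OF this q_pos'], of "b / pi"]
    moreover have "(\<lambda>a. b / pi * inverse (1 + (b * a)\<^sup>2)) = \<rho>1"
      by (simp add: \<rho>1_def fun_eq_iff inverse_eq_divide)
    moreover have "b / pi * - (inverse q * (2 * b\<^sup>2 * a) * inverse q) = - 2 * b ^ 3 * a / (pi * q\<^sup>2)" for q
      by (cases "q = 0") (simp_all add: field_simps power2_eq_square power3_eq_cube)
    ultimately show ?thesis by (simp add: \<rho>2_def)
  qed
  have \<rho>1_bound: "0 \<le> \<rho>1 a" "\<rho>1 a \<le> b" for a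
  proof -
    have "1 \<le> pi * (1 + (b * a)\<^sup>2)" using pi_ge_two by (intro mult_ge1_I) auto
    then show "0 \<le> \<rho>1 a" "\<rho>1 a \<le> b" using b by (auto simp: \<rho>1_def divide_simps)
  qed
  have \<rho>2_bound: "\<bar>\<rho>2 a\<bar> \<le> b\<^sup>2" for a
  proof -
    let ?q = "1 + (b * a)\<^sup>2"
    have "0 \<le> (1 - \<bar>b * a\<bar>)\<^sup>2" by simp
    then have "2 * \<bar>b * a\<bar> \<le> ?q" by (simp add: power2_eq_square algebra_simps)
    also have "?q \<le> pi * ?q\<^sup>2"
    proof -
      have "?q * 1 \<le> ?q * (pi * ?q)" using pi_ge_two by (intro mult_left_mono mult_ge1_I) auto
      then show ?thesis by (simp add: power2_eq_square mult_ac)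
    qed
    finally have 1: "2 * \<bar>b * a\<bar> \<le> pi * ?q\<^sup>2" .
    have "\<bar>\<rho>2 a\<bar> = b\<^sup>2 * (2 * \<bar>b * a\<bar> / (pi * ?q\<^sup>2))"
      using b by (simp add: \<rho>2_def abs_mult power2_eq_square power3_eq_cube)
    also have "\<dots> \<le> b\<^sup>2 * 1"
      using 1 q_pos[of a] by (intro mult_left_mono) (auto simp: divide_le_eq_1)
    finally show ?thesis by simp
  qed
  have \<nu>_bound: "\<bar>\<nu> i v\<bar> \<le> 1" for i v
    using abs_div_smooth_norm_le[OF \<eta>] by (auto simp: \<nu>_def n_def)
  have \<nu>2_bound: "\<bar>\<nu>2 i i' v\<bar> \<le> 2 / \<eta>" for i i' v
  proof (cases "i < m \<and> i' < m")
    case True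
    have eq: "\<nu>2 i i' v = ((if i = i' then 1 else 0) - \<nu> i v * \<nu> i' v) / n v"
      using True n_pos[of v] by (simp add: \<nu>2_def \<nu>_def field_simps power3_eq_cube)
    have "\<bar>\<nu> i v * \<nu> i' v\<bar> \<le> 1 * 1" unfolding abs_mult using \<nu>_bound by (intro mult_mono) auto
    then have "\<bar>(if i = i' then 1 else 0) - \<nu> i v * \<nu> i' v\<bar> \<le> 2" by (auto simp: abs_le_iff)
    then show ?thesis unfolding eq abs_divide using n_pos[of v] n_ge[of v] \<eta>
      by (intro frac_le) auto
  qed (use \<eta> in \<open>auto simp: \<nu>2_def\<close>)
  have n_loc: "n v = n w" if "\<And>i. i < m \<Longrightarrow> v i = w i" for v w
    unfolding n_def smooth_norm_def using that by simp
  have dn: "((\<lambda>r. n (\<lambda>i. c i r)) has_real_derivative (\<Sum>i<m. \<nu> i (\<lambda>i. c i r) * c' i)) (at r)"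
    if "\<And>i. i \<le> m \<Longrightarrow> (c i has_real_derivative c' i) (at r)" for c c' r
    using DERIV_smooth_norm[OF \<eta>, of m c c' r] that by (simp add: n_def \<nu>_def)
  have dA: "((\<lambda>r. A (\<lambda>i. c i r)) has_real_derivative (\<Sum>i\<le>m. \<nu> i (\<lambda>i. c i r) * c' i)) (at r)"
    if c: "\<And>i. i \<le> m \<Longrightarrow> (c i has_real_derivative c' i) (at r)" for c c' r
    unfolding A_def lessThan_Suc_atMost[symmetric] sum.lessThan_Suc
    by (rule derivative_eq_intros dn[OF c] c[of m] refl | simp add: \<nu>_def)+
  have d\<nu>: "((\<lambda>r. \<nu> i (\<lambda>i. c i r)) has_real_derivative (\<Sum>i'\<le>m. \<nu>2 i i' (\<lambda>i. c i r) * c' i')) (at r)"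
    if i: "i \<le> m" and c: "\<And>i. i \<le> m \<Longrightarrow> (c i has_real_derivative c' i) (at r)" for i c c' r
  proof (cases "i < m")
    case True
    let ?n = "n (\<lambda>i. c i r)"
    have n0: "?n \<noteq> 0" using n_pos[of "\<lambda>i. c i r"] by simp
    have "((\<lambda>r. c i r / n (\<lambda>i. c i r)) has_real_derivative
      (c' i * ?n - c i r * (\<Sum>i<m. \<nu> i (\<lambda>i. c i r) * c' i)) / (?n * ?n)) (at r)"
      by (rule DERIV_divide[OF c[OF i] dn[OF c] n0])
    moreover have "(c' i * ?n - c i r * (\<Sum>i<m. \<nu> i (\<lambda>i. c i r) * c' i)) / (?n * ?n) =
      (\<Sum>i'\<le>m. \<nu>2 i i' (\<lambda>i. c i r) * c' i')"
    proof -
      have "(\<Sum>i'\<le>m. \<nu>2 i i' (\<lambda>i. c i r) * c' i') =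
        (\<Sum>i'<m. ((if i' = i then c' i / ?n else 0) - c i r * (\<nu> i' (\<lambda>i. c i r) * c' i') / (?n * ?n)))"
        unfolding lessThan_Suc_atMost[symmetric] sum.lessThan_Suc
        using True by (auto simp: \<nu>2_def \<nu>_def field_simps power3_eq_cube intro!: sum.cong)
      also have "\<dots> = c' i / ?n - c i r * (\<Sum>i<m. \<nu> i (\<lambda>i. c i r) * c' i) / (?n * ?n)"
        unfolding sum_subtractf using True by (simp add: sum_distrib_left sum_divide_distrib)
      finally show ?thesis using n0 by (simp add: field_simps)
    qed
    ultimately show ?thesis using True by (simp add: \<nu>_def)
  qed (auto simp: \<nu>_def \<nu>2_def)
  have mn: "(\<lambda>u. n (\<lambda>i. Y i u)) \<in> ?M"
    if "\<And>i. i \<le> m \<Longrightarrow> Y i \<in> ?M" for Y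
  proof -
    have [measurable]: "i < m \<Longrightarrow> Y i \<in> ?M" for i using that by simp
    show ?thesis unfolding n_def smooth_norm_def by measurable
  qed
  have mA: "(\<lambda>u. A (\<lambda>i. Y i u)) \<in> ?M"
    if "\<And>i. i \<le> m \<Longrightarrow> Y i \<in> ?M" for Y
    unfolding A_def using mn[OF that] that[of m] by simp
  have m\<nu>: "(\<lambda>u. \<nu> i (\<lambda>i. Y i u)) \<in> ?M"
    if "i \<le> m" "\<And>i. i \<le> m \<Longrightarrow> Y i \<in> ?M" for i Y
    unfolding \<nu>_def using mn[OF that(2)] that by auto
  have m\<nu>2: "(\<lambda>u. \<nu>2 i i' (\<lambda>i. Y i u)) \<in> ?M"
    if "i \<le> m" "i' \<le> m" "\<And>i. i \<le> m \<Longrightarrow> Y i \<in> ?M" for i i' Y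
    unfolding \<nu>2_def using mn[OF that(3)] that by auto
  have m\<rho>: "\<rho> \<in> borel_measurable borel" "\<rho>1 \<in> borel_measurable borel" "\<rho>2 \<in> borel_measurable borel"
    unfolding \<rho>_def \<rho>1_def \<rho>2_def by measurable
  have cn: "isCont (\<lambda>r. n (\<lambda>i. c i r)) r"
    if "\<And>i. i \<le> m \<Longrightarrow> isCont (c i) r" for c and r :: real
    unfolding n_def smooth_norm_def using that by (intro continuous_intros) auto
  have cA: "isCont (\<lambda>r. A (\<lambda>i. c i r)) r"
    if "\<And>i. i \<le> m \<Longrightarrow> isCont (c i) r" for c and r :: real
    unfolding A_def using that cn[OF that] by (intro continuous_intros) auto
  have c\<nu>: "isCont (\<lambda>r. \<nu> i (\<lambda>i. c i r)) r"
    if "i \<le> m" "\<And>i. i \<le> m \<Longrightarrow> isCont (c i) r" for i c and r :: real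
    unfolding \<nu>_def using that cn[OF that(2)] n_pos[of "\<lambda>i. c i r"]
    by (cases "i < m") (auto intro!: continuous_intros)
  have c\<nu>2: "isCont (\<lambda>r. \<nu>2 i i' (\<lambda>i. c i r)) r"
    if "i \<le> m" "i' \<le> m" "\<And>i. i \<le> m \<Longrightarrow> isCont (c i) r" for i i' c and r :: real
    unfolding \<nu>2_def using that cn[OF that(3)] n_pos[of "\<lambda>i. c i r"]
    by (cases "i < m \<and> i' < m"; cases "i = i'") (auto intro!: continuous_intros)
  have c\<rho>: "isCont (\<lambda>r. \<rho> (f r)) r" "isCont (\<lambda>r. \<rho>1 (f r)) r" "isCont (\<lambda>r. \<rho>2 (f r)) r"
    if f: "isCont f r" for f :: "real \<Rightarrow> real" and r
  proof -
    show "isCont (\<lambda>r. \<rho> (f r)) r" by (rule isCont_o2[OF f DERIV_isCont[OF d\<rho>]])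
    show "isCont (\<lambda>r. \<rho>1 (f r)) r" by (rule isCont_o2[OF f DERIV_isCont[OF d\<rho>1]])
    have "isCont \<rho>2 a" for a unfolding \<rho>2_def using q_pos'[of a] by (intro continuous_intros) auto
    then show "isCont (\<lambda>r. \<rho>2 (f r)) r" by (rule isCont_o2[OF f])
  qed
  have "(\<integral>u. (\<Prod>l\<in>L. \<rho> (A (\<lambda>i. if i < m then u (i, N) else \<Sum>j<N. u (m, j) * z l j))) \<partial>gauss I) \<le>
    (\<integral>u. (\<Prod>l\<in>L. \<rho> (A (\<lambda>i. if i < m then \<Sum>j<N. u (i, j) * z l j else u (m, N)))) \<partial>gauss I)"
    unfolding I_def
  proof (rule gordon_comparison_smooth[where \<psi>="\<lambda>v. \<rho> (A v)" and ?\<psi>1.0=\<psi>1 and ?\<psi>2.0=\<psi>2 and C=C], fold I_def)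
    show "\<rho> (A v) = \<rho> (A w)" if "\<And>i. i \<le> m \<Longrightarrow> v i = w i" for v w
      using n_loc[of v w] that by (simp add: A_def)
    show "(\<lambda>u. \<rho> (A (\<lambda>i. Y i u))) \<in> ?M"
      if "\<And>i. i \<le> m \<Longrightarrow> Y i \<in> ?M" for Y
      by (rule measurable_compose[OF mA m\<rho>(1)]) (rule that)
    show "(\<lambda>u. \<psi>1 i (\<lambda>i. Y i u)) \<in> ?M"
      if "i \<le> m" "\<And>i. i \<le> m \<Longrightarrow> Y i \<in> ?M" for i Y
      unfolding \<psi>1_def
      by (intro borel_measurable_times measurable_compose[OF mA m\<rho>(2)] m\<nu>) (use that in auto)
    show "(\<lambda>u. \<psi>2 i i' (\<lambda>i. Y i u)) \<in> ?M"
      if "i \<le> m" "i' \<le> m" "\<And>i. i \<le> m \<Longrightarrow> Y i \<in> ?M" for i i' Y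
      unfolding \<psi>2_def
      by (intro borel_measurable_add borel_measurable_times measurable_compose[OF mA m\<rho>(2)]
        measurable_compose[OF mA m\<rho>(3)] m\<nu> m\<nu>2) (use that in auto)
    show "((\<lambda>r. \<rho> (A (\<lambda>i. c i r))) has_real_derivative (\<Sum>i\<le>m. \<psi>1 i (\<lambda>i. c i r) * c' i)) (at r)"
      if "\<And>i. i \<le> m \<Longrightarrow> (c i has_real_derivative c' i) (at r)" for c c' r
      using DERIV_chain2[OF d\<rho> dA[OF that]] by (simp add: \<psi>1_def sum_distrib_left mult_ac)
    show "((\<lambda>r. \<psi>1 i (\<lambda>i. c i r)) has_real_derivative (\<Sum>i'\<le>m. \<psi>2 i i' (\<lambda>i. c i r) * c' i')) (at r)"
      if "i \<le> m" "\<And>i. i \<le> m \<Longrightarrow> (c i has_real_derivative c' i) (at r)" for i c c' r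
      using DERIV_mult[OF DERIV_chain2[OF d\<rho>1 dA[OF that(2)]] d\<nu>[OF that]]
      by (simp add: \<psi>1_def \<psi>2_def sum_distrib_left sum_distrib_right sum.distrib algebra_simps)
    show "isCont (\<lambda>r. \<rho> (A (\<lambda>i. c i r))) r"
      if "\<And>i. i \<le> m \<Longrightarrow> isCont (c i) r" for c and r :: real
      by (intro c\<rho> cA) (use that in auto)
    show "isCont (\<lambda>r. \<psi>1 i (\<lambda>i. c i r)) r"
      if "i \<le> m" "\<And>i. i \<le> m \<Longrightarrow> isCont (c i) r" for i c and r :: real
      unfolding \<psi>1_def by (intro continuous_mult c\<rho> cA c\<nu>) (use that in auto)
    show "isCont (\<lambda>r. \<psi>2 i i' (\<lambda>i. c i r)) r"
      if "i \<le> m" "i' \<le> m" "\<And>i. i \<le> m \<Longrightarrow> isCont (c i) r" for i i' c and r :: real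
      unfolding \<psi>2_def by (intro continuous_add continuous_mult c\<rho> cA c\<nu> c\<nu>2) (use that in auto)
    show "0 \<le> \<rho> (A v)" "\<rho> (A v) \<le> 1" for v
      using arctan_ubound[of "b * A v"] arctan_lbound[of "b * A v"] by (auto simp: \<rho>_def field_simps)
    show "\<bar>\<psi>1 i v\<bar> \<le> C" if "i \<le> m" for i v
    proof -
      have "\<bar>\<psi>1 i v\<bar> \<le> b * 1"
        unfolding \<psi>1_def abs_mult using \<rho>1_bound[of "A v"] \<nu>_bound[of i v] b by (intro mult_mono) auto
      also have "\<dots> \<le> C" using b \<eta> by (simp add: C_def)
      finally show ?thesis .
    qed
    show "\<bar>\<psi>2 i i' v\<bar> \<le> C" if "i \<le> m" "i' \<le> m" for i i' v
    proof -
      have "\<bar>\<rho>2 (A v) * \<nu> i' v * \<nu> i v\<bar> \<le> b\<^sup>2 * 1 * 1"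
        unfolding abs_mult using \<rho>2_bound[of "A v"] \<nu>_bound[of i v] \<nu>_bound[of i' v] b by (intro mult_mono) auto
      moreover have "\<bar>\<rho>1 (A v) * \<nu>2 i i' v\<bar> \<le> b * (2 / \<eta>)"
        unfolding abs_mult using \<rho>1_bound[of "A v"] \<nu>2_bound[of i i' v] b by (intro mult_mono) auto
      ultimately show ?thesis unfolding \<psi>2_def C_def using b by linarith
    qed
    show "(\<Sum>i<m. \<psi>1 i v * \<psi>1 i w) \<le> \<psi>1 m v * \<psi>1 m w" for v w
    proof -
      \<comment> \<open>Cauchy-Schwarz for two vectors of the unit ball, obtained from AM-GM in each
        coordinate.\<close>
      have "(\<Sum>i<m. \<nu> i v * \<nu> i w) \<le> (\<Sum>i<m. ((\<nu> i v)\<^sup>2 + (\<nu> i w)\<^sup>2) / 2)"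
      proof (rule sum_mono)
        fix i
        have "0 \<le> (\<nu> i v - \<nu> i w)\<^sup>2" by simp
        then show "\<nu> i v * \<nu> i w \<le> ((\<nu> i v)\<^sup>2 + (\<nu> i w)\<^sup>2) / 2" by (simp add: power2_diff)
      qed
      also have "\<dots> = ((\<Sum>i<m. (\<nu> i v)\<^sup>2) + (\<Sum>i<m. (\<nu> i w)\<^sup>2)) / 2"
        by (simp add: sum.distrib flip: sum_divide_distrib)
      also have "\<dots> \<le> 1"
        using sum_power2_div_smooth_norm_le[OF \<eta>, of v m] sum_power2_div_smooth_norm_le[OF \<eta>, of w m]
        by (simp add: \<nu>_def n_def)
      finally have "\<rho>1 (A v) * \<rho>1 (A w) * (\<Sum>i<m. \<nu> i v * \<nu> i w) \<le> \<rho>1 (A v) * \<rho>1 (A w) * 1"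
        using \<rho>1_bound by (intro mult_left_mono mult_nonneg_nonneg)
      then show ?thesis by (simp add: \<psi>1_def \<nu>_def sum_distrib_left mult_ac)
    qed
  qed (use L unit in auto)
  moreover have "A (\<lambda>i. if i < m then u (i, N) else \<Sum>j<N. u (m, j) * z l j) =
     smooth_norm \<eta> m (\<lambda>i. u (i, N)) + (\<Sum>j<N. u (m, j) * z l j) - c"
    "A (\<lambda>i. if i < m then \<Sum>j<N. u (i, j) * z l j else u (m, N)) =
     smooth_norm \<eta> m (\<lambda>i. \<Sum>j<N. u (i, j) * z l j) + u (m, N) - c" for u l
    by (simp_all add: A_def n_def smooth_norm_def)
  ultimately show ?thesis by simp
qed


section \<open>From smooth steps to distribution functions and Laplace transforms\<close>

lemma arctan_step_limit:
  "(\<lambda>n. 1 / 2 + arctan (real (Suc n) * a) / pi) \<longlonglongrightarrow> (if a < 0 then 0 else if a = 0 then 1 / 2 else 1)"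
proof -
  consider "a < 0" | "a = 0" | "a > 0" by linarith
  then show ?thesis
  proof cases
    case 1
    have "filterlim (\<lambda>n. real (Suc n) * a) at_bot sequentially"
      using 1 by real_asymp
    then have "(\<lambda>n. 1 / 2 + arctan (real (Suc n) * a) / pi) \<longlonglongrightarrow> 1 / 2 + - (pi / 2) / pi"
      by (intro tendsto_intros filterlim_compose[OF tendsto_arctan_at_bot]) auto
    then show ?thesis using 1 by simp
  next
    case 3
    have "filterlim (\<lambda>n. real (Suc n) * a) at_top sequentially"
      using 3 by real_asymp
    then have "(\<lambda>n. 1 / 2 + arctan (real (Suc n) * a) / pi) \<longlonglongrightarrow> 1 / 2 + (pi / 2) / pi"
      by (intro tendsto_intros filterlim_compose[OF tendsto_arctan_at_top]) auto
    then show ?thesis using 3 by simp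
  qed simp
qed

text \<open>The limiting step has value 1/2 at the jump. It is squeezed between two indicators that
  treat the level \<open>c\<close> differently, which explains the strict inequality on the left and
  the weak one on the right.\<close>

lemma gordon_comparison:
  fixes z :: "'l \<Rightarrow> nat \<Rightarrow> real" and m N :: nat and \<eta> c :: real
  defines "G \<equiv> gauss ({..m} \<times> {..N})"
  assumes L: "finite L" and unit: "\<And>l. l \<in> L \<Longrightarrow> (\<Sum>j<N. (z l j)\<^sup>2) = 1" and \<eta>: "\<eta> > 0"
  shows "measure G {u \<in> space G. \<exists>l\<in>L. smooth_norm \<eta> m (\<lambda>i. \<Sum>j<N. u (i, j) * z l j) + u (m, N) < c} \<le>
    measure G {u \<in> space G. \<exists>l\<in>L. smooth_norm \<eta> m (\<lambda>i. u (i, N)) + (\<Sum>j<N. u (m, j) * z l j) \<le> c}"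
proof -
  interpret prob_space G unfolding G_def by (rule prob_space_gauss)
  define U where "U l u = smooth_norm \<eta> m (\<lambda>i. \<Sum>j<N. u (i, j) * z l j) + u (m, N)" for l u
  define V where "V l u = smooth_norm \<eta> m (\<lambda>i. u (i, N)) + (\<Sum>j<N. u (m, j) * z l j)" for l u
  define \<rho> where "\<rho> n a = 1 / 2 + arctan (real (Suc n) * a) / pi" for n a
  define \<sigma> where "\<sigma> a = (if a < 0 then 0 else if a = 0 then 1 / 2 else 1 :: real)" for a :: real
  let ?U = "{u \<in> space G. \<not> (\<exists>l\<in>L. U l u < c)}" and ?V = "{u \<in> space G. \<not> (\<exists>l\<in>L. V l u \<le> c)}"
    and ?su = "\<lambda>u. \<Prod>l\<in>L. \<sigma> (U l u - c)" and ?sv = "\<lambda>u. \<Prod>l\<in>L. \<sigma> (V l u - c)"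
  have [measurable]: "U l \<in> borel_measurable G" "V l \<in> borel_measurable G" for l
    unfolding U_def V_def smooth_norm_def G_def by measurable
  have [measurable]: "\<rho> n \<in> borel_measurable borel" "\<sigma> \<in> borel_measurable borel" for n
    unfolding \<rho>_def \<sigma>_def by measurable
  have \<rho>01: "0 \<le> \<rho> n a" "\<rho> n a \<le> 1" for n a
    using arctan_ubound[of "real (Suc n) * a"] arctan_lbound[of "real (Suc n) * a"]
    by (auto simp: \<rho>_def field_simps)
  have \<sigma>01: "0 \<le> \<sigma> a" "\<sigma> a \<le> 1" for a by (auto simp: \<sigma>_def)
  have lim: "(\<lambda>n. \<integral>u. (\<Prod>l\<in>L. \<rho> n (W l u - c)) \<partial>G) \<longlonglongrightarrow> (\<integral>u. (\<Prod>l\<in>L. \<sigma> (W l u - c)) \<partial>G)"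
    if [measurable]: "\<And>l. W l \<in> borel_measurable G" for W :: "'l \<Rightarrow> _ \<Rightarrow> real"
  proof (rule integral_dominated_convergence[where w="\<lambda>_. 1"])
    show "AE u in G. (\<lambda>n. \<Prod>l\<in>L. \<rho> n (W l u - c)) \<longlonglongrightarrow> (\<Prod>l\<in>L. \<sigma> (W l u - c))"
      unfolding \<rho>_def \<sigma>_def by (intro AE_I2 tendsto_prod arctan_step_limit)
    show "AE u in G. norm (\<Prod>l\<in>L. \<rho> n (W l u - c)) \<le> 1" for n
      using \<rho>01 by (intro AE_I2) (auto simp: abs_prod intro!: prod_le_1)
  qed auto
  have "(\<integral>u. ?sv u \<partial>G) \<le> (\<integral>u. ?su u \<partial>G)"
  proof (rule LIMSEQ_le[OF lim lim])
    have "(\<integral>u. (\<Prod>l\<in>L. \<rho> n (V l u - c)) \<partial>G) \<le> (\<integral>u. (\<Prod>l\<in>L. \<rho> n (U l u - c)) \<partial>G)" for n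
      unfolding U_def V_def \<rho>_def G_def
      by (rule gordon_comparison_arctan[OF L unit \<eta>]) auto
    then show "\<exists>N. \<forall>n\<ge>N. (\<integral>u. (\<Prod>l\<in>L. \<rho> n (V l u - c)) \<partial>G) \<le> (\<integral>u. (\<Prod>l\<in>L. \<rho> n (U l u - c)) \<partial>G)"
      by blast
  qed auto
  also have "\<dots> \<le> (\<integral>u. indicator ?U u \<partial>G)"
  proof (rule integral_mono)
    show "integrable G (\<lambda>u. ?su u)"
      by (rule integrable_const_bound[where B=1]) (use \<sigma>01 in \<open>auto simp: abs_prod intro!: prod_le_1\<close>)
    show "integrable G (indicat_real ?U)"
      using L by (intro integrable_real_indicator) (auto simp: less_top[symmetric])
    fix u assume "u \<in> space G"
    have "?su u = 0" if "\<exists>l\<in>L. U l u < c"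
      using that by (intro prod_zero L) (auto simp: \<sigma>_def)
    with \<open>u \<in> space G\<close> show "?su u \<le> indicator ?U u"
      using \<sigma>01 by (auto simp: indicator_def intro!: prod_le_1)
  qed
  also have "\<dots> = measure G ?U"
    by (simp add: Int_absorb2 Collect_restrict)
  also have "\<dots> = 1 - measure G {u \<in> space G. \<exists>l\<in>L. U l u < c}"
    using L by (intro prob_neg) auto
  finally have 1: "(\<integral>u. ?sv u \<partial>G) \<le> \<dots>" .
  have "1 - measure G {u \<in> space G. \<exists>l\<in>L. V l u \<le> c} = measure G ?V"
    using L by (intro prob_neg[symmetric]) auto
  also have "\<dots> = (\<integral>u. indicator ?V u \<partial>G)"
    by (simp add: Int_absorb2 Collect_restrict)
  also have "\<dots> \<le> (\<integral>u. ?sv u \<partial>G)"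
  proof (rule integral_mono)
    show "integrable G (\<lambda>u. ?sv u)"
      by (rule integrable_const_bound[where B=1]) (use \<sigma>01 in \<open>auto simp: abs_prod intro!: prod_le_1\<close>)
    show "integrable G (indicat_real ?V)"
      using L by (intro integrable_real_indicator) (auto simp: less_top[symmetric])
    fix u assume "u \<in> space G"
    have "?sv u = 1" if "\<not> (\<exists>l\<in>L. V l u \<le> c)"
      using that by (intro prod.neutral) (auto simp: \<sigma>_def not_le)
    then show "indicator ?V u \<le> ?sv u"
      using \<sigma>01 by (auto simp: indicator_def intro!: prod_nonneg)
  qed
  finally show ?thesis using 1 by (simp add: U_def V_def)
qed

text \<open>Layer cake: \<open>exp (- l * y)\<close> is the integral of
  \<open>l * exp (- l * c)\<close> over \<open>c > y\<close>. By Fubini a comparison of distribution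
  functions at every level carries over to the Laplace transforms.\<close>

lemma nn_integral_exp_mono_of_cdf:
  fixes f g :: "'a \<Rightarrow> real" and l :: real
  assumes M: "prob_space M" and l: "l > 0"
    and [measurable]: "B \<in> sets M" "f \<in> borel_measurable M" "g \<in> borel_measurable M"
    and le: "\<And>c. measure M {x \<in> space M. x \<in> B \<and> f x < c} \<le> measure M {x \<in> space M. g x \<le> c}"
  shows "(\<integral>\<^sup>+x. indicator B x * ennreal (exp (- l * f x)) \<partial>M) \<le> (\<integral>\<^sup>+x. ennreal (exp (- l * g x)) \<partial>M)"
proof -
  let ?k = "\<lambda>c. ennreal (l * exp (- l * c))"
    and ?F = "\<lambda>c. {x \<in> space M. x \<in> B \<and> f x < c}" and ?H = "\<lambda>c. {x \<in> space M. g x \<le> c}"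
  interpret prob_space M by fact
  interpret P: pair_sigma_finite M lborel ..
  have E: "(\<integral>\<^sup>+c. ?k c * indicator {y..} c \<partial>lborel) = ennreal (exp (- l * y))" for y
  proof -
    have "filterlim (\<lambda>c. - l * c) at_bot at_top" using l by real_asymp
    then have "((\<lambda>c. - exp (- l * c)) \<longlongrightarrow> - 0) at_top"
      by (intro tendsto_minus filterlim_compose[OF exp_at_bot])
    then have "(\<integral>\<^sup>+c. ?k c * indicator {y..} c \<partial>lborel) = ennreal (- 0 - - exp (- l * y))"
      using l by (intro nn_integral_FTC_atLeast) (auto intro!: derivative_eq_intros)
    then show ?thesis by simp
  qed
  \<comment> \<open>The open half line matches the strict inequality \<open>f x < c\<close>; its end
    point is a null set.\<close>
  have E': "(\<integral>\<^sup>+c. ?k c * indicator {y<..} c \<partial>lborel) = ennreal (exp (- l * y))" for y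
    unfolding E[symmetric]
  proof (rule nn_integral_cong_AE)
    have "AE c in lborel. c \<noteq> y" by (rule AE_lborel_singleton)
    then show "AE c in lborel. ?k c * indicator {y<..} c =
      ?k c * indicator {y..} c"
      by eventually_elim (auto simp: indicator_def)
  qed
  have "(\<integral>\<^sup>+x. indicator B x * ennreal (exp (- l * f x)) \<partial>M) =
    (\<integral>\<^sup>+x. (\<integral>\<^sup>+c. indicator B x * (?k c * indicator {f x<..} c) \<partial>lborel) \<partial>M)"
  proof (rule nn_integral_cong)
    fix x
    have "(\<integral>\<^sup>+c. indicator B x * (?k c * indicator {f x<..} c) \<partial>lborel) =
      indicator B x * (\<integral>\<^sup>+c. ?k c * indicator {f x<..} c \<partial>lborel)"
      by (rule nn_integral_cmult) measurable
    then show "indicator B x * ennreal (exp (- l * f x)) =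
      (\<integral>\<^sup>+c. indicator B x * (?k c * indicator {f x<..} c) \<partial>lborel)"
      by (simp only: E')
  qed
  also have "\<dots> = (\<integral>\<^sup>+x. (\<integral>\<^sup>+c. ?k c * indicator (?F c) x \<partial>lborel) \<partial>M)"
    by (intro nn_integral_cong) (auto simp: indicator_def)
  also have "\<dots> = (\<integral>\<^sup>+c. (\<integral>\<^sup>+x. ?k c * indicator (?F c) x \<partial>M) \<partial>lborel)"
    by (rule P.Fubini'[symmetric]) measurable
  also have "\<dots> = (\<integral>\<^sup>+c. ?k c * emeasure M (?F c) \<partial>lborel)"
    by (intro nn_integral_cong, subst nn_integral_cmult_indicator) auto
  also have "\<dots> \<le> (\<integral>\<^sup>+c. ?k c * emeasure M (?H c) \<partial>lborel)"
    using le by (intro nn_integral_mono mult_left_mono) (auto simp: emeasure_eq_measure)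
  also have "\<dots> = (\<integral>\<^sup>+c. (\<integral>\<^sup>+x. ?k c * indicator (?H c) x \<partial>M) \<partial>lborel)"
    by (intro nn_integral_cong, subst nn_integral_cmult_indicator) auto
  also have "\<dots> = (\<integral>\<^sup>+x. (\<integral>\<^sup>+c. ?k c * indicator (?H c) x \<partial>lborel) \<partial>M)"
    by (rule P.Fubini') measurable
  also have "\<dots> = (\<integral>\<^sup>+x. (\<integral>\<^sup>+c. ?k c * indicator {g x..} c \<partial>lborel) \<partial>M)"
    by (intro nn_integral_cong) (auto simp: indicator_def)
  also have "\<dots> = (\<integral>\<^sup>+x. ennreal (exp (- l * g x)) \<partial>M)"
    by (simp only: E)
  finally show ?thesis .
qed

text \<open>Where the norm of \<open>G z\<close> is below \<open>\<delta>\<close>, its sum with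
  \<open>\<gamma>\<close> is below \<open>\<delta> + \<gamma>\<close>; on the other side a majorant
  \<open>D\<close> replaces the supremum of \<open>- \<langle>h, z\<rangle>\<close>. Thus
  \<open>\<gamma>\<close> separates from \<open>G\<close>, and, once \<open>D\<close> depends on
  \<open>h\<close> only, so does \<open>g\<close> from \<open>h\<close>.\<close>

lemma gordon_exponential:
  fixes z :: "'l \<Rightarrow> nat \<Rightarrow> real" and m N :: nat and \<eta> l \<delta> :: real and D :: "_ \<Rightarrow> real"
  defines "G \<equiv> gauss ({..m} \<times> {..N})"
  assumes L: "finite L" and unit: "\<And>k. k \<in> L \<Longrightarrow> (\<Sum>j<N. (z k j)\<^sup>2) = 1" and \<eta>: "\<eta> > 0" and l: "l > 0"
    and D[measurable]: "D \<in> borel_measurable G"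
    and D_ge: "\<And>u k. k \<in> L \<Longrightarrow> - (\<Sum>j<N. u (m, j) * z k j) \<le> D u"
  shows "(\<integral>\<^sup>+u. indicator {u \<in> space G. \<exists>k\<in>L. smooth_norm \<eta> m (\<lambda>i. \<Sum>j<N. u (i, j) * z k j) < \<delta>} u *
        ennreal (exp (- l * (\<delta> + u (m, N)))) \<partial>G) \<le>
    (\<integral>\<^sup>+u. ennreal (exp (- l * (smooth_norm \<eta> m (\<lambda>i. u (i, N)) - D u))) \<partial>G)"
proof (rule nn_integral_exp_mono_of_cdf[OF _ l])
  interpret prob_space G unfolding G_def by (rule prob_space_gauss)
  show "prob_space G" by unfold_locales
  have mU: "(\<lambda>u. smooth_norm \<eta> m (\<lambda>i. \<Sum>j<N. u (i, j) * z k j)) \<in> borel_measurable G" for k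
    unfolding smooth_norm_def G_def by measurable
  have mV: "(\<lambda>u. smooth_norm \<eta> m (\<lambda>i. u (i, N))) \<in> borel_measurable G"
    unfolding smooth_norm_def G_def by measurable
  have mc: "(\<lambda>u. u (m, j)) \<in> borel_measurable G" if "j \<le> N" for j
    unfolding G_def using that by (intro measurable_gauss_component) auto
  note [measurable] = mU mV mc[OF order_refl]
  have mW: "(\<lambda>u. \<Sum>j<N. u (m, j) * z k j) \<in> borel_measurable G" for k
    by (intro borel_measurable_sum borel_measurable_times mc) auto
  note [measurable] = mW
  show "{u \<in> space G. \<exists>k\<in>L. smooth_norm \<eta> m (\<lambda>i. \<Sum>j<N. u (i, j) * z k j) < \<delta>} \<in> sets G"
    using L by measurable
  show "(\<lambda>u. \<delta> + u (m, N)) \<in> borel_measurable G" by measurable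
  show "(\<lambda>u. smooth_norm \<eta> m (\<lambda>i. u (i, N)) - D u) \<in> borel_measurable G" by measurable
  fix c
  have "measure G {u \<in> space G. u \<in> {u \<in> space G. \<exists>k\<in>L. smooth_norm \<eta> m (\<lambda>i. \<Sum>j<N. u (i, j) * z k j) < \<delta>} \<and> \<delta> + u (m, N) < c} \<le>
    measure G {u \<in> space G. \<exists>k\<in>L. smooth_norm \<eta> m (\<lambda>i. \<Sum>j<N. u (i, j) * z k j) + u (m, N) < c}"
  proof (rule finite_measure_mono)
    show "{u \<in> space G. u \<in> {u \<in> space G. \<exists>k\<in>L. smooth_norm \<eta> m (\<lambda>i. \<Sum>j<N. u (i, j) * z k j) < \<delta>} \<and> \<delta> + u (m, N) < c}
      \<subseteq> {u \<in> space G. \<exists>k\<in>L. smooth_norm \<eta> m (\<lambda>i. \<Sum>j<N. u (i, j) * z k j) + u (m, N) < c}"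
      by force
    show "{u \<in> space G. \<exists>k\<in>L. smooth_norm \<eta> m (\<lambda>i. \<Sum>j<N. u (i, j) * z k j) + u (m, N) < c} \<in> events"
      using L by measurable
  qed
  also have "\<dots> \<le> measure G {u \<in> space G. \<exists>k\<in>L. smooth_norm \<eta> m (\<lambda>i. u (i, N)) + (\<Sum>j<N. u (m, j) * z k j) \<le> c}"
    unfolding G_def by (rule gordon_comparison[OF L unit \<eta>])
  also have "\<dots> \<le> measure G {u \<in> space G. smooth_norm \<eta> m (\<lambda>i. u (i, N)) - D u \<le> c}"
  proof (rule finite_measure_mono)
    show "{u \<in> space G. \<exists>k\<in>L. smooth_norm \<eta> m (\<lambda>i. u (i, N)) + (\<Sum>j<N. u (m, j) * z k j) \<le> c}
      \<subseteq> {u \<in> space G. smooth_norm \<eta> m (\<lambda>i. u (i, N)) - D u \<le> c}"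
    proof safe
      fix u k assume "k \<in> L" "smooth_norm \<eta> m (\<lambda>i. u (i, N)) + (\<Sum>j<N. u (m, j) * z k j) \<le> c"
      with D_ge[of k u] show "smooth_norm \<eta> m (\<lambda>i. u (i, N)) - D u \<le> c" by linarith
    qed
  qed measurable
  finally show "measure G {u \<in> space G. u \<in> {u \<in> space G. \<exists>k\<in>L. smooth_norm \<eta> m (\<lambda>i. \<Sum>j<N. u (i, j) * z k j) < \<delta>} \<and> \<delta> + u (m, N) < c} \<le>
    measure G {u \<in> space G. smooth_norm \<eta> m (\<lambda>i. u (i, N)) - D u \<le> c}" .
qed

section \<open>The Laplace transform of a Gaussian norm\<close>

text \<open>A single term of the exponential series of \<open>l * x\<close> is at most the whole
  sum.\<close>

lemma power_mult_exp_minus_le_fact: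
  fixes x l :: real
  assumes "0 \<le> x" "0 < l"
  shows "x ^ k * exp (- l * x) \<le> fact k / l ^ k"
proof -
  have "(\<Sum>n\<in>{k}. (l * x) ^ n /\<^sub>R fact n) \<le> (\<Sum>n. (l * x) ^ n /\<^sub>R fact n)"
    using assms by (intro sum_le_suminf summable_exp_generic) auto
  then have "(l * x) ^ k \<le> fact k * exp (l * x)"
    by (simp add: exp_def field_simps)
  then show ?thesis using assms by (simp add: exp_minus field_simps power_mult_distrib)
qed

lemma power_mult_exp_minus_le:
  fixes x l :: real
  assumes "0 \<le> x" "0 < l"
  shows "exp (- l * x) \<le> 1" "x * exp (- l * x) \<le> 1 / l" "x\<^sup>2 * exp (- l * x) \<le> 2 / l\<^sup>2"
  using power_mult_exp_minus_le_fact[OF assms, of 0] power_mult_exp_minus_le_fact[OF assms, of 1]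
    power_mult_exp_minus_le_fact[OF assms, of 2] by auto

text \<open>Stein's identity for the radial vector field \<open>g (n v) * v\<close>, summed over the
  coordinates: the right side integrates its divergence, and
  \<open>(n v)\<^sup>2 - \<eta>\<^sup>2\<close> is the squared length of \<open>v\<close>.\<close>

lemma gauss_radial_integration_by_parts:
  fixes g g' :: "real \<Rightarrow> real" and K :: "'i set" and \<eta> C :: real
  defines "n \<equiv> \<lambda>v. sqrt (\<eta>\<^sup>2 + (\<Sum>i\<in>K. (v i)\<^sup>2))"
  assumes K: "finite K" and \<eta>: "\<eta> > 0"
    and g: "\<And>x. x > 0 \<Longrightarrow> (g has_real_derivative g' x) (at x)" "\<And>x. x > 0 \<Longrightarrow> isCont g' x"
    and [measurable]: "g \<in> borel_measurable borel" "g' \<in> borel_measurable borel"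
    and bound: "\<And>x. x \<ge> \<eta> \<Longrightarrow> \<bar>x * g x\<bar> \<le> C" "\<And>x. x \<ge> \<eta> \<Longrightarrow> \<bar>g x\<bar> + \<bar>x * g' x\<bar> \<le> C"
  shows "(\<integral>v. ((n v)\<^sup>2 - \<eta>\<^sup>2) * g (n v) \<partial>gauss K) =
    real (card K) * (\<integral>v. g (n v) \<partial>gauss K) + (\<integral>v. ((n v)\<^sup>2 - \<eta>\<^sup>2) / n v * g' (n v) \<partial>gauss K)"
proof -
  have n2: "(n v)\<^sup>2 = \<eta>\<^sup>2 + (\<Sum>i\<in>K. (v i)\<^sup>2)" for v
    unfolding n_def by (simp add: sum_nonneg)
  have n_ge: "n v \<ge> \<eta>" for v
    unfolding n_def by (intro real_le_rsqrt) (auto intro: sum_nonneg)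
  have n_pos: "n v > 0" for v using n_ge[of v] \<eta> by linarith
  have mn[measurable]: "n \<in> borel_measurable (gauss K)"
    unfolding n_def using K by measurable
  \<comment> \<open>No coordinate exceeds \<open>n v\<close>, so the bounds on the profile
    \<open>g\<close> give the bounds in each coordinate that integration by parts asks for.\<close>
  have comp: "(v i)\<^sup>2 \<le> (n v)\<^sup>2" if "i \<in> K" for i v
    using member_le_sum[of i K "\<lambda>i. (v i)\<^sup>2"] that K by (simp add: n2 add_increasing)
  have comp': "\<bar>v i\<bar> \<le> n v" if "i \<in> K" for i v
    using comp[OF that, of v] n_pos[of v] by (metis abs_le_square_iff abs_of_pos)
  define h' where "h' i v = g (n v) + (v i)\<^sup>2 / n v * g' (n v)" for i v
  have ibp: "integrable (gauss K) (\<lambda>v. v i * (v i * g (n v)))" "integrable (gauss K) (h' i)"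
     "(\<integral>v. v i * (v i * g (n v)) \<partial>gauss K) = (\<integral>v. h' i v \<partial>gauss K)" if i: "i \<in> K" for i
  proof -
    have dn: "((\<lambda>s. n (v(i := s))) has_real_derivative t / n (v(i := t))) (at t)" for v t
    proof -
      have eq: "n (v(i := s)) = sqrt (s\<^sup>2 + (\<eta>\<^sup>2 + (\<Sum>j\<in>K - {i}. (v j)\<^sup>2)))" for s
        unfolding n_def using K i by (subst sum.remove[of K i]) (auto intro!: arg_cong[where f=sqrt] sum.cong)
      have "0 < t\<^sup>2 + (\<eta>\<^sup>2 + (\<Sum>j\<in>K - {i}. (v j)\<^sup>2))"
        using \<eta> by (intro add_nonneg_pos add_pos_nonneg sum_nonneg) auto
      then show ?thesis unfolding eq
        by (auto intro!: derivative_eq_intros simp: field_simps)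
    qed
    have cn: "isCont (\<lambda>s. n (v(i := s))) t" for v t
      using dn by (rule DERIV_isCont)
    have dh: "((\<lambda>s. (v(i := s)) i * g (n (v(i := s)))) has_real_derivative h' i (v(i := t))) (at t)" for v t
      using DERIV_mult[OF DERIV_ident DERIV_chain2[OF g(1)[OF n_pos] dn[of v t]]]
      by (simp add: h'_def power2_eq_square mult_ac)
    have ch: "isCont (\<lambda>s. h' i (v(i := s))) t" for v t
    proof -
      have "isCont (\<lambda>s. g (n (v(i := s)))) t" "isCont (\<lambda>s. g' (n (v(i := s)))) t"
        by (rule isCont_o2[where f="\<lambda>s. n (v(i := s))", OF cn]; rule DERIV_isCont[OF g(1)] g(2); rule n_pos)+
      then show ?thesis
        unfolding h'_def using cn n_pos[of "v(i := t)"] by (intro continuous_intros) auto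
    qed
    have b1: "\<bar>v i * g (n v)\<bar> \<le> C" for v
    proof -
      have "\<bar>v i * g (n v)\<bar> \<le> \<bar>n v * g (n v)\<bar>"
        using comp'[OF i, of v] n_pos[of v] by (auto simp: abs_mult intro!: mult_right_mono)
      also have "\<dots> \<le> C" using bound(1)[OF n_ge] .
      finally show ?thesis .
    qed
    have b2: "\<bar>h' i v\<bar> \<le> C" for v
    proof -
      have "(v i)\<^sup>2 / n v \<le> n v"
        using comp[OF i, of v] n_pos[of v] by (simp add: field_simps power2_eq_square)
      then have "\<bar>(v i)\<^sup>2 / n v * g' (n v)\<bar> \<le> \<bar>n v * g' (n v)\<bar>"
        using n_pos[of v] mult_right_mono[of "(v i)\<^sup>2 / n v" "n v" "\<bar>g' (n v)\<bar>"] by (simp add: abs_mult)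
      then show ?thesis using bound(2)[OF n_ge[of v]] unfolding h'_def by linarith
    qed
    have m1: "(\<lambda>v. v i * g (n v)) \<in> borel_measurable (gauss K)" using i by measurable
    have m2: "h' i \<in> borel_measurable (gauss K)" unfolding h'_def using i by measurable
    note * = gauss_integration_by_parts[OF K i m1 m2 dh ch b1 b2]
    show "integrable (gauss K) (\<lambda>v. v i * (v i * g (n v)))" "integrable (gauss K) (h' i)"
     "(\<integral>v. v i * (v i * g (n v)) \<partial>gauss K) = (\<integral>v. h' i v \<partial>gauss K)"
      using * by simp_all
  qed
  have ig: "integrable (gauss K) (\<lambda>v. g (n v))"
  proof (rule integrable_gauss_bounded[where C=C])
    show "\<bar>g (n v)\<bar> \<le> C" for v using bound(2)[OF n_ge[of v]] by linarith
  qed measurable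
  have ig': "integrable (gauss K) (\<lambda>v. (v i)\<^sup>2 / n v * g' (n v))" if "i \<in> K" for i
    using Bochner_Integration.integrable_diff[OF ibp(2)[OF that] ig] by (simp add: h'_def)
  have "(\<integral>v. ((n v)\<^sup>2 - \<eta>\<^sup>2) * g (n v) \<partial>gauss K) = (\<integral>v. (\<Sum>i\<in>K. v i * (v i * g (n v))) \<partial>gauss K)"
    unfolding n2 by (intro Bochner_Integration.integral_cong refl) (simp add: sum_distrib_right power2_eq_square mult.assoc)
  also have "\<dots> = (\<Sum>i\<in>K. \<integral>v. h' i v \<partial>gauss K)"
    by (subst Bochner_Integration.integral_sum) (auto simp: ibp)
  also have "\<dots> = (\<Sum>i\<in>K. (\<integral>v. g (n v) \<partial>gauss K) + (\<integral>v. (v i)\<^sup>2 / n v * g' (n v) \<partial>gauss K))"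
    unfolding h'_def by (intro sum.cong refl Bochner_Integration.integral_add ig ig')
  also have "\<dots> = real (card K) * (\<integral>v. g (n v) \<partial>gauss K) + (\<integral>v. (\<Sum>i\<in>K. (v i)\<^sup>2 / n v * g' (n v)) \<partial>gauss K)"
    by (subst Bochner_Integration.integral_sum[OF ig'], assumption) (simp add: sum.distrib)
  finally show ?thesis
    by (simp add: n2 sum_distrib_right sum_divide_distrib)
qed

text \<open>With \<open>p k l\<close> the expectation of \<open>n ^ k * exp (- l * n)\<close>, integration by parts gives
  \<open>m * p 0 \<le> p 2 + l * p 1\<close> and \<open>p 3 \<le> m' * p 1 - l * p 2\<close>. Together with \<open>(p 2)\<^sup>2 \<le> p 1 * p 3\<close>
  this bounds the logarithmic derivative \<open>- p 1 / p 0\<close> of the Laplace transform \<open>p 0\<close>.\<close>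
lemma gauss_norm_laplace_bound:
  fixes K :: "'i set" and \<eta> \<Lambda> :: real
  defines "n \<equiv> \<lambda>v. sqrt (\<eta>\<^sup>2 + (\<Sum>i\<in>K. (v i)\<^sup>2))"
  defines "m \<equiv> real (card K)"
  defines "m' \<equiv> m + 1 + \<eta>\<^sup>2 + \<Lambda> * \<eta>"
  assumes K: "finite K" and \<eta>: "\<eta> > 0" and \<Lambda>: "\<Lambda> > 0"
  shows "(\<integral>v. exp (- \<Lambda> * n v) \<partial>gauss K) \<le> exp (- (m / m') * (\<Lambda> * sqrt m' - \<Lambda>\<^sup>2 / 4))"
proof -
  interpret prob_space "gauss K" by (rule prob_space_gauss)
  have n_ge: "n v \<ge> \<eta>" for v
    unfolding n_def by (intro real_le_rsqrt) (auto intro: sum_nonneg)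
  have n_pos: "n v > 0" for v using n_ge[of v] \<eta> by linarith
  have mn[measurable]: "n \<in> borel_measurable (gauss K)"
    unfolding n_def using K by measurable
  have m0: "0 \<le> m" by (simp add: m_def)
  have "0 \<le> \<eta>\<^sup>2" "0 \<le> \<Lambda> * \<eta>" using \<eta> \<Lambda> by auto
  then have m': "m' > 0" "m \<ge> 0" using m0 unfolding m'_def by linarith+
  define p where "p k l = (\<integral>v. n v ^ k * exp (- l * n v) \<partial>gauss K)" for k l
  have ip: "integrable (gauss K) (\<lambda>v. n v ^ k * exp (- l * n v))" if "l > 0" for k l
  proof (rule integrable_gauss_bounded[where C="fact k / l ^ k"])
    fix v
    show "\<bar>n v ^ k * exp (- l * n v)\<bar> \<le> fact k / l ^ k"
      using power_mult_exp_minus_le_fact[of "n v" l k] that n_pos[of v] by (simp add: abs_mult)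
  qed measurable
  have ip0: "integrable (gauss K) (\<lambda>v. exp (- l * n v))" if "l > 0" for l
  proof -
    have "integrable (gauss K) (\<lambda>v. n v ^ 0 * exp (- l * n v))" using that by (rule ip)
    then show ?thesis by simp
  qed
  \<comment> \<open>As \<open>p 0\<close> has derivative \<open>- p 1\<close>, this says that
    \<open>p 0 l * exp (E l)\<close>, with the exponent \<open>E\<close> introduced below, decreases
    in \<open>l\<close>.\<close>
  have key: "m * (sqrt m' - l / 2) * p 0 l \<le> m' * p 1 l" if l: "0 < l" "l \<le> \<Lambda>" for l
  proof -
    let ?e = "\<lambda>v. exp (- l * n v)" and ?q = "\<lambda>v. (n v)\<^sup>2 - \<eta>\<^sup>2"
    have I: "integrable (gauss K) (\<lambda>v. n v ^ d * ?e v)" for d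
      using l(1) by (rule ip)
    have I0: "integrable (gauss K) (\<lambda>v. n v ^ 0 * ?e v)" by (rule I)
    have I1: "integrable (gauss K) (\<lambda>v. n v ^ 1 * ?e v)" by (rule I)
    have I2: "integrable (gauss K) (\<lambda>v. n v ^ 2 * ?e v)" by (rule I)
    have e: "0 < n v ^ k * ?e v" for k v using n_pos by simp
    have p_nonneg: "0 \<le> p k l" for k
      unfolding p_def by (intro Bochner_Integration.integral_nonneg) (simp add: less_imp_le[OF n_pos])
    have p01: "\<eta> * p 0 l \<le> p 1 l"
      unfolding p_def integral_mult_right_zero[symmetric]
      by (intro integral_mono integrable_mult_right I) (use n_ge in \<open>auto intro!: mult_right_mono\<close>)
    have p1: "p 1 l > 0"
    proof -
      have "(\<integral>v. 0 \<partial>gauss K) < (\<integral>v. n v ^ 1 * ?e v \<partial>gauss K)"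
        by (rule integral_less_AE_space) (use I1 n_pos emeasure_space_1 in auto)
      then show ?thesis by (simp add: p_def)
    qed
    have r: "0 \<le> ?q v / n v" "?q v / n v \<le> n v" for v
      using n_ge[of v] n_pos[of v] \<eta> by (auto simp: field_simps power2_eq_square intro: mult_mono)
    have r_bound: "\<bar>?q v / n v * (- l * ?e v)\<bar> \<le> 1" for v
    proof -
      have "\<bar>?q v / n v * (- l * ?e v)\<bar> =
        ?q v / n v * (l * ?e v)"
        using r(1)[of v] l by (simp only: abs_mult abs_minus_cancel abs_of_nonneg) simp
      also have "\<dots> \<le> n v * (l * ?e v)"
        using r(2)[of v] l by (intro mult_right_mono) auto
      also have "\<dots> \<le> 1"
        using power_mult_exp_minus_le(2)[of "n v" l] n_pos[of v] l by (simp add: field_simps)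
      finally show ?thesis .
    qed
    have A: "m * p 0 l \<le> p 2 l + l * p 1 l"
    proof -
      have p0: "(\<integral>v. ?e v \<partial>gauss K) = p 0 l" by (simp add: p_def)
      have "(\<integral>v. ?q v * ?e v \<partial>gauss K) =
        m * (\<integral>v. ?e v \<partial>gauss K) + (\<integral>v. ?q v / n v * (- l * ?e v) \<partial>gauss K)"
        unfolding n_def m_def
      proof (rule gauss_radial_integration_by_parts[OF K \<eta>, where g="\<lambda>x. exp (- l * x)" and g'="\<lambda>x. - l * exp (- l * x)" and C="1 / l + 2"])
        fix x assume "x \<ge> \<eta>"
        then have x: "x > 0" using \<eta> by linarith
        note b = power_mult_exp_minus_le[of x l]
        have "l * (x * exp (- l * x)) \<le> l * (1 / l)" using b(2) x l by (intro mult_left_mono) auto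
        then have lx: "l * (x * exp (- l * x)) \<le> 1" using l by simp
        have abs: "\<bar>x * exp (- l * x)\<bar> = x * exp (- l * x)" "\<bar>x * (- l * exp (- l * x))\<bar> = l * (x * exp (- l * x))"
          using x l by (simp_all add: abs_mult)
        have "0 \<le> 1 / l" "exp (- l * x) \<le> 1" "\<bar>exp (- l * x)\<bar> = exp (- l * x)" using b(1) x l by auto
        then show "\<bar>x * exp (- l * x)\<bar> \<le> 1 / l + 2" "\<bar>exp (- l * x)\<bar> + \<bar>x * (- l * exp (- l * x))\<bar> \<le> 1 / l + 2"
          unfolding abs using b(2) x l lx by linarith+
      qed (auto intro!: derivative_eq_intros continuous_intros)
      moreover have "(\<integral>v. ?q v * ?e v \<partial>gauss K) = p 2 l - \<eta>\<^sup>2 * p 0 l"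
        using I2 I0 by (simp add: p_def left_diff_distrib)
      moreover have "- l * p 1 l \<le> (\<integral>v. ?q v / n v * (- l * ?e v) \<partial>gauss K)"
        unfolding p_def integral_mult_right_zero[symmetric]
      proof (rule integral_mono)
        show "integrable (gauss K) (\<lambda>v. - l * (n v ^ 1 * ?e v))" using I1 by simp
        show "integrable (gauss K) (\<lambda>v. ?q v / n v * (- l * ?e v))"
          by (rule integrable_gauss_bounded[where C=1]) (use r_bound in auto)
        show "- l * (n v ^ 1 * ?e v) \<le> ?q v / n v * (- l * ?e v)" for v
          using mult_right_mono[OF r(2)[of v], of "l * ?e v"] l by (simp add: mult_ac)
      qed
      moreover have "0 \<le> \<eta>\<^sup>2 * p 0 l" using p_nonneg by simp
      ultimately show ?thesis unfolding p0 by linarith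
    qed
    \<comment> \<open>Origin of \<open>m'\<close>: the divergence gives \<open>m\<close>, the
      derivative of the profile \<open>x * exp (- l * x)\<close> gives 1, the difference between
      \<open>(n v)\<^sup>2\<close> and the squared length of \<open>v\<close> gives
      \<open>\<eta>\<^sup>2\<close>, and a remaining multiple of \<open>p 0\<close> is turned by
      \<open>p01\<close> into \<open>\<Lambda> * \<eta>\<close> times \<open>p 1\<close>.\<close>
    have B: "p 3 l \<le> m' * p 1 l - l * p 2 l"
    proof -
      have p1: "(\<integral>v. n v * ?e v \<partial>gauss K) = p 1 l" by (simp add: p_def)
      have "(\<integral>v. ?q v * (n v * ?e v) \<partial>gauss K) =
        m * (\<integral>v. n v * ?e v \<partial>gauss K) + (\<integral>v. ?q v / n v * ((1 - l * n v) * ?e v) \<partial>gauss K)"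
        unfolding n_def m_def
      proof (rule gauss_radial_integration_by_parts[OF K \<eta>, where g="\<lambda>x. x * exp (- l * x)" and g'="\<lambda>x. (1 - l * x) * exp (- l * x)" and C="2 / l\<^sup>2 + 4 / l"])
        fix x assume "x \<ge> \<eta>"
        then have x: "x > 0" using \<eta> by linarith
        note b = power_mult_exp_minus_le[of x l]
        have "l * (x\<^sup>2 * exp (- l * x)) \<le> l * (2 / l\<^sup>2)" using b(3) x l by (intro mult_left_mono) auto
        then have lx: "l * (x\<^sup>2 * exp (- l * x)) \<le> 2 / l" using l by (simp add: power2_eq_square)
        have pos: "0 \<le> x * exp (- l * x)" "0 \<le> l * (x\<^sup>2 * exp (- l * x))" "0 \<le> 1 / l" using x l by auto
        have "\<bar>x * (x * exp (- l * x))\<bar> = x\<^sup>2 * exp (- l * x)" using x by (simp add: abs_mult power2_eq_square)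
        moreover have "0 \<le> 4 / l" using l by simp
        ultimately show "\<bar>x * (x * exp (- l * x))\<bar> \<le> 2 / l\<^sup>2 + 4 / l" using b(3) x l(1) by linarith
        have "x * ((1 - l * x) * exp (- l * x)) = x * exp (- l * x) - l * (x\<^sup>2 * exp (- l * x))"
          by (simp add: power2_eq_square algebra_simps)
        then have "\<bar>x * exp (- l * x)\<bar> + \<bar>x * ((1 - l * x) * exp (- l * x))\<bar> \<le> 2 * (x * exp (- l * x)) + l * (x\<^sup>2 * exp (- l * x))"
          using pos by linarith
        also have "\<dots> \<le> 2 * (1 / l) + 2 / l" using b(2) x l lx by linarith
        also have "\<dots> \<le> 2 / l\<^sup>2 + 4 / l" by simp
        finally show "\<bar>x * exp (- l * x)\<bar> + \<bar>x * ((1 - l * x) * exp (- l * x))\<bar> \<le> 2 / l\<^sup>2 + 4 / l" .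
      qed (auto intro!: derivative_eq_intros continuous_intros simp: algebra_simps)
      moreover have "(\<integral>v. ?q v * (n v * ?e v) \<partial>gauss K) = p 3 l - \<eta>\<^sup>2 * p 1 l"
      proof -
        have "?q v * (n v * ?e v) = n v ^ 3 * ?e v - \<eta>\<^sup>2 * (n v ^ 1 * ?e v)" for v
          by (simp add: power2_eq_square power3_eq_cube algebra_simps)
        then show ?thesis unfolding p_def
          by (simp only: Bochner_Integration.integral_diff[OF I integrable_mult_right[OF I]] integral_mult_right_zero)
      qed
      moreover have "(\<integral>v. ?q v / n v * ((1 - l * n v) * ?e v) \<partial>gauss K) \<le>
        (\<integral>v. n v ^ 1 * ?e v - l * (n v ^ 2 * ?e v) + l * \<eta>\<^sup>2 * (n v ^ 0 * ?e v) \<partial>gauss K)"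
      proof (rule integral_mono)
        have e1: "?q v / n v * ((1 - l * n v) * ?e v) =
          ?q v / n v * ?e v - l * (n v ^ 2 * ?e v) + l * \<eta>\<^sup>2 * (n v ^ 0 * ?e v)" for v
          using n_pos[of v] by (simp add: field_simps power2_eq_square)
        have "integrable (gauss K) (\<lambda>v. ?q v / n v * (- l * ?e v))"
          by (rule integrable_gauss_bounded[where C=1]) (use r_bound in auto)
        from integrable_mult_right[OF this, of "- 1 / l"]
        have "integrable (gauss K) (\<lambda>v. ?q v / n v * ?e v)" using l by simp
        then show "integrable (gauss K) (\<lambda>v. ?q v / n v * ((1 - l * n v) * ?e v))"
          unfolding e1
          by (intro Bochner_Integration.integrable_add Bochner_Integration.integrable_diff integrable_mult_right I)
        show "?q v / n v * ((1 - l * n v) * ?e v) \<le>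
          n v ^ 1 * ?e v - l * (n v ^ 2 * ?e v) + l * \<eta>\<^sup>2 * (n v ^ 0 * ?e v)" for v
          unfolding e1 using mult_right_mono[OF r(2)[of v], of "?e v"] by simp
        show "integrable (gauss K) (\<lambda>v. n v ^ 1 * ?e v - l * (n v ^ 2 * ?e v) + l * \<eta>\<^sup>2 * (n v ^ 0 * ?e v))"
          by (intro Bochner_Integration.integrable_add Bochner_Integration.integrable_diff integrable_mult_right I)
      qed
      moreover have "\<dots> = p 1 l - l * p 2 l + l * \<eta>\<^sup>2 * p 0 l"
        unfolding p_def
        by (simp only: Bochner_Integration.integral_add Bochner_Integration.integral_diff Bochner_Integration.integrable_diff integrable_mult_right I integral_mult_right_zero)
      moreover have "l * \<eta>\<^sup>2 * p 0 l \<le> \<Lambda> * \<eta> * p 1 l"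
      proof -
        have "l * \<eta>\<^sup>2 * p 0 l = (l * \<eta>) * (\<eta> * p 0 l)" by (simp add: power2_eq_square)
        also have "\<dots> \<le> (\<Lambda> * \<eta>) * p 1 l" using p01 l \<eta> p_nonneg by (intro mult_mono) auto
        finally show ?thesis by simp
      qed
      ultimately have "p 3 l - \<eta>\<^sup>2 * p 1 l \<le> m * p 1 l + (p 1 l - l * p 2 l + \<Lambda> * \<eta> * p 1 l)" unfolding p1 by linarith
      then show ?thesis by (simp add: m'_def algebra_simps)
    qed
    \<comment> \<open>The mean of \<open>n\<close> under the weight
      \<open>n * exp (- l * n)\<close>; that its variance is nonnegative is the Cauchy-Schwarz bound
      on \<open>p 2\<close>.\<close>
    define X where "X = p 2 l / p 1 l"
    have X0: "X \<ge> 0" using p_nonneg p1 by (simp add: X_def)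
    have "0 \<le> (\<integral>v. (n v - X)\<^sup>2 * (n v ^ 1 * ?e v) \<partial>gauss K)"
      by (intro Bochner_Integration.integral_nonneg mult_nonneg_nonneg zero_le_power2 less_imp_le[OF e])
    also have "\<dots> = (\<integral>v. n v ^ 3 * ?e v - 2 * X * (n v ^ 2 * ?e v) + X\<^sup>2 * (n v ^ 1 * ?e v) \<partial>gauss K)"
      by (intro Bochner_Integration.integral_cong refl) (simp add: power2_eq_square power3_eq_cube algebra_simps)
    also have "\<dots> = p 3 l - 2 * X * p 2 l + X\<^sup>2 * p 1 l"
      unfolding p_def
      by (simp only: Bochner_Integration.integral_add Bochner_Integration.integral_diff Bochner_Integration.integrable_diff integrable_mult_right I integral_mult_right_zero)
    also have "\<dots> = p 3 l - X\<^sup>2 * p 1 l"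
      using p1 by (simp add: X_def power2_eq_square)
    also have "\<dots> \<le> (m' - l * X - X\<^sup>2) * p 1 l"
      using B p1 by (simp add: X_def algebra_simps)
    finally have X: "X\<^sup>2 + l * X \<le> m'" using p1 by (simp add: zero_le_mult_iff)
    have mp: "m * p 0 l \<le> (X + l) * p 1 l" using A p1 by (simp add: X_def algebra_simps)
    \<comment> \<open>Solving \<open>X\<^sup>2 + l * X \<le> m'\<close> gives
      \<open>X + l \<le> q + l / 2\<close> with \<open>q\<^sup>2 = m' + l\<^sup>2 / 4\<close>, and
      \<open>(q + l / 2) * (q - l / 2) = m'\<close>.\<close>
    have "(X + l) * (sqrt m' - l / 2) \<le> m'" if "sqrt m' - l / 2 \<ge> 0"
    proof -
      define q where "q = sqrt (m' + l\<^sup>2 / 4)"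
      have q: "q\<^sup>2 = m' + l\<^sup>2 / 4" using m' by (simp add: q_def)
      have "(X + l / 2)\<^sup>2 \<le> q\<^sup>2" unfolding q using X by (simp add: power2_eq_square algebra_simps)
      then have "X + l / 2 \<le> q" by (rule power2_le_imp_le) (use m' in \<open>auto simp: q_def\<close>)
      moreover have "sqrt m' \<le> q" unfolding q_def by (intro real_sqrt_le_mono) auto
      ultimately have "(X + l) * (sqrt m' - l / 2) \<le> (q + l / 2) * (q - l / 2)"
        using that X0 l by (intro mult_mono) auto
      also have "\<dots> = m'" using q by (simp add: power2_eq_square algebra_simps)
      finally show ?thesis .
    qed
    show ?thesis
    proof (cases "sqrt m' - l / 2 \<ge> 0")
      case True
      have "m * (sqrt m' - l / 2) * p 0 l = (sqrt m' - l / 2) * (m * p 0 l)" by simp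
      also have "\<dots> \<le> (sqrt m' - l / 2) * ((X + l) * p 1 l)" by (intro mult_left_mono mp True)
      also have "\<dots> = ((X + l) * (sqrt m' - l / 2)) * p 1 l" by simp
      also have "\<dots> \<le> m' * p 1 l"
        using \<open>sqrt m' - l / 2 \<ge> 0 \<Longrightarrow> _\<close>[OF True] p1 by (intro mult_right_mono) auto
      finally show ?thesis .
    next
      case False
      then have "m * (sqrt m' - l / 2) * p 0 l \<le> 0"
        using m' p_nonneg[of 0] by (intro mult_nonpos_nonneg mult_nonneg_nonpos) auto
      also have "0 \<le> m' * p 1 l" using m' p1 by simp
      finally show ?thesis .
    qed
  qed
  define E where "E l = (m / m') * (l * sqrt m' - l\<^sup>2 / 4)" for l
  have dp: "((\<lambda>l. p 0 l) has_real_derivative - p 1 l) (at l)" if "l > 0" for l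
  proof -
    have "((\<lambda>l. \<integral>v. exp (- l * n v) \<partial>gauss K) has_real_derivative (\<integral>v. - n v * exp (- l * n v) \<partial>gauss K)) (at l)"
    proof (rule has_derivative_integral[where a="l / 2" and b="l + 1" and g="\<lambda>_. 2 / l"])
      show "l \<in> {l / 2<..<l + 1}" using that by auto
      show "integrable (gauss K) (\<lambda>v. exp (- s * n v))" if "s \<in> {l / 2<..<l + 1}" for s
        using that \<open>l > 0\<close> by (intro ip0) auto
      show "((\<lambda>s. exp (- s * n v)) has_real_derivative - n v * exp (- s * n v)) (at s)" for s v
        by (auto intro!: derivative_eq_intros)
      show "\<bar>- n v * exp (- s * n v)\<bar> \<le> 2 / l" if "s \<in> {l / 2<..<l + 1}" for s v
      proof -
        have "n v * exp (- s * n v) \<le> 1 / s"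
          using power_mult_exp_minus_le(2)[of "n v" s] n_pos[of v] that \<open>l > 0\<close> by auto
        also have "\<dots> \<le> 2 / l" using that \<open>l > 0\<close> by (simp add: field_simps)
        finally show ?thesis using n_pos[of v] by (simp add: abs_mult)
      qed
    qed auto
    then show ?thesis by (simp add: p_def)
  qed
  have alg: "- a * e + (e * ((c / d) * t)) * b = e / d * (c * t * b - d * a)" if "d \<noteq> 0" for a b c d e t :: real
    using that by (simp add: field_simps)
  \<comment> \<open>The moment bounds degenerate at 0, so monotonicity is used on
    \<open>{s..\<Lambda>}\<close> with \<open>s > 0\<close>, and \<open>s\<close> tends to 0
    afterwards.\<close>
  have F: "p 0 \<Lambda> * exp (E \<Lambda>) \<le> exp (E s)" if s: "0 < s" "s \<le> \<Lambda>" for s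
  proof -
    have "p 0 \<Lambda> * exp (E \<Lambda>) \<le> p 0 s * exp (E s)"
    proof (rule DERIV_nonpos_imp_nonincreasing[OF s(2)])
      fix l assume l: "s \<le> l" "l \<le> \<Lambda>"
      then have l0: "l > 0" using s by linarith
      have "(E has_real_derivative (m / m') * (sqrt m' - l / 2)) (at l)"
        unfolding E_def using m'(1) by (auto intro!: derivative_eq_intros)
      then have "((\<lambda>l. p 0 l * exp (E l)) has_real_derivative
        - p 1 l * exp (E l) + (exp (E l) * ((m / m') * (sqrt m' - l / 2))) * p 0 l) (at l)"
        by (intro DERIV_mult dp l0 DERIV_fun_exp)
      moreover have "- p 1 l * exp (E l) + (exp (E l) * ((m / m') * (sqrt m' - l / 2))) * p 0 l =
        exp (E l) / m' * (m * (sqrt m' - l / 2) * p 0 l - m' * p 1 l)"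
        by (rule alg) (use m'(1) in linarith)
      moreover have "\<dots> \<le> 0"
        using key[OF l0 l(2)] m' by (intro mult_nonneg_nonpos) auto
      ultimately show "\<exists>y. ((\<lambda>l. p 0 l * exp (E l)) has_real_derivative y) (at l) \<and> y \<le> 0"
        by auto
    qed
    also have "\<dots> \<le> 1 * exp (E s)"
    proof (intro mult_right_mono)
      have "p 0 s \<le> (\<integral>v. 1 \<partial>gauss K)"
        unfolding p_def using s n_pos ip0[OF s(1)]
        by (intro integral_mono) (auto simp: less_imp_le)
      then show "p 0 s \<le> 1" by (simp add: prob_space)
    qed auto
    finally show ?thesis by simp
  qed
  have "((\<lambda>s. exp (E s)) \<longlongrightarrow> exp (E 0)) (at_right 0)"
    unfolding E_def by (intro tendsto_intros) simp
  moreover have "eventually (\<lambda>s. p 0 \<Lambda> * exp (E \<Lambda>) \<le> exp (E s)) (at_right 0)"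
    using F \<Lambda> by (auto simp: eventually_at_right_field intro!: exI[of _ \<Lambda>])
  ultimately have "p 0 \<Lambda> * exp (E \<Lambda>) \<le> exp (E 0)"
    by (intro tendsto_lowerbound) auto
  then have "p 0 \<Lambda> \<le> exp (- E \<Lambda>)"
    by (simp add: E_def exp_minus field_simps)
  then show ?thesis by (simp add: p_def E_def)
qed

section \<open>One-dimensional exponential moments\<close>

text \<open>For standard normal \<open>u\<close> this is the mean of
  \<open>(max 0 (\<tau> - u))\<^sup>2\<close>, the share of one support coordinate in the expected
  squared distance. The companion \<open>upper_sq\<close> is half the share of a coordinate off the
  support, where both tails count.\<close>

definition lower_sq :: "real \<Rightarrow> real" where
  "lower_sq \<tau> = (LBINT u:{..\<tau>}. (u - \<tau>)\<^sup>2 * std_normal_density u)"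

definition upper_sq :: "real \<Rightarrow> real" where
  "upper_sq \<tau> = (LBINT u:{\<tau>..}. (u - \<tau>)\<^sup>2 * std_normal_density u)"

lemma nn_integral_std_gauss:
  "f \<in> borel_measurable borel \<Longrightarrow>
    (\<integral>\<^sup>+u. f u \<partial>std_gauss) = (\<integral>\<^sup>+u. ennreal (std_normal_density u) * f u \<partial>lborel)"
  by (rule nn_integral_density) auto

lemma std_normal_density_minus: "std_normal_density (- u) = std_normal_density u"
  by (simp add: std_normal_density_def)

lemma nn_integral_std_gauss_minus:
  assumes [measurable]: "f \<in> borel_measurable borel"
  shows "(\<integral>\<^sup>+u. f (- u) \<partial>std_gauss) = (\<integral>\<^sup>+u. f u \<partial>std_gauss)"
proof -
  have "(\<integral>\<^sup>+u. ennreal (std_normal_density u) * f u \<partial>lborel) =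
    ennreal \<bar>-1\<bar> * (\<integral>\<^sup>+u. ennreal (std_normal_density (0 + -1 * u)) * f (0 + -1 * u) \<partial>lborel)"
    by (rule nn_integral_real_affine) auto
  then show ?thesis by (simp add: nn_integral_std_gauss std_normal_density_minus)
qed

lemma std_normal_density_antimono:
  "0 \<le> a \<Longrightarrow> a \<le> b \<Longrightarrow> std_normal_density b \<le> std_normal_density a"
  unfolding std_normal_density_def by (intro mult_left_mono) (auto intro: power_mono)

lemma integrable_shifted_sq:
  "integrable lborel (\<lambda>u. (u - \<tau>)\<^sup>2 * std_normal_density u)"
proof -
  have "(\<lambda>u. (u - \<tau>)\<^sup>2 * std_normal_density u) =
    (\<lambda>u. std_normal_density u * u ^ 2 - 2 * \<tau> * (std_normal_density u * u ^ 1) + \<tau>\<^sup>2 * std_normal_density u)"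
    by (auto simp: power2_diff algebra_simps)
  then show ?thesis
    using integrable_std_normal_moment[of 2] integrable_std_normal_moment[of 1] by simp
qed

lemma integral_shifted_sq:
  "(\<integral>u. (u - \<tau>)\<^sup>2 * std_normal_density u \<partial>lborel) = 1 + \<tau>\<^sup>2"
proof -
  have "(\<lambda>u. (u - \<tau>)\<^sup>2 * std_normal_density u) =
    (\<lambda>u. std_normal_density u * u ^ 2 - 2 * \<tau> * (std_normal_density u * u ^ 1) + \<tau>\<^sup>2 * std_normal_density u)"
    by (auto simp: power2_diff algebra_simps)
  then show ?thesis
    using integrable_std_normal_moment[of 2] integrable_std_normal_moment[of 1]
      integral_std_normal_moment_even[of 1] integral_std_normal_moment_odd[of 0]
    by (simp add: fact_numeral)
qed

lemma nn_integral_upper_sq: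
  "(\<integral>\<^sup>+u. ennreal ((u - \<tau>)\<^sup>2) * indicator {\<tau>..} u \<partial>std_gauss) = ennreal (upper_sq \<tau>)"
  "0 \<le> upper_sq \<tau>"
proof -
  have "(\<integral>\<^sup>+u. ennreal ((u - \<tau>)\<^sup>2) * indicator {\<tau>..} u \<partial>std_gauss) =
    (\<integral>\<^sup>+u. ennreal (indicat_real {\<tau>..} u *\<^sub>R ((u - \<tau>)\<^sup>2 * std_normal_density u)) \<partial>lborel)"
    by (subst nn_integral_std_gauss) (auto intro!: nn_integral_cong simp: indicator_def ennreal_mult' mult_ac)
  also have "\<dots> = ennreal (upper_sq \<tau>)"
    unfolding upper_sq_def set_lebesgue_integral_def
    by (rule nn_integral_eq_integral)
      (auto intro!: integrable_mult_indicator[OF _ integrable_shifted_sq, unfolded real_scaleR_def])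
  finally show "(\<integral>\<^sup>+u. ennreal ((u - \<tau>)\<^sup>2) * indicator {\<tau>..} u \<partial>std_gauss) = ennreal (upper_sq \<tau>)" .
  show "0 \<le> upper_sq \<tau>"
    unfolding upper_sq_def set_lebesgue_integral_def by (intro Bochner_Integration.integral_nonneg) auto
qed

text \<open>The parametrisation makes \<open>1 - 2 * \<mu> = 1 / (1 + 2 * x)\<close>, so
  \<open>y\<close> is the exponential moment of \<open>\<mu> * u\<^sup>2\<close> for a standard
  normal \<open>u\<close>. The polynomial factor in front of the exponential is the one in
  \<open>exp t \<le> 1 + t * exp t\<close>, through which the bound is applied.\<close>

lemma upper_tail_exp_bound:
  fixes \<tau> x :: real
  assumes \<tau>: "0 \<le> \<tau>" and x: "0 \<le> x"
  defines "\<mu> \<equiv> x / (1 + 2 * x)" and "y \<equiv> sqrt (1 + 2 * x)"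
  shows "(\<integral>\<^sup>+u. ennreal (\<mu> * (u - \<tau>)\<^sup>2 * exp (\<mu> * (u - \<tau>)\<^sup>2)) * indicator {\<tau>..} u \<partial>std_gauss)
    \<le> ennreal (x * y * upper_sq \<tau>)"
proof -
  have y: "y\<^sup>2 = 1 + 2 * x" "y \<ge> 1" using x by (auto simp: y_def)
  have \<mu>: "\<mu> * y\<^sup>2 = x" "0 \<le> \<mu>" using x by (auto simp: \<mu>_def y)
  let ?g = "\<lambda>u. ennreal (std_normal_density u) * (ennreal (\<mu> * (u - \<tau>)\<^sup>2 * exp (\<mu> * (u - \<tau>)\<^sup>2)) * indicator {\<tau>..} u)"
  \<comment> \<open>dilation of the half line around \<open>\<tau>\<close> by the factor \<open>y\<close>, which absorbs the exponential weight\<close>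
  have "(\<integral>\<^sup>+u. ?g u \<partial>lborel) = ennreal \<bar>y\<bar> * (\<integral>\<^sup>+t. ?g (\<tau> * (1 - y) + y * t) \<partial>lborel)"
    by (rule nn_integral_real_affine) (use y in auto)
  also have "\<dots> \<le> ennreal \<bar>y\<bar> * (\<integral>\<^sup>+t. ennreal x * (ennreal (std_normal_density t) * (ennreal ((t - \<tau>)\<^sup>2) * indicator {\<tau>..} t)) \<partial>lborel)"
  proof (intro mult_left_mono nn_integral_mono)
    fix t
    define u where "u = \<tau> * (1 - y) + y * t"
    have u: "u - \<tau> = y * (t - \<tau>)" by (simp add: u_def algebra_simps)
    then have "\<tau> \<le> u \<longleftrightarrow> 0 \<le> y * (t - \<tau>)" by linarith
    then have ind: "\<tau> \<le> u \<longleftrightarrow> \<tau> \<le> t" using y(2) by (auto simp: zero_le_mult_iff)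
    show "?g u \<le> ennreal x * (ennreal (std_normal_density t) * (ennreal ((t - \<tau>)\<^sup>2) * indicator {\<tau>..} t))"
    proof (cases "\<tau> \<le> t")
      case True
      have sq: "\<mu> * (u - \<tau>)\<^sup>2 = x * (t - \<tau>)\<^sup>2"
        unfolding u power_mult_distrib using \<mu> by (simp flip: mult.assoc)
      have "std_normal_density u * exp (x * (t - \<tau>)\<^sup>2) \<le> std_normal_density t"
      proof -
        \<comment> \<open>Here \<open>\<tau> \<ge> 0\<close> enters:
          \<open>u\<^sup>2 - t\<^sup>2 - 2 * x * (t - \<tau>)\<^sup>2\<close> is twice this
          product.\<close>
        have "0 \<le> \<tau> * ((y - 1) * (t - \<tau>))" using \<tau> True y by (intro mult_nonneg_nonneg) auto
        moreover have "u\<^sup>2 = \<tau>\<^sup>2 + 2 * \<tau> * (y * (t - \<tau>)) + y\<^sup>2 * (t - \<tau>)\<^sup>2"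
        proof -
          have "u = \<tau> + y * (t - \<tau>)" using u by linarith
          then show ?thesis by (simp only: power2_sum power_mult_distrib)
        qed
        ultimately have "- u\<^sup>2 / 2 + x * (t - \<tau>)\<^sup>2 \<le> - t\<^sup>2 / 2"
          unfolding y(1) by (simp add: power2_eq_square algebra_simps)
        then show ?thesis
          unfolding std_normal_density_def by (simp add: divide_right_mono flip: exp_add)
      qed
      then have "x * (t - \<tau>)\<^sup>2 * (std_normal_density u * exp (x * (t - \<tau>)\<^sup>2)) \<le> x * (t - \<tau>)\<^sup>2 * std_normal_density t"
        using x by (intro mult_left_mono) auto
      then show ?thesis using True ind x
        by (auto simp: sq indicator_def mult_ac simp flip: ennreal_mult intro!: ennreal_leI)
    qed (use ind in simp)
  qed auto
  also have "(\<integral>\<^sup>+t. ennreal x * (ennreal (std_normal_density t) * (ennreal ((t - \<tau>)\<^sup>2) * indicator {\<tau>..} t)) \<partial>lborel) =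
    ennreal x * ennreal (upper_sq \<tau>)"
    by (simp add: nn_integral_cmult nn_integral_std_gauss flip: nn_integral_upper_sq)
  also have "ennreal \<bar>y\<bar> * (ennreal x * ennreal (upper_sq \<tau>)) = ennreal (x * y * upper_sq \<tau>)"
    using x y nn_integral_upper_sq(2)[of \<tau>] by (simp add: mult_ac flip: ennreal_mult)
  finally show ?thesis by (subst nn_integral_std_gauss) auto
qed

text \<open>By \<open>exp t \<le> 1 + t * exp t\<close> only the two tails contribute to the excess
  over 1. The result is again an exponential, so that over independent coordinates the exponents add
  up to the risk functional.\<close>

lemma soft_threshold_exp_bound:
  fixes \<tau> x :: real
  assumes \<tau>: "0 \<le> \<tau>" and x: "0 \<le> x"
  shows "(\<integral>\<^sup>+u. ennreal (exp (x / (1 + 2 * x) * (max 0 (\<bar>u\<bar> - \<tau>))\<^sup>2)) \<partial>std_gauss)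
    \<le> ennreal (exp ((x + x\<^sup>2) * (2 * upper_sq \<tau>)))"
proof -
  define \<mu> where "\<mu> = x / (1 + 2 * x)"
  define y where "y = sqrt (1 + 2 * x)"
  define k where "k u = ennreal (\<mu> * (u - \<tau>)\<^sup>2 * exp (\<mu> * (u - \<tau>)\<^sup>2)) * indicator {\<tau>..} u" for u
  have [measurable]: "k \<in> borel_measurable borel" unfolding k_def by measurable
  have \<mu>: "0 \<le> \<mu>" using x by (simp add: \<mu>_def)
  have y: "y \<le> 1 + x" unfolding y_def using x by (intro real_le_lsqrt) (auto simp: power2_eq_square algebra_simps)
  have k_le: "(\<integral>\<^sup>+u. k u \<partial>std_gauss) \<le> ennreal (x * y * upper_sq \<tau>)"
    unfolding k_def \<mu>_def y_def by (rule upper_tail_exp_bound[OF \<tau> x])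
  have pw: "ennreal (exp (\<mu> * (max 0 (\<bar>u\<bar> - \<tau>))\<^sup>2)) \<le> 1 + (k u + k (- u))" for u
  proof -
    have *: "exp t \<le> 1 + t * exp t" for t :: real
    proof -
      have "1 - t \<le> exp (- t)" using exp_ge_add_one_self[of "- t"] by simp
      then have "(1 - t) * exp t \<le> exp (- t) * exp t" by (intro mult_right_mono) auto
      then show ?thesis by (simp add: algebra_simps flip: exp_add)
    qed
    have **: "ennreal (exp t) \<le> 1 + ennreal (t * exp t)" if "0 \<le> t" for t
    proof -
      have "ennreal (exp t) \<le> ennreal (1 + t * exp t)" by (intro ennreal_leI *)
      also have "\<dots> = 1 + ennreal (t * exp t)" using that by (subst ennreal_plus) auto
      finally show ?thesis .
    qed
    consider "\<bar>u\<bar> \<le> \<tau>" | "u \<ge> \<tau>" "u \<ge> 0" | "- u \<ge> \<tau>" "- u \<ge> 0" using \<tau> by linarith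
    then show ?thesis
    proof cases
      case 2
      then have "ennreal (exp (\<mu> * (max 0 (\<bar>u\<bar> - \<tau>))\<^sup>2)) \<le> 1 + k u"
        using **[of "\<mu> * (u - \<tau>)\<^sup>2"] \<mu> by (simp add: k_def)
      also have "\<dots> \<le> 1 + (k u + k (- u))" by (intro add_left_mono) simp
      finally show ?thesis .
    next
      case 3
      then have "ennreal (exp (\<mu> * (max 0 (\<bar>u\<bar> - \<tau>))\<^sup>2)) \<le> 1 + k (- u)"
        using **[of "\<mu> * (- u - \<tau>)\<^sup>2"] \<mu> by (simp add: k_def)
      also have "\<dots> \<le> 1 + (k u + k (- u))" by (intro add_left_mono) simp
      finally show ?thesis .
    qed simp
  qed
  have "(\<integral>\<^sup>+u. ennreal (exp (\<mu> * (max 0 (\<bar>u\<bar> - \<tau>))\<^sup>2)) \<partial>std_gauss) \<le> (\<integral>\<^sup>+u. 1 + (k u + k (- u)) \<partial>std_gauss)"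
    by (intro nn_integral_mono pw)
  also have "\<dots> = 1 + (\<integral>\<^sup>+u. k u \<partial>std_gauss) + (\<integral>\<^sup>+u. k u \<partial>std_gauss)"
    by (simp add: nn_integral_add nn_integral_std_gauss_minus std_gauss.emeasure_space_1[simplified] add.assoc)
  also have "\<dots> \<le> 1 + ennreal (x * y * upper_sq \<tau>) + ennreal (x * y * upper_sq \<tau>)"
    by (intro add_mono k_le order_refl)
  also have "\<dots> = ennreal (1 + 2 * (x * y * upper_sq \<tau>))"
  proof -
    define r where "r = x * y * upper_sq \<tau>"
    have "0 \<le> r" using x nn_integral_upper_sq(2)[of \<tau>] by (simp add: r_def y_def)
    then have "ennreal (1 + (r + r)) = 1 + (ennreal r + ennreal r)"
      by (subst ennreal_plus, simp, simp, subst ennreal_plus, simp_all)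
    then show ?thesis unfolding r_def[symmetric] by (simp only: add.assoc mult_2)
  qed
  also have "\<dots> \<le> ennreal (exp ((x + x\<^sup>2) * (2 * upper_sq \<tau>)))"
  proof (rule ennreal_leI)
    have "x * y * upper_sq \<tau> \<le> x * (1 + x) * upper_sq \<tau>"
      using x y nn_integral_upper_sq(2)[of \<tau>] by (intro mult_right_mono mult_left_mono) auto
    then have "1 + 2 * (x * y * upper_sq \<tau>) \<le> 1 + (x + x\<^sup>2) * (2 * upper_sq \<tau>)"
      by (simp add: power2_eq_square algebra_simps)
    also have "\<dots> \<le> exp ((x + x\<^sup>2) * (2 * upper_sq \<tau>))" by simp
    finally show "1 + 2 * (x * y * upper_sq \<tau>) \<le> exp ((x + x\<^sup>2) * (2 * upper_sq \<tau>))" .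
  qed
  finally show ?thesis by (simp add: \<mu>_def)
qed

definition normal_cdf :: "real \<Rightarrow> real" where
  "normal_cdf b = measure std_gauss {..b}"

lemma emeasure_std_gauss_atMost: "emeasure std_gauss {..b} = ennreal (normal_cdf b)"
  by (simp add: normal_cdf_def std_gauss.emeasure_eq_measure)

lemma normal_cdf_bounds: "0 \<le> normal_cdf b" "normal_cdf b \<le> 1"
  by (auto simp: normal_cdf_def)

text \<open>The density decreases on the nonnegative axis, so its values at the end points bound it
  on \<open>{a<..b}\<close>.\<close>

lemma normal_cdf_diff:
  assumes "0 \<le> a" "a \<le> b"
  shows "normal_cdf b - normal_cdf a \<le> (b - a) * std_normal_density a"
    "(b - a) * std_normal_density b \<le> normal_cdf b - normal_cdf a"
proof -
  have "{..b} - {..a} = {a<..b}" using assms by auto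
  then have eq: "normal_cdf b - normal_cdf a = measure std_gauss {a<..b}"
    using std_gauss.finite_measure_Diff[of "{..b}" "{..a}"] assms by (simp add: normal_cdf_def)
  have em: "ennreal (measure std_gauss {a<..b}) = (\<integral>\<^sup>+u. ennreal (std_normal_density u) * indicator {a<..b} u \<partial>lborel)"
    by (simp add: emeasure_density flip: std_gauss.emeasure_eq_measure)
  have cn: "(\<integral>\<^sup>+u. ennreal (std_normal_density c) * indicator {a<..b} u \<partial>lborel) = ennreal ((b - a) * std_normal_density c)" for c
    using assms by (subst nn_integral_cmult_indicator) (auto simp: mult.commute ennreal_mult')
  have "ennreal (measure std_gauss {a<..b}) \<le> ennreal ((b - a) * std_normal_density a)"
    unfolding em cn[symmetric] using assms
    by (intro nn_integral_mono) (auto simp: indicator_def intro!: ennreal_leI std_normal_density_antimono)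
  then show "normal_cdf b - normal_cdf a \<le> (b - a) * std_normal_density a"
    unfolding eq using assms by (simp add: ennreal_le_iff)
  have "ennreal ((b - a) * std_normal_density b) \<le> ennreal (measure std_gauss {a<..b})"
    unfolding em cn[symmetric] using assms
    by (intro nn_integral_mono) (auto simp: indicator_def intro!: ennreal_leI std_normal_density_antimono)
  then show "(b - a) * std_normal_density b \<le> normal_cdf b - normal_cdf a"
    unfolding eq by (simp add: ennreal_le_iff)
qed

lemma normal_cdf_eq_integral: "normal_cdf b = (\<integral>u. indicator {..b} u * std_normal_density u \<partial>lborel)"
proof -
  have "normal_cdf b = (\<integral>u. indicat_real {..b} u \<partial>std_gauss)"
    by (simp add: normal_cdf_def)
  also have "\<dots> = (\<integral>u. std_normal_density u * indicator {..b} u \<partial>lborel)"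
    by (rule integral_std_gauss) auto
  finally show ?thesis by (simp add: mult.commute)
qed

lemma lower_sq_eq: "lower_sq \<tau> = (1 + \<tau>\<^sup>2) * normal_cdf \<tau> + \<tau> * std_normal_density \<tau>"
proof -
  \<comment> \<open>Subtracting \<open>1 + \<tau>\<^sup>2\<close> times the density leaves a
    function with the elementary antiderivative \<open>F\<close>.\<close>
  define f where "f u = (u - \<tau>)\<^sup>2 * std_normal_density u - (1 + \<tau>\<^sup>2) * std_normal_density u" for u
  define F where "F u = - u * std_normal_density u + 2 * \<tau> * std_normal_density u" for u
  have int_f: "integrable lborel f"
    unfolding f_def using integrable_shifted_sq[of \<tau>] by (intro Bochner_Integration.integrable_diff) auto
  have "(LBINT u=-\<infinity>..ereal \<tau>. f u) = F \<tau> - 0"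
  proof (rule interval_integral_FTC_integrable)
    show "(F has_vector_derivative f u) (at u)" for u
      unfolding has_real_derivative_iff_has_vector_derivative[symmetric] F_def f_def
      by (rule derivative_eq_intros DERIV_std_normal_density refl)+ (simp add: power2_eq_square algebra_simps)
    show "isCont f u" for u
      unfolding f_def by (intro continuous_intros continuous_std_normal_density)
    show "set_integrable lborel (einterval (-\<infinity>) (ereal \<tau>)) f"
      unfolding set_integrable_def using int_f by (intro integrable_mult_indicator) auto
    have "(F \<longlongrightarrow> 0) at_bot"
      unfolding F_def std_normal_density_def by real_asymp
    then show "((F \<circ> real_of_ereal) \<longlongrightarrow> 0) (at_right (- \<infinity>))"
      by (rule tendsto_at_right_MInf)
    have "isCont F \<tau>" unfolding F_def by (intro continuous_intros continuous_std_normal_density)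
    then have "(F \<longlongrightarrow> F \<tau>) (at_left \<tau>)" by (simp add: isCont_def filterlim_at_split)
    then show "((F \<circ> real_of_ereal) \<longlongrightarrow> F \<tau>) (at_left (ereal \<tau>))"
      by (simp add: ereal_tendsto_simps)
  qed auto
  also have "(LBINT u=-\<infinity>..ereal \<tau>. f u) = (\<integral>u. indicator {..\<tau>} u * f u \<partial>lborel)"
  proof -
    have "einterval (-\<infinity>) (ereal \<tau>) = {..<\<tau>}" by (auto simp: einterval_def)
    moreover have "(\<integral>u. indicator {..<\<tau>} u * f u \<partial>lborel) = (\<integral>u. indicator {..\<tau>} u * f u \<partial>lborel)"
    proof (rule integral_cong_AE)
      have "AE u in lborel. u \<noteq> \<tau>" by (rule AE_lborel_singleton)
      then show "AE u in lborel. indicator {..<\<tau>} u * f u = indicator {..\<tau>} u * f u"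
        by eventually_elim (auto simp: indicator_def)
    qed (auto simp: f_def)
    ultimately show ?thesis
      by (simp add: interval_lebesgue_integral_def set_lebesgue_integral_def)
  qed
  also have "\<dots> = lower_sq \<tau> - (1 + \<tau>\<^sup>2) * normal_cdf \<tau>"
  proof -
    have "(\<integral>u. indicator {..\<tau>} u * f u \<partial>lborel) =
      (\<integral>u. indicator {..\<tau>} u * ((u - \<tau>)\<^sup>2 * std_normal_density u) - (1 + \<tau>\<^sup>2) * (indicator {..\<tau>} u * std_normal_density u) \<partial>lborel)"
      by (intro Bochner_Integration.integral_cong refl) (simp add: f_def algebra_simps)
    also have "\<dots> = (\<integral>u. indicator {..\<tau>} u * ((u - \<tau>)\<^sup>2 * std_normal_density u) \<partial>lborel) -
      (\<integral>u. (1 + \<tau>\<^sup>2) * (indicator {..\<tau>} u * std_normal_density u) \<partial>lborel)"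
      by (intro Bochner_Integration.integral_diff integrable_mult_right
        integrable_mult_indicator[OF _ integrable_shifted_sq, unfolded real_scaleR_def]
        integrable_mult_indicator[OF _ integrable_normal_density, unfolded real_scaleR_def]) auto
    finally show ?thesis by (simp add: lower_sq_def set_lebesgue_integral_def normal_cdf_eq_integral)
  qed
  finally show ?thesis by (simp add: F_def algebra_simps)
qed

text \<open>The two parts add up to the full moment \<open>1 + \<tau>\<^sup>2\<close>, and the upper
  part is at most 1 because \<open>(u - \<tau>)\<^sup>2 \<le> u\<^sup>2\<close> for
  \<open>0 \<le> \<tau> \<le> u\<close>.\<close>

lemma lower_sq_ge_power2:
  assumes "0 \<le> \<tau>" shows "\<tau>\<^sup>2 \<le> lower_sq \<tau>"
proof -
  have sq: "ennreal 1 = (\<integral>\<^sup>+u. ennreal (u\<^sup>2 * std_normal_density u) \<partial>lborel)"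
    using integral_shifted_sq[of 0] integrable_shifted_sq[of 0] by (simp add: nn_integral_eq_integral)
  have "ennreal (upper_sq \<tau>) = (\<integral>\<^sup>+u. ennreal (std_normal_density u) * (ennreal ((u - \<tau>)\<^sup>2) * indicator {\<tau>..} u) \<partial>lborel)"
    unfolding nn_integral_upper_sq(1)[symmetric] by (rule nn_integral_std_gauss) measurable
  also have "\<dots> \<le> (\<integral>\<^sup>+u. ennreal (u\<^sup>2 * std_normal_density u) \<partial>lborel)"
  proof (rule nn_integral_mono)
    fix u
    have "(u - \<tau>)\<^sup>2 \<le> u\<^sup>2" if "\<tau> \<le> u" using that assms by (intro power_mono) auto
    then show "ennreal (std_normal_density u) * (ennreal ((u - \<tau>)\<^sup>2) * indicator {\<tau>..} u) \<le> ennreal (u\<^sup>2 * std_normal_density u)"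
      by (auto simp: indicator_def mult.commute[of "u\<^sup>2"] simp flip: ennreal_mult intro!: ennreal_leI mult_left_mono)
  qed
  also have "\<dots> = ennreal 1" using sq by simp
  finally have "ennreal (upper_sq \<tau>) \<le> ennreal 1" .
  then have "upper_sq \<tau> \<le> 1" by simp
  moreover have "lower_sq \<tau> + upper_sq \<tau> = 1 + \<tau>\<^sup>2"
  proof -
    have "lower_sq \<tau> + upper_sq \<tau> = (\<integral>u. indicator {..\<tau>} u * ((u - \<tau>)\<^sup>2 * std_normal_density u) +
      indicator {\<tau>..} u * ((u - \<tau>)\<^sup>2 * std_normal_density u) \<partial>lborel)"
      unfolding lower_sq_def upper_sq_def set_lebesgue_integral_def real_scaleR_def
      by (intro Bochner_Integration.integral_add[symmetric]
        integrable_mult_indicator[OF _ integrable_shifted_sq, unfolded real_scaleR_def]) auto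
    also have "\<dots> = (\<integral>u. (u - \<tau>)\<^sup>2 * std_normal_density u \<partial>lborel)"
      by (intro Bochner_Integration.integral_cong refl) (auto simp: indicator_def)
    finally show ?thesis by (simp add: integral_shifted_sq)
  qed
  ultimately show ?thesis by linarith
qed

lemma normal_tail_chebyshev:
  assumes "0 \<le> \<tau>" shows "\<tau>\<^sup>2 * (1 - normal_cdf \<tau>) \<le> 1"
proof -
  have "1 - normal_cdf \<tau> = measure std_gauss {\<tau><..}"
    using std_gauss.prob_compl[of "{..\<tau>}"] by (simp add: normal_cdf_def Compl_atMost flip: Compl_eq_Diff_UNIV)
  then have "ennreal (1 - normal_cdf \<tau>) = (\<integral>\<^sup>+u. ennreal (std_normal_density u) * indicator {\<tau><..} u \<partial>lborel)"
    by (simp add: emeasure_density flip: std_gauss.emeasure_eq_measure)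
  then have "ennreal (\<tau>\<^sup>2) * ennreal (1 - normal_cdf \<tau>) = (\<integral>\<^sup>+u. ennreal (\<tau>\<^sup>2) * (ennreal (std_normal_density u) * indicator {\<tau><..} u) \<partial>lborel)"
    by (simp add: nn_integral_cmult)
  also have "\<dots> \<le> (\<integral>\<^sup>+u. ennreal (u\<^sup>2 * std_normal_density u) \<partial>lborel)"
    using assms by (intro nn_integral_mono) (auto simp: indicator_def simp flip: ennreal_mult intro!: ennreal_leI mult_right_mono power_mono)
  also have "\<dots> = ennreal 1"
    using integral_shifted_sq[of 0] integrable_shifted_sq[of 0] by (simp add: nn_integral_eq_integral)
  finally have "ennreal (\<tau>\<^sup>2 * (1 - normal_cdf \<tau>)) \<le> ennreal 1"
    using normal_cdf_bounds[of \<tau>] by (simp add: ennreal_mult del: ennreal_le_1 ennreal_1)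
  then show ?thesis by simp
qed

text \<open>The integral has the exact value
  \<open>y * exp \<zeta> * normal_cdf (\<tau> * y) + (1 - \<Phi>)\<close>. Already for typical
  \<open>u\<close> the exponent is of size \<open>\<zeta> = x * \<tau>\<^sup>2\<close>, which may be
  large, so linearising at once as for soft thresholding would lose too much. Instead
  \<open>exp \<zeta>\<close> is split off and only the remaining factor is linearised.\<close>

lemma lower_tail_exp_bound:
  fixes \<tau> x :: real
  assumes \<tau>: "0 \<le> \<tau>" and x: "0 \<le> x"
  shows "(\<integral>\<^sup>+u. ennreal (exp (x / (1 + 2 * x) * (max 0 (\<tau> - u))\<^sup>2)) \<partial>std_gauss)
    \<le> ennreal (exp ((x + x\<^sup>2) * lower_sq \<tau>))"
proof -
  define \<mu> where "\<mu> = x / (1 + 2 * x)"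
  define y where "y = sqrt (1 + 2 * x)"
  define \<Phi> where "\<Phi> = normal_cdf \<tau>"
  define d where "d = std_normal_density \<tau>"
  define \<zeta> where "\<zeta> = x * \<tau>\<^sup>2"
  define w where "w = lower_sq \<tau>"
  have y: "y\<^sup>2 = 1 + 2 * x" "y \<ge> 1" using x by (auto simp: y_def)
  have y': "y \<le> 1 + x" unfolding y_def using x by (intro real_le_lsqrt) (auto simp: power2_eq_square algebra_simps)
  have \<mu>: "\<mu> * y\<^sup>2 = x" using x by (auto simp: \<mu>_def y)
  have \<Phi>: "0 \<le> \<Phi>" "\<Phi> \<le> 1" by (auto simp: \<Phi>_def normal_cdf_bounds)
  have d: "0 \<le> d" by (simp add: d_def)
  let ?g = "\<lambda>u. ennreal (std_normal_density u) * (ennreal (exp (\<mu> * (\<tau> - u)\<^sup>2)) * indicator {..\<tau>} u)"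
  have "(\<integral>\<^sup>+u. ennreal (exp (\<mu> * (max 0 (\<tau> - u))\<^sup>2)) \<partial>std_gauss) =
    (\<integral>\<^sup>+u. ennreal (exp (\<mu> * (\<tau> - u)\<^sup>2)) * indicator {..\<tau>} u + indicator (- {..\<tau>}) u \<partial>std_gauss)"
    by (intro nn_integral_cong) (auto simp: indicator_def)
  also have "\<dots> = (\<integral>\<^sup>+u. ?g u \<partial>lborel) + emeasure std_gauss (- {..\<tau>})"
    by (subst nn_integral_add) (auto simp: nn_integral_std_gauss)
  also have "emeasure std_gauss (- {..\<tau>}) = ennreal (1 - \<Phi>)"
    using std_gauss.prob_compl[of "{..\<tau>}"]
    by (simp add: \<Phi>_def normal_cdf_def std_gauss.emeasure_eq_measure Compl_eq_Diff_UNIV)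
  \<comment> \<open>completing the square\<close>
  also have "(\<integral>\<^sup>+u. ?g u \<partial>lborel) = ennreal \<bar>y\<bar> * (\<integral>\<^sup>+t. ?g (- 2 * x * \<tau> + y * t) \<partial>lborel)"
    by (rule nn_integral_real_affine) (use y in auto)
  also have "(\<integral>\<^sup>+t. ?g (- 2 * x * \<tau> + y * t) \<partial>lborel) =
    (\<integral>\<^sup>+t. ennreal (exp \<zeta>) * (ennreal (std_normal_density t) * indicator {..\<tau> * y} t) \<partial>lborel)"
  proof (rule nn_integral_cong)
    fix t
    define u where "u = - 2 * x * \<tau> + y * t"
    have u: "\<tau> - u = y * (\<tau> * y - t)" using y(1) by (simp add: u_def power2_eq_square algebra_simps)
    then have "u \<le> \<tau> \<longleftrightarrow> 0 \<le> y * (\<tau> * y - t)" by linarith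
    then have ind: "u \<le> \<tau> \<longleftrightarrow> t \<le> \<tau> * y" using y(2) by (auto simp: zero_le_mult_iff)
    have "- u\<^sup>2 / 2 + \<mu> * (\<tau> - u)\<^sup>2 = - t\<^sup>2 / 2 + \<zeta>"
    proof -
      have "\<mu> * (\<tau> - u)\<^sup>2 = x * (\<tau> * y - t)\<^sup>2"
        unfolding u power_mult_distrib using \<mu> by (simp flip: mult.assoc)
      also have "\<dots> = x * (\<tau>\<^sup>2 * y\<^sup>2 - 2 * \<tau> * y * t + t\<^sup>2)" by (simp add: power2_diff power_mult_distrib mult_ac)
      also have "\<dots> = x * (\<tau>\<^sup>2 * (1 + 2 * x) - 2 * \<tau> * y * t + t\<^sup>2)" by (simp only: y(1))
      finally have 1: "\<mu> * (\<tau> - u)\<^sup>2 = x * (\<tau>\<^sup>2 * (1 + 2 * x) - 2 * \<tau> * y * t + t\<^sup>2)" .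
      have "u\<^sup>2 = y\<^sup>2 * t\<^sup>2 - 4 * x * \<tau> * y * t + 4 * x\<^sup>2 * \<tau>\<^sup>2"
        by (simp add: u_def power2_eq_square algebra_simps)
      also have "\<dots> = (1 + 2 * x) * t\<^sup>2 - 4 * x * \<tau> * y * t + 4 * x\<^sup>2 * \<tau>\<^sup>2" by (simp only: y(1))
      finally show ?thesis unfolding 1 \<zeta>_def by (simp add: power2_eq_square field_simps)
    qed
    then have "exp (- u\<^sup>2 / 2) * exp (\<mu> * (\<tau> - u)\<^sup>2) = exp (- t\<^sup>2 / 2) * exp \<zeta>"
      by (simp only: exp_add[symmetric])
    then have "std_normal_density u * exp (\<mu> * (\<tau> - u)\<^sup>2) = exp \<zeta> * std_normal_density t"
      unfolding std_normal_density_def by (simp add: mult_ac)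
    then show "?g u = ennreal (exp \<zeta>) * (ennreal (std_normal_density t) * indicator {..\<tau> * y} t)"
      using ind by (auto simp: indicator_def simp flip: ennreal_mult)
  qed
  also have "\<dots> = ennreal (exp \<zeta>) * ennreal (normal_cdf (\<tau> * y))"
    by (simp add: nn_integral_cmult emeasure_density flip: emeasure_std_gauss_atMost)
  also have "ennreal \<bar>y\<bar> * (ennreal (exp \<zeta>) * ennreal (normal_cdf (\<tau> * y))) + ennreal (1 - \<Phi>) =
    ennreal (y * exp \<zeta> * normal_cdf (\<tau> * y) + (1 - \<Phi>))"
    using y \<Phi> normal_cdf_bounds[of "\<tau> * y"] by (simp add: mult_ac flip: ennreal_mult ennreal_plus)
  also have "\<dots> \<le> ennreal (exp ((x + x\<^sup>2) * w))"
  proof (rule ennreal_leI)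
    have w: "w = (1 + \<tau>\<^sup>2) * \<Phi> + \<tau> * d" "\<tau>\<^sup>2 \<le> w"
      using lower_sq_ge_power2[OF \<tau>] by (auto simp: w_def \<Phi>_def d_def lower_sq_eq)
    have "\<tau> * 1 \<le> \<tau> * y" using \<tau> y by (intro mult_left_mono) auto
    then have "normal_cdf (\<tau> * y) - \<Phi> \<le> (\<tau> * y - \<tau>) * d"
      unfolding \<Phi>_def d_def using \<tau> by (intro normal_cdf_diff) auto
    then have 1: "normal_cdf (\<tau> * y) \<le> \<Phi> + (y - 1) * (\<tau> * d)" by (simp add: algebra_simps)
    have 2: "\<tau> * d \<le> \<Phi>"
      using normal_cdf_diff(2)[of 0 \<tau>] \<tau> normal_cdf_bounds[of 0] by (simp add: \<Phi>_def d_def)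
    \<comment> \<open>This keeps the second-order error below
      \<open>x\<^sup>2 * \<tau>\<^sup>2 / 2\<close>, which \<open>\<tau>\<^sup>2 \<le> w\<close>
      absorbs into \<open>x\<^sup>2 * w\<close>.\<close>
    have 3: "(1 - \<Phi>) * \<tau>\<^sup>2 \<le> 1" using normal_tail_chebyshev[OF \<tau>] by (simp add: \<Phi>_def mult.commute)
    have \<zeta>: "0 \<le> \<zeta>" using x by (simp add: \<zeta>_def)
    have "y * normal_cdf (\<tau> * y) \<le> y * (\<Phi> + (y - 1) * (\<tau> * d))" using 1 y by (intro mult_left_mono) auto
    also have "\<dots> = y * (\<Phi> - \<tau> * d) + y\<^sup>2 * (\<tau> * d)" by (simp add: power2_eq_square algebra_simps)
    also have "\<dots> \<le> (1 + x) * (\<Phi> - \<tau> * d) + (1 + 2 * x) * (\<tau> * d)"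
      unfolding y(1) using 2 y' by (intro add_right_mono mult_right_mono) auto
    finally have A: "y * normal_cdf (\<tau> * y) \<le> \<Phi> + x * (\<Phi> + \<tau> * d)" by (simp add: algebra_simps)
    have B: "exp (- \<zeta>) \<le> 1 - \<zeta> + \<zeta>\<^sup>2 / 2"
    proof -
      \<comment> \<open>The product equals \<open>1 + \<zeta> ^ 4 / 4\<close>.\<close>
      have "1 \<le> (1 - \<zeta> + \<zeta>\<^sup>2 / 2) * (1 + \<zeta> + \<zeta>\<^sup>2 / 2)"
        using \<zeta> by (simp add: power2_eq_square algebra_simps)
      also have "\<dots> \<le> (1 - \<zeta> + \<zeta>\<^sup>2 / 2) * exp \<zeta>"
      proof (intro mult_left_mono exp_lower_Taylor_quadratic \<zeta>)
        have "0 \<le> (1 - \<zeta>)\<^sup>2" by simp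
        then show "0 \<le> 1 - \<zeta> + \<zeta>\<^sup>2 / 2" by (simp add: power2_diff)
      qed
      finally show ?thesis by (simp add: exp_minus divide_simps)
    qed
    \<comment> \<open>By the closed form of \<open>w\<close> the first-order term is exactly
      \<open>x * (w - \<tau>\<^sup>2)\<close>; the missing \<open>x * \<tau>\<^sup>2\<close> is
      returned by the factor \<open>exp \<zeta>\<close>.\<close>
    have "(\<Phi> + x * (\<Phi> + \<tau> * d)) + (1 - \<Phi>) * (1 - \<zeta> + \<zeta>\<^sup>2 / 2) = 1 + x * (w - \<tau>\<^sup>2) + (1 - \<Phi>) * \<tau>\<^sup>2 * (x\<^sup>2 * \<tau>\<^sup>2 / 2)"
      unfolding w \<zeta>_def by (simp add: power2_eq_square field_simps)
    also have "\<dots> \<le> 1 + x * (w - \<tau>\<^sup>2) + 1 * (x\<^sup>2 * \<tau>\<^sup>2 / 2)"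
      using 3 by (intro add_left_mono mult_right_mono) auto
    also have "\<dots> \<le> exp (x * (w - \<tau>\<^sup>2) + x\<^sup>2 * \<tau>\<^sup>2 / 2)"
      using exp_ge_add_one_self[of "x * (w - \<tau>\<^sup>2) + x\<^sup>2 * \<tau>\<^sup>2 / 2"] by linarith
    finally have C: "(\<Phi> + x * (\<Phi> + \<tau> * d)) + (1 - \<Phi>) * (1 - \<zeta> + \<zeta>\<^sup>2 / 2) \<le> exp (x * (w - \<tau>\<^sup>2) + x\<^sup>2 * \<tau>\<^sup>2 / 2)" .
    have "y * exp \<zeta> * normal_cdf (\<tau> * y) + (1 - \<Phi>) = exp \<zeta> * (y * normal_cdf (\<tau> * y) + (1 - \<Phi>) * exp (- \<zeta>))"
      by (simp add: exp_minus field_simps)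
    also have "\<dots> \<le> exp \<zeta> * ((\<Phi> + x * (\<Phi> + \<tau> * d)) + (1 - \<Phi>) * (1 - \<zeta> + \<zeta>\<^sup>2 / 2))"
      using A B \<Phi> by (intro mult_left_mono add_mono) auto
    also have "\<dots> \<le> exp \<zeta> * exp (x * (w - \<tau>\<^sup>2) + x\<^sup>2 * \<tau>\<^sup>2 / 2)"
      by (intro mult_left_mono C) simp
    also have "exp \<zeta> * exp (x * (w - \<tau>\<^sup>2) + x\<^sup>2 * \<tau>\<^sup>2 / 2) = exp (x * w + x\<^sup>2 * \<tau>\<^sup>2 / 2)"
      by (simp add: \<zeta>_def algebra_simps flip: exp_add)
    also have "\<dots> \<le> exp ((x + x\<^sup>2) * w)"
    proof -
      have "\<tau>\<^sup>2 / 2 \<le> w" using w(2) zero_le_power2[of \<tau>] by linarith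
      then have "x\<^sup>2 * (\<tau>\<^sup>2 / 2) \<le> x\<^sup>2 * w" by (intro mult_left_mono) auto
      then show ?thesis by (simp add: algebra_simps)
    qed
    finally show "y * exp \<zeta> * normal_cdf (\<tau> * y) + (1 - \<Phi>) \<le> exp ((x + x\<^sup>2) * w)" by simp
  qed
  finally show ?thesis by (simp add: \<mu>_def w_def)
qed

lemma lower_sq_ge_normal_cdf_0:
  assumes "0 \<le> \<tau>" shows "normal_cdf 0 \<le> lower_sq \<tau>"
proof -
  have "normal_cdf 0 \<le> normal_cdf \<tau>"
    unfolding normal_cdf_def using assms by (intro std_gauss.finite_measure_mono) auto
  also have "\<dots> \<le> (1 + \<tau>\<^sup>2) * normal_cdf \<tau> + \<tau> * std_normal_density \<tau>"
    using assms normal_cdf_bounds[of \<tau>] by (simp add: algebra_simps)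
  finally show ?thesis by (simp add: lower_sq_eq)
qed

text \<open>The two closed half lines at 0 have equal mass by symmetry and together cover the
  line.\<close>

lemma normal_cdf_0_ge: "1 / 2 \<le> normal_cdf 0"
proof -
  have "emeasure std_gauss {0..} = (\<integral>\<^sup>+u. indicator {0..} u \<partial>std_gauss)"
    by (rule nn_integral_indicator[symmetric]) simp
  also have "\<dots> = (\<integral>\<^sup>+u. indicator {..0} (- u) \<partial>std_gauss)"
    by (intro nn_integral_cong) (auto simp: indicator_def)
  also have "\<dots> = ennreal (normal_cdf 0)"
    by (subst nn_integral_std_gauss_minus) (auto simp: emeasure_std_gauss_atMost)
  finally have "measure std_gauss {0..} = normal_cdf 0"
    by (simp add: std_gauss.emeasure_eq_measure normal_cdf_def)
  moreover have "measure std_gauss ({0..} \<union> {..0}) \<le> measure std_gauss {0..} + measure std_gauss {..0}"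
    by (rule measure_Un_le) auto
  moreover have "{0..} \<union> {..0} = (UNIV :: real set)" by auto
  ultimately show ?thesis
    using std_gauss.prob_space by (simp add: normal_cdf_def)
qed

section \<open>Kernels meeting compact sets\<close>

text \<open>Formulated with the raw entries, since the scaling of the Gaussian matrix does not
  change its kernel.\<close>

definition kernel_meets :: "nat \<Rightarrow> nat \<Rightarrow> (nat \<Rightarrow> real) set \<Rightarrow> (nat \<times> nat \<Rightarrow> real) set" where
  "kernel_meets m N S = {a \<in> space (gauss ({..<m} \<times> {..<N})). \<exists>z\<in>S. \<forall>i<m. (\<Sum>j<N. a (i, j) * z j) = 0}"

text \<open>Pinning the coordinates from \<open>N\<close> on to 0 makes the set compact in the
  product topology on \<open>nat \<Rightarrow> real\<close>.\<close>

definition unit_sphere :: "nat \<Rightarrow> (nat \<Rightarrow> real) set" where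
  "unit_sphere N = {z. (\<forall>j\<ge>N. z j = 0) \<and> (\<Sum>j<N. (z j)\<^sup>2) = 1}"

lemma continuous_on_coordinate [continuous_intros]:
  fixes j :: nat shows "continuous_on S (\<lambda>z :: nat \<Rightarrow> real. z j)"
  by (rule continuous_on_subset[OF continuous_on_product_coordinates]) simp

lemma unit_sphere_abs_le:
  assumes "z \<in> unit_sphere N" shows "\<bar>z j\<bar> \<le> 1"
proof (cases "j < N")
  case True
  then have "(z j)\<^sup>2 \<le> (\<Sum>j<N. (z j)\<^sup>2)" by (intro member_le_sum) auto
  then show ?thesis using assms by (simp add: unit_sphere_def abs_square_le_1)
qed (use assms in \<open>simp add: unit_sphere_def\<close>)

lemma compact_unit_sphere: "compact (unit_sphere N)"
proof -
  have "compactin (product_topology (\<lambda>_. euclidean) UNIV) (PiE UNIV (\<lambda>_ :: nat. {-1..1 :: real}))"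
    unfolding compactin_PiE by auto
  then have "compact (PiE UNIV (\<lambda>_ :: nat. {-1..1 :: real}))"
    unfolding euclidean_product_topology by simp
  moreover have "closed (unit_sphere N)"
  proof -
    have "unit_sphere N = (\<Inter>j\<in>{N..}. {z. z j = 0}) \<inter> {z. (\<Sum>j<N. (z j)\<^sup>2) = 1}"
      by (auto simp: unit_sphere_def)
    also have "closed \<dots>"
      by (intro closed_Int closed_INT ballI closed_Collect_eq continuous_intros)
    finally show ?thesis .
  qed
  moreover have "unit_sphere N \<subseteq> PiE UNIV (\<lambda>_. {-1..1})"
    using unit_sphere_abs_le by (auto simp: abs_le_iff minus_le_iff)
  ultimately show ?thesis by (metis compact_Int_closed inf.absorb_iff2)
qed

lemma dense_sequence:
  fixes S :: "(nat \<Rightarrow> real) set"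
  assumes "S \<noteq> {}"
  obtains d :: "nat \<Rightarrow> nat \<Rightarrow> real" where "range d \<subseteq> S" "S \<subseteq> closure (range d)"
proof -
  obtain D where D: "countable D" "D \<subseteq> S" "S \<subseteq> closure D" by (rule separable)
  then have "D \<noteq> {}" using assms by auto
  with D have "range (from_nat_into D) = D" by (simp add: range_from_nat_into)
  with D show thesis by (intro that[of "from_nat_into D"]) auto
qed

text \<open>The residual is continuous in the vector, so its sublevel set is open and, as it
  contains \<open>z\<close>, meets the dense sequence.\<close>

lemma residual_near_zero:
  fixes S :: "(nat \<Rightarrow> real) set"
  assumes "z \<in> S" "S \<subseteq> closure (range d)" "\<forall>i<m. (\<Sum>j<N. a (i, j) * z j) = 0" "0 < (\<delta>::real)"
  shows "\<exists>k. (\<Sum>i<m. (\<Sum>j<N. a (i, j) * d k j)\<^sup>2) < \<delta>"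
proof -
  let ?U = "{z. (\<Sum>i<m. (\<Sum>j<N. a (i, j) * z j)\<^sup>2) < \<delta>}"
  have U: "open ?U" by (intro open_Collect_less continuous_intros)
  have "z \<in> ?U \<inter> closure (range d)" using assms by auto
  then have "?U \<inter> range d \<noteq> {}" using open_Int_closure_eq_empty[OF U, of "range d"] by blast
  then show ?thesis by auto
qed

text \<open>By compactness the residual vanishes somewhere on \<open>S\<close> exactly if it becomes
  arbitrarily small along a dense sequence, which replaces an uncountable quantifier by countable
  ones.\<close>

lemma kernel_meets_sets:
  assumes S: "compact S"
  shows "kernel_meets m N S \<in> sets (gauss ({..<m} \<times> {..<N}))"
proof (cases "S = {}")
  case False
  then obtain d :: "nat \<Rightarrow> nat \<Rightarrow> real" where d: "range d \<subseteq> S" "S \<subseteq> closure (range d)"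
    by (rule dense_sequence)
  define R where "R a z = (\<Sum>i<m. (\<Sum>j<N. a (i, j) * z j)\<^sup>2)" for a :: "nat \<times> nat \<Rightarrow> real" and z
  have R_cont: "continuous_on UNIV (R a)" for a unfolding R_def by (intro continuous_intros)
  have [measurable]: "(\<lambda>a. R a z) \<in> borel_measurable (gauss ({..<m} \<times> {..<N}))" for z
    unfolding R_def
    by (intro borel_measurable_sum borel_measurable_power borel_measurable_times measurable_gauss_component) auto
  have "kernel_meets m N S = {a \<in> space (gauss ({..<m} \<times> {..<N})). \<forall>r. \<exists>k. R a (d k) < inverse (real (Suc r))}"
  proof (intro set_eqI iffI)
    fix a assume "a \<in> kernel_meets m N S"
    then obtain z where z: "z \<in> S" "\<forall>i<m. (\<Sum>j<N. a (i, j) * z j) = 0" "a \<in> space (gauss ({..<m} \<times> {..<N}))"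
      by (auto simp: kernel_meets_def)
    have "\<exists>k. R a (d k) < inverse (real (Suc r))" for r
      unfolding R_def by (rule residual_near_zero[OF z(1) d(2) z(2)]) simp
    with z(3) show "a \<in> {a \<in> space (gauss ({..<m} \<times> {..<N})). \<forall>r. \<exists>k. R a (d k) < inverse (real (Suc r))}"
      by auto
  next
    fix a assume "a \<in> {a \<in> space (gauss ({..<m} \<times> {..<N})). \<forall>r. \<exists>k. R a (d k) < inverse (real (Suc r))}"
    then have a: "a \<in> space (gauss ({..<m} \<times> {..<N}))" and "\<forall>r. \<exists>k. R a (d k) < inverse (real (Suc r))" by auto
    then obtain k where k: "\<And>r. R a (d (k r)) < inverse (real (Suc r))" by metis
    have "seq_compact S" using S compact_eq_seq_compact_metric by blast
    moreover have "\<forall>r. d (k r) \<in> S" using d by auto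
    ultimately obtain z \<phi> where z: "z \<in> S" "strict_mono \<phi>" "((\<lambda>r. d (k r)) \<circ> \<phi>) \<longlonglongrightarrow> z"
      unfolding seq_compact_def by metis
    have "(\<lambda>r. R a (((\<lambda>r. d (k r)) \<circ> \<phi>) r)) \<longlonglongrightarrow> R a z"
      using R_cont z(3) by (rule continuous_on_tendsto_compose) auto
    moreover have "(\<lambda>r. R a (((\<lambda>r. d (k r)) \<circ> \<phi>) r)) \<longlonglongrightarrow> 0"
    proof (rule tendsto_sandwich[OF _ _ tendsto_const])
      show "eventually (\<lambda>r. 0 \<le> R a (((\<lambda>r. d (k r)) \<circ> \<phi>) r)) sequentially"
        by (auto simp: R_def intro!: always_eventually sum_nonneg)
      show "eventually (\<lambda>r. R a (((\<lambda>r. d (k r)) \<circ> \<phi>) r) \<le> ((\<lambda>r. inverse (real (Suc r))) \<circ> \<phi>) r) sequentially"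
        using k by (auto intro!: always_eventually less_imp_le)
      show "((\<lambda>r. inverse (real (Suc r))) \<circ> \<phi>) \<longlonglongrightarrow> 0"
        using LIMSEQ_inverse_real_of_nat z(2) by (rule LIMSEQ_subseq_LIMSEQ)
    qed
    ultimately have "R a z = 0" by (rule LIMSEQ_unique)
    then have "\<forall>i<m. (\<Sum>j<N. a (i, j) * z j) = 0"
      unfolding R_def by (subst (asm) sum_nonneg_eq_0_iff) auto
    then show "a \<in> kernel_meets m N S" using a z(1) by (auto simp: kernel_meets_def)
  qed
  also have "\<dots> \<in> sets (gauss ({..<m} \<times> {..<N}))" by measurable
  finally show ?thesis .
qed (simp add: kernel_meets_def)

text \<open>Gaussian elimination for a homogeneous system with more unknowns than equations: a pivot
  removes one equation and one unknown.\<close>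

lemma exists_orthogonal:
  fixes c :: "'j \<Rightarrow> 'i \<Rightarrow> real"
  assumes "finite J" "finite P" "card J < card P"
  shows "\<exists>w. (\<exists>i\<in>P. w i \<noteq> 0) \<and> (\<forall>j\<in>J. (\<Sum>i\<in>P. w i * c j i) = 0)"
  using assms
proof (induction J arbitrary: P c rule: finite_induct)
  case empty
  then have "P \<noteq> {}" by auto
  then show ?case by (intro exI[of _ "\<lambda>_. 1"]) auto
next
  case (insert k J)
  show ?case
  proof (cases "\<forall>i\<in>P. c k i = 0")
    case True
    have "\<exists>w. (\<exists>i\<in>P. w i \<noteq> 0) \<and> (\<forall>j\<in>J. (\<Sum>i\<in>P. w i * c j i) = 0)"
      by (rule insert.IH) (use insert in auto)
    then obtain w where "(\<exists>i\<in>P. w i \<noteq> 0) \<and> (\<forall>j\<in>J. (\<Sum>i\<in>P. w i * c j i) = 0)" ..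
    then show ?thesis using True by (intro exI[of _ w]) auto
  next
    case False
    then obtain p where p: "p \<in> P" "c k p \<noteq> 0" by auto
    have "card J < card (P - {p})" using insert p by simp
    then have "\<exists>w. (\<exists>i\<in>P - {p}. w i \<noteq> 0) \<and>
      (\<forall>j\<in>J. (\<Sum>i\<in>P - {p}. w i * (c j i - c j p / c k p * c k i)) = 0)"
      using insert.prems by (intro insert.IH) auto
    then obtain w where w: "\<exists>i\<in>P - {p}. w i \<noteq> 0"
      "\<forall>j\<in>J. (\<Sum>i\<in>P - {p}. w i * (c j i - c j p / c k p * c k i)) = 0" by blast
    \<comment> \<open>Back substitution: the value of the pivot unknown that satisfies equation
      \<open>k\<close>.\<close>
    define t where "t = - (\<Sum>i\<in>P - {p}. w i * c k i) / c k p"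
    define v where "v = w(p := t)"
    have sum_v: "(\<Sum>i\<in>P. v i * c j i) = t * c j p + (\<Sum>i\<in>P - {p}. w i * c j i)" for j
      using p insert.prems by (subst sum.remove[of P p]) (auto simp: v_def intro!: sum.cong)
    have "(\<Sum>i\<in>P. v i * c k i) = 0" unfolding sum_v using p by (simp add: t_def)
    moreover have "(\<Sum>i\<in>P. v i * c j i) = 0" if "j \<in> J" for j
    proof -
      have "0 = (\<Sum>i\<in>P - {p}. w i * c j i - c j p / c k p * (w i * c k i))"
        using w(2) that by (simp add: algebra_simps)
      also have "\<dots> = (\<Sum>i\<in>P - {p}. w i * c j i) - c j p / c k p * (\<Sum>i\<in>P - {p}. w i * c k i)"
        by (simp add: sum_subtractf sum_distrib_left)
      finally show ?thesis unfolding sum_v by (simp add: t_def field_simps)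
    qed
    moreover have "\<exists>i\<in>P. v i \<noteq> 0" using w(1) by (auto simp: v_def)
    ultimately show ?thesis by (intro exI[of _ v]) auto
  qed
qed

lemma emeasure_std_gauss_singleton: "emeasure std_gauss {t} = 0"
proof -
  have "emeasure std_gauss {t} = (\<integral>\<^sup>+u. ennreal (std_normal_density u) * indicator {t} u \<partial>lborel)"
    by (rule emeasure_density) auto
  also have "\<dots> = (\<integral>\<^sup>+(u::real). 0 \<partial>lborel)"
  proof (rule nn_integral_cong_AE)
    have "AE u in lborel. u \<noteq> t" by (rule AE_lborel_singleton)
    then show "AE u in lborel. ennreal (std_normal_density u) * indicator {t} u = 0"
      by eventually_elim simp
  qed
  finally show ?thesis by simp
qed

text \<open>With the other coordinates frozen the equation determines coordinate \<open>p\<close>,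
  and single points are null.\<close>

lemma gauss_hyperplane_null:
  assumes J: "finite J" "p \<in> J" and w: "w p \<noteq> 0"
  shows "(\<integral>\<^sup>+y. indicator {y. (\<Sum>q\<in>J. w q * y q) = 0} y \<partial>gauss J) = 0"
proof -
  obtain I where I: "J = insert p I" "p \<notin> I" "finite I"
    using J by (metis Set.set_insert finite_insert)
  have [measurable]: "(\<lambda>y. \<Sum>q\<in>J. w q * y q) \<in> borel_measurable (gauss J)"
    by (intro borel_measurable_sum borel_measurable_times measurable_gauss_component) auto
  have "(\<integral>\<^sup>+y. indicator {y. (\<Sum>q\<in>J. w q * y q) = 0} y \<partial>gauss J) =
    (\<integral>\<^sup>+y. indicator {y \<in> space (gauss J). (\<Sum>q\<in>J. w q * y q) = 0} y \<partial>gauss J)"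
    by (intro nn_integral_cong) (auto simp: indicator_def)
  also have "\<dots> = (\<integral>\<^sup>+x. (\<integral>\<^sup>+t. indicator {y \<in> space (gauss J). (\<Sum>q\<in>J. w q * y q) = 0} (x(p := t)) \<partial>std_gauss) \<partial>gauss I)"
    unfolding I(1)
    by (rule gauss.product_nn_integral_insert[OF I(3,2)]) (simp flip: I(1))
  also have "\<dots> \<le> (\<integral>\<^sup>+x. (\<integral>\<^sup>+t. indicator {- (\<Sum>q\<in>I. w q * x q) / w p} t \<partial>std_gauss) \<partial>gauss I)"
  proof (intro nn_integral_mono)
    fix x t
    have "(\<Sum>q\<in>J. w q * (x(p := t)) q) = w p * t + (\<Sum>q\<in>I. w q * x q)"
      using I by (auto intro!: sum.cong)
    moreover have "t = - c / w p" if "w p * t + c = 0" for c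
      using that w by (simp add: field_simps) 
    ultimately show "indicator {y \<in> space (gauss J). (\<Sum>q\<in>J. w q * y q) = 0} (x(p := t)) \<le> (indicator {- (\<Sum>q\<in>I. w q * x q) / w p} t :: ennreal)"
      by (auto simp: indicator_def)
  qed
  also have "\<dots> = 0" by (simp add: emeasure_std_gauss_singleton)
  finally show ?thesis by simp
qed

text \<open>Induction on the number of columns. If the first \<open>N\<close> columns have trivial
  kernel, a kernel vector satisfies \<open>z N \<noteq> 0\<close>. A nonzero \<open>w\<close>
  orthogonal to these columns exists because \<open>N < m\<close>, and it is then orthogonal to the
  new column as well. That column is independent of the previous ones, so it lies in this hyperplane
  with probability 0.\<close>

lemma emeasure_kernel_meets_sphere:
  "N \<le> m \<Longrightarrow> emeasure (gauss ({..<m} \<times> {..<N})) (kernel_meets m N (unit_sphere N)) = 0"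
proof (induction N)
  case 0
  \<comment> \<open>The sphere in dimension 0 is empty, as an empty sum cannot be 1.\<close>
  then show ?case by (simp add: kernel_meets_def unit_sphere_def)
next
  case (Suc N)
  let ?I = "{..<m} \<times> {..<N}" and ?J = "{..<m} \<times> {N}" and ?B = "kernel_meets m (Suc N) (unit_sphere (Suc N))"
  have IJ: "{..<m} \<times> {..<Suc N} = ?I \<union> ?J" by auto
  have B: "?B \<in> sets (gauss (?I \<union> ?J))"
    unfolding IJ[symmetric] by (rule kernel_meets_sets[OF compact_unit_sphere])
  have "emeasure (gauss (?I \<union> ?J)) ?B = (\<integral>\<^sup>+x. indicator ?B x \<partial>gauss (?I \<union> ?J))"
    using B by simp
  also have "\<dots> = (\<integral>\<^sup>+x. (\<integral>\<^sup>+y. indicator ?B (merge ?I ?J (x, y)) \<partial>gauss ?J) \<partial>gauss ?I)"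
    by (rule gauss.product_nn_integral_fold) (use B in auto)
  also have "\<dots> = (\<integral>\<^sup>+x. 0 \<partial>gauss ?I)"
  proof (rule nn_integral_cong_AE)
    have "AE x in gauss ?I. x \<notin> kernel_meets m N (unit_sphere N)"
      using Suc kernel_meets_sets[OF compact_unit_sphere] by (intro AE_not_in null_setsI) auto
    then show "AE x in gauss ?I. (\<integral>\<^sup>+y. indicator ?B (merge ?I ?J (x, y)) \<partial>gauss ?J) = 0"
      using AE_space
    proof eventually_elim
      fix x assume x: "x \<notin> kernel_meets m N (unit_sphere N)" "x \<in> space (gauss ?I)"
      obtain w where w: "\<exists>i\<in>{..<m}. w i \<noteq> 0" "\<forall>j\<in>{..<N}. (\<Sum>i\<in>{..<m}. w i * x (i, j)) = 0"
        using exists_orthogonal[of "{..<N}" "{..<m}" "\<lambda>j i. x (i, j)"] Suc.prems by auto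
      have "indicator ?B (merge ?I ?J (x, y)) \<le> (indicator {y. (\<Sum>q\<in>?J. w (fst q) * y q) = 0} y :: ennreal)" for y
      proof (cases "merge ?I ?J (x, y) \<in> ?B")
        case True
        then obtain z where z: "z \<in> unit_sphere (Suc N)"
          "\<forall>i<m. (\<Sum>j<Suc N. merge ?I ?J (x, y) (i, j) * z j) = 0"
          by (auto simp: kernel_meets_def)
        then have eq: "(\<Sum>j<N. x (i, j) * z j) + y (i, N) * z N = 0" if "i < m" for i
          using that by (simp add: merge_def)
        have "z N \<noteq> 0"
        proof
          assume "z N = 0"
          then have "z \<in> unit_sphere N"
            using z(1) by (auto simp: unit_sphere_def) (metis Suc_leI le_neq_implies_less)
          then show False using x eq \<open>z N = 0\<close> by (auto simp: kernel_meets_def)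
        qed
        have "0 = (\<Sum>i<m. w i * ((\<Sum>j<N. x (i, j) * z j) + y (i, N) * z N))" using eq by simp
        also have "\<dots> = (\<Sum>i<m. \<Sum>j<N. w i * x (i, j) * z j) + (\<Sum>i<m. w i * y (i, N)) * z N"
          by (simp add: distrib_left sum.distrib sum_distrib_left sum_distrib_right mult.assoc)
        also have "(\<Sum>i<m. \<Sum>j<N. w i * x (i, j) * z j) = (\<Sum>j<N. (\<Sum>i<m. w i * x (i, j)) * z j)"
          by (subst sum.swap) (simp add: sum_distrib_right)
        also have "\<dots> = 0" using w(2) by simp
        finally have "(\<Sum>i<m. w i * y (i, N)) = 0" using \<open>z N \<noteq> 0\<close> by simp
        then have "(\<Sum>q\<in>?J. w (fst q) * y q) = 0" unfolding sum.cartesian_product' by simp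
        then show ?thesis by (simp add: indicator_def)
      qed simp
      then have "(\<integral>\<^sup>+y. indicator ?B (merge ?I ?J (x, y)) \<partial>gauss ?J) \<le>
        (\<integral>\<^sup>+y. indicator {y. (\<Sum>q\<in>?J. w (fst q) * y q) = 0} y \<partial>gauss ?J)"
        by (intro nn_integral_mono)
      also obtain i where "i < m" "w i \<noteq> 0" using w(1) by auto
      then have "(\<integral>\<^sup>+y. indicator {y. (\<Sum>q\<in>?J. w (fst q) * y q) = 0} y \<partial>gauss ?J) = 0"
        by (intro gauss_hyperplane_null[where p="(i, N)"]) auto
      finally show "(\<integral>\<^sup>+y. indicator ?B (merge ?I ?J (x, y)) \<partial>gauss ?J) = 0" by simp
    qed
  qed
  finally show ?case by (simp add: IJ)
qed

section \<open>The descent cone of the box-constrained problem\<close>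

text \<open>The sign conditions say that \<open>z\<close> points into the box at the active bounds
  of \<open>x0\<close>. Under them the sum is the directional derivative of the
  \<open>\<ell>\<^sub>1\<close> norm at \<open>x0\<close>: entries on the support move towards 0,
  all others away from it.\<close>

definition descent_sphere :: "nat \<Rightarrow> nat set \<Rightarrow> nat set \<Rightarrow> (nat \<Rightarrow> real) set" where
  "descent_sphere N K1 Km1 = {z \<in> unit_sphere N. (\<forall>j\<in>K1. z j \<le> 0) \<and> (\<forall>j\<in>Km1. 0 \<le> z j) \<and>
     (\<Sum>j<N. if j \<in> K1 \<union> Km1 then - \<bar>z j\<bar> else \<bar>z j\<bar>) \<le> 0}"

lemma compact_descent_sphere: "compact (descent_sphere N K1 Km1)"
proof -
  have eq: "descent_sphere N K1 Km1 = unit_sphere N \<inter> ((\<Inter>j\<in>K1. {z. z j \<le> 0}) \<inter> (\<Inter>j\<in>Km1. {z. 0 \<le> z j}) \<inter>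
    {z. (\<Sum>j<N. if j \<in> K1 \<union> Km1 then - \<bar>z j\<bar> else \<bar>z j\<bar>) \<le> 0})"
    by (auto simp: descent_sphere_def)
  have "continuous_on UNIV (\<lambda>z::nat\<Rightarrow>real. if j \<in> K1 \<union> Km1 then - \<bar>z j\<bar> else \<bar>z j\<bar>)" for j
    by (cases "j \<in> K1 \<union> Km1") (auto intro!: continuous_intros)
  then show ?thesis unfolding eq
    by (intro compact_Int_closed compact_unit_sphere closed_Int closed_INT ballI closed_Collect_le continuous_intros)
qed

text \<open>A direction of the cone may be followed for a full step: its entries are at most 1 in
  modulus, so \<open>x0 + z\<close> stays in the box and the norm changes by exactly the directional
  derivative. Conversely, the difference between a competitor and \<open>x0\<close>, normalised,
  lies in the cone.\<close>

lemma unique_l1_box_solution_iff: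
  fixes a :: "nat \<times> nat \<Rightarrow> real"
  assumes K: "K1 \<subseteq> {..<N}" "Km1 \<subseteq> {..<N}" "K1 \<inter> Km1 = {}"
  defines "x0 \<equiv> \<lambda>j. indic_vec K1 j - indic_vec Km1 j"
  shows "unique_l1_box_solution m N (gauss_matrix m a) (mat_vec m N (gauss_matrix m a) x0) x0 \<longleftrightarrow>
    \<not> (\<exists>z\<in>descent_sphere N K1 Km1. \<forall>i<m. (\<Sum>j<N. a (i, j) * z j) = 0)"
proof -
  have x0: "x0 j = 1" if "j \<in> K1" for j using that K by (auto simp: x0_def indic_vec_def)
  have x0': "x0 j = -1" if "j \<in> Km1" for j using that K by (auto simp: x0_def indic_vec_def)
  have x00: "x0 j = 0" if "j \<notin> K1 \<union> Km1" for j using that by (auto simp: x0_def indic_vec_def)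
  have x0N: "x0 j = 0" if "N \<le> j" for j using that K by (intro x00) auto
  have rows: "(\<Sum>j<N. gauss_matrix m a i j * x j) = mat_vec m N (gauss_matrix m a) x0 i \<longleftrightarrow>
    (\<Sum>j<N. a (i, j) * (x j - x0 j)) = 0" if "i < m" for i x
  proof -
    have "(\<Sum>j<N. gauss_matrix m a i j * x j) - mat_vec m N (gauss_matrix m a) x0 i =
      (\<Sum>j<N. a (i, j) * (x j - x0 j)) / sqrt (real m)"
      using that by (simp add: mat_vec_def gauss_matrix_def sum_divide_distrib diff_divide_distrib algebra_simps flip: sum_subtractf)
    moreover have "sqrt (real m) > 0" using that by simp
    ultimately show ?thesis by auto
  qed
  have feas: "x \<in> box_feasible m N (gauss_matrix m a) (mat_vec m N (gauss_matrix m a) x0) \<longleftrightarrow>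
    (\<forall>j\<ge>N. x j = 0) \<and> (\<forall>j<N. -1 \<le> x j \<and> x j \<le> 1) \<and> (\<forall>i<m. (\<Sum>j<N. a (i, j) * (x j - x0 j)) = 0)" for x
    unfolding box_feasible_def using rows by auto
  have "x0 \<in> box_feasible m N (gauss_matrix m a) (mat_vec m N (gauss_matrix m a) x0)"
    unfolding feas using x0N by (auto simp: x0_def indic_vec_def)
  then have "unique_l1_box_solution m N (gauss_matrix m a) (mat_vec m N (gauss_matrix m a) x0) x0 \<longleftrightarrow>
    \<not> (\<exists>x. x \<in> box_feasible m N (gauss_matrix m a) (mat_vec m N (gauss_matrix m a) x0) \<and> x \<noteq> x0 \<and> l1norm N x \<le> l1norm N x0)"
    unfolding unique_l1_box_solution_def by (auto simp: not_le)
  also have "(\<exists>x. x \<in> box_feasible m N (gauss_matrix m a) (mat_vec m N (gauss_matrix m a) x0) \<and> x \<noteq> x0 \<and> l1norm N x \<le> l1norm N x0) \<longleftrightarrow>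
    (\<exists>z\<in>descent_sphere N K1 Km1. \<forall>i<m. (\<Sum>j<N. a (i, j) * z j) = 0)"
  proof
    assume "\<exists>z\<in>descent_sphere N K1 Km1. \<forall>i<m. (\<Sum>j<N. a (i, j) * z j) = 0"
    then obtain z where z: "z \<in> descent_sphere N K1 Km1" "\<forall>i<m. (\<Sum>j<N. a (i, j) * z j) = 0" by auto
    have zs: "z \<in> unit_sphere N" and z1: "\<And>j. j \<in> K1 \<Longrightarrow> z j \<le> 0" and zm1: "\<And>j. j \<in> Km1 \<Longrightarrow> 0 \<le> z j"
      and zl: "(\<Sum>j<N. if j \<in> K1 \<union> Km1 then - \<bar>z j\<bar> else \<bar>z j\<bar>) \<le> 0"
      using z(1) by (auto simp: descent_sphere_def)
    note zb = unit_sphere_abs_le[OF zs]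
    define x where "x j = x0 j + z j" for j
    have xj: "-1 \<le> x j \<and> x j \<le> 1 \<and> \<bar>x j\<bar> - \<bar>x0 j\<bar> = (if j \<in> K1 \<union> Km1 then - \<bar>z j\<bar> else \<bar>z j\<bar>)" for j
    proof -
      consider "j \<in> K1" | "j \<in> Km1" | "j \<notin> K1 \<union> Km1" by blast
      then show ?thesis
        using zb[of j] z1[of j] zm1[of j] x0[of j] x0'[of j] x00[of j] by cases (auto simp: x_def)
    qed
    have "l1norm N x - l1norm N x0 = (\<Sum>j<N. if j \<in> K1 \<union> Km1 then - \<bar>z j\<bar> else \<bar>z j\<bar>)"
      unfolding l1norm_def sum_subtractf[symmetric] using xj by (intro sum.cong) auto
    then have "l1norm N x \<le> l1norm N x0" using zl by linarith
    moreover have "x \<noteq> x0"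
    proof
      assume "x = x0"
      then have "z j = 0" for j by (metis x_def add_cancel_right_right)
      then show False using zs by (simp add: unit_sphere_def)
    qed
    moreover have "x \<in> box_feasible m N (gauss_matrix m a) (mat_vec m N (gauss_matrix m a) x0)"
      unfolding feas using xj z(2) x0N zs by (auto simp: x_def unit_sphere_def)
    ultimately show "\<exists>x. x \<in> box_feasible m N (gauss_matrix m a) (mat_vec m N (gauss_matrix m a) x0) \<and> x \<noteq> x0 \<and> l1norm N x \<le> l1norm N x0"
      by blast
  next
    assume "\<exists>x. x \<in> box_feasible m N (gauss_matrix m a) (mat_vec m N (gauss_matrix m a) x0) \<and> x \<noteq> x0 \<and> l1norm N x \<le> l1norm N x0"
    then obtain x where x: "\<And>j. N \<le> j \<Longrightarrow> x j = 0" "\<And>j. j < N \<Longrightarrow> -1 \<le> x j \<and> x j \<le> 1"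
      "\<And>i. i < m \<Longrightarrow> (\<Sum>j<N. a (i, j) * (x j - x0 j)) = 0" "x \<noteq> x0" "l1norm N x \<le> l1norm N x0"
      unfolding feas by blast
    define d where "d j = x j - x0 j" for j
    define r where "r = sqrt (\<Sum>j<N. (d j)\<^sup>2)"
    have dN: "d j = 0" if "N \<le> j" for j using that x(1) x0N by (simp add: d_def)
    obtain j where "d j \<noteq> 0" using x(4) by (auto simp: d_def fun_eq_iff)
    then have "j < N" "0 < (d j)\<^sup>2" using dN by (auto simp: not_le[symmetric])
    then have "0 < (\<Sum>j<N. (d j)\<^sup>2)" by (intro sum_pos2[where i=j]) auto
    then have r: "r > 0" "r\<^sup>2 = (\<Sum>j<N. (d j)\<^sup>2)" by (auto simp: r_def)
    have d1: "d j \<le> 0" if "j \<in> K1" for j using that x(2)[of j] x0[OF that] K by (auto simp: d_def)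
    have dm1: "0 \<le> d j" if "j \<in> Km1" for j using that x(2)[of j] x0'[OF that] K by (auto simp: d_def)
    \<comment> \<open>Only an inequality: on the support an entry of \<open>d\<close> may reach
      modulus 2, and beyond modulus 1 the entry of \<open>x\<close> has passed through 0.\<close>
    have "(\<Sum>j<N. if j \<in> K1 \<union> Km1 then - \<bar>d j\<bar> else \<bar>d j\<bar>) \<le> (\<Sum>j<N. \<bar>x j\<bar> - \<bar>x0 j\<bar>)"
    proof (rule sum_mono)
      fix j
      consider "j \<in> K1" | "j \<in> Km1" | "j \<notin> K1 \<union> Km1" by blast
      then show "(if j \<in> K1 \<union> Km1 then - \<bar>d j\<bar> else \<bar>d j\<bar>) \<le> \<bar>x j\<bar> - \<bar>x0 j\<bar>"
        using d1[of j] dm1[of j] x0[of j] x0'[of j] x00[of j] by cases (auto simp: d_def)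
    qed
    also have "\<dots> \<le> 0" using x(5) by (simp add: l1norm_def sum_subtractf)
    finally have dl: "(\<Sum>j<N. if j \<in> K1 \<union> Km1 then - \<bar>d j\<bar> else \<bar>d j\<bar>) \<le> 0" .
    define z where "z j = d j / r" for j
    have "(\<Sum>j<N. (z j)\<^sup>2) = 1"
      using r \<open>0 < (\<Sum>j<N. (d j)\<^sup>2)\<close> by (simp add: z_def power_divide flip: sum_divide_distrib)
    moreover have "(\<Sum>j<N. if j \<in> K1 \<union> Km1 then - \<bar>z j\<bar> else \<bar>z j\<bar>) =
      (\<Sum>j<N. if j \<in> K1 \<union> Km1 then - \<bar>d j\<bar> else \<bar>d j\<bar>) / r"
      unfolding sum_divide_distrib using r by (intro sum.cong) (auto simp: z_def abs_divide)
    moreover have "\<dots> \<le> 0" using dl r by (simp add: divide_nonpos_pos)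
    ultimately have "z \<in> descent_sphere N K1 Km1"
      using dN d1 dm1 r by (auto simp: descent_sphere_def unit_sphere_def z_def divide_nonpos_pos)
    moreover have "(\<Sum>j<N. a (i, j) * z j) = 0" if "i < m" for i
    proof -
      have "(\<Sum>j<N. a (i, j) * z j) = (\<Sum>j<N. a (i, j) * (x j - x0 j)) / r"
        by (simp add: z_def d_def sum_divide_distrib)
      then show ?thesis using x(3)[OF that] by simp
    qed
    ultimately show "\<exists>z\<in>descent_sphere N K1 Km1. \<forall>i<m. (\<Sum>j<N. a (i, j) * z j) = 0" by blast
  qed
  finally show ?thesis .
qed

section \<open>Escape of the kernel from the descent cone\<close>

lemma nn_integral_std_gauss_exp:
  "(\<integral>\<^sup>+u. ennreal (exp (- l * u)) \<partial>std_gauss) = ennreal (exp (l\<^sup>2 / 2))"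
proof -
  have "(\<integral>\<^sup>+u. ennreal (exp (- l * u)) \<partial>std_gauss) = (\<integral>\<^sup>+u. ennreal (std_normal_density u) * ennreal (exp (- l * u)) \<partial>lborel)"
    by (rule nn_integral_std_gauss) measurable
  also have "\<dots> = ennreal \<bar>1\<bar> * (\<integral>\<^sup>+t. ennreal (std_normal_density (- l + 1 * t)) * ennreal (exp (- l * (- l + 1 * t))) \<partial>lborel)"
    by (rule nn_integral_real_affine) auto
  also have "\<dots> = (\<integral>\<^sup>+t. ennreal (exp (l\<^sup>2 / 2)) * (ennreal (std_normal_density t) * 1) \<partial>lborel)"
  proof -
    have "std_normal_density (- l + t) * exp (- l * (- l + t)) = exp (l\<^sup>2 / 2) * std_normal_density t" for t
    proof -
      have "- (- l + t)\<^sup>2 / 2 + - l * (- l + t) = l\<^sup>2 / 2 + - t\<^sup>2 / 2"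
        by (simp add: power2_eq_square field_simps)
      then have "exp (- (- l + t)\<^sup>2 / 2) * exp (- l * (- l + t)) = exp (l\<^sup>2 / 2) * exp (- t\<^sup>2 / 2)"
        by (simp only: exp_add[symmetric])
      then show ?thesis unfolding std_normal_density_def by (simp add: mult_ac)
    qed
    then show ?thesis by (simp flip: ennreal_mult)
  qed
  also have "\<dots> = ennreal (exp (l\<^sup>2 / 2)) * (\<integral>\<^sup>+t. 1 \<partial>std_gauss)"
    by (subst nn_integral_std_gauss, simp, rule nn_integral_cmult) measurable
  finally show ?thesis by (simp add: std_gauss.emeasure_space_1[simplified])
qed

definition threshold_risk :: "nat \<Rightarrow> nat \<Rightarrow> real \<Rightarrow> real" where
  "threshold_risk N k \<tau> = real k * lower_sq \<tau> + 2 * (real N - real k) * upper_sq \<tau>"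

text \<open>Both sides of the exponential comparison are evaluated. The parameter \<open>S\<close>
  stays free here and is set to \<open>sqrt \<Delta>\<close> in the end. AM-GM with weight
  \<open>l + S\<close> produces the coefficient \<open>l / (2 * (l + S))\<close> in front of the
  squares, and \<open>x = l / (2 * S)\<close> is the value for which this equals
  \<open>x / (1 + 2 * x)\<close>, as the one-dimensional bounds require.\<close>

lemma gordon_escape:
  fixes z :: "'l \<Rightarrow> nat \<Rightarrow> real" and m N :: nat and \<eta> l S \<tau> :: real
  assumes K: "K1 \<subseteq> {..<N}" "Km1 \<subseteq> {..<N}" "K1 \<inter> Km1 = {}"
    and L: "finite L" and z: "\<And>k. k \<in> L \<Longrightarrow> z k \<in> descent_sphere N K1 Km1"
    and pos: "\<eta> > 0" "l > 0" "S > 0" "\<tau> \<ge> 0"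
  defines "m' \<equiv> real m + 1 + \<eta>\<^sup>2 + l * \<eta>" and "x \<equiv> l / (2 * S)"
  shows "measure (gauss ({..<m} \<times> {..<N})) {a \<in> space (gauss ({..<m} \<times> {..<N})).
      \<exists>k\<in>L. smooth_norm \<eta> m (\<lambda>i. \<Sum>j<N. a (i, j) * z k j) < 2 * \<eta>} \<le>
    exp (2 * l * \<eta> - l\<^sup>2 / 2 - (real m / m') * (l * sqrt m' - l\<^sup>2 / 4) + l * (l + S) / 2 +
      (x + x\<^sup>2) * threshold_risk N (card (K1 \<union> Km1)) \<tau>)"
proof -
  let ?r = "threshold_risk N (card (K1 \<union> Km1)) \<tau>" and ?a = "exp (- (real m / m') * (l * sqrt m' - l\<^sup>2 / 4))"
    and ?c = "ennreal (exp (- 2 * l * \<eta>))" and ?n = "\<lambda>v :: nat \<times> nat \<Rightarrow> real. smooth_norm \<eta> m (\<lambda>i. v (i, N))"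
    and ?g = "\<lambda>v :: nat \<times> nat \<Rightarrow> real. ennreal (exp (- l * v (m, N)))"
  let ?K = "{..m} \<times> {..N}" and ?I1 = "{..<m} \<times> {..<N}" and ?I2 = "{..<m} \<times> {N}" and ?H = "{m} \<times> {..<N}"
  define \<sigma> where "\<sigma> = l + S"
  define \<mu> where "\<mu> = x / (1 + 2 * x)"
  have x: "x > 0" using pos by (simp add: x_def)
  have \<mu>: "\<mu> = l / (2 * \<sigma>)" using pos by (simp add: \<mu>_def x_def \<sigma>_def field_simps)
  have \<sigma>: "\<sigma> > 0" using pos by (simp add: \<sigma>_def)
  \<comment> \<open>The distance of \<open>- h\<close> to the scaled subdifferential in coordinate
    \<open>j\<close>, which is \<open>{\<tau>..}\<close> on \<open>K1\<close>,
    \<open>{..- \<tau>}\<close> on \<open>Km1\<close> and \<open>{- \<tau>..\<tau>}\<close>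
    elsewhere.\<close>
  define f where "f j h = (if j \<in> K1 then max 0 (\<tau> - - h) else if j \<in> Km1 then max 0 (\<tau> - h) else max 0 (\<bar>h\<bar> - \<tau>))" for j and h :: real
  \<comment> \<open>AM-GM turns the norm of the thresholded vector into a sum of squares, whose exponential moment factorises\<close>
  define D where "D v = \<sigma> / 2 + (\<Sum>j<N. (f j (v (m, j)))\<^sup>2) / (2 * \<sigma>)" for v :: "nat \<times> nat \<Rightarrow> real"
  let ?b = "exp (l * \<sigma> / 2 + (x + x\<^sup>2) * ?r)" and ?d = "\<lambda>v. ennreal (exp (l * D v))" and ?e = "\<lambda>v. ennreal (exp (- l * ?n v))"
  have f_meas[measurable]: "f j \<in> borel_measurable borel" for j unfolding f_def by measurable
  have comp: "(\<lambda>v. v p) \<in> borel_measurable (gauss A)" if "p \<in> A" for p :: "nat \<times> nat" and A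
    using that by (rule measurable_gauss_component)
  have fc: "(\<lambda>v. f j (v p)) \<in> borel_measurable (gauss A)" if "p \<in> A" for j and p :: "nat \<times> nat" and A
    by (rule measurable_compose[OF comp[OF that] f_meas])
  have D_meas: "D \<in> borel_measurable (gauss A)" if "?H \<subseteq> A" for A
    unfolding D_def
    by (intro borel_measurable_add borel_measurable_divide borel_measurable_const borel_measurable_sum borel_measurable_power fc)
      (use that in auto)
  have n_meas: "(\<lambda>v. ?n v) \<in> borel_measurable (gauss A)" if "?I2 \<subseteq> A" for A
  proof -
    have "(\<lambda>v. \<eta>\<^sup>2 + (\<Sum>i<m. (v (i, N))\<^sup>2)) \<in> borel_measurable (gauss A)"
      by (intro borel_measurable_add borel_measurable_const borel_measurable_sum borel_measurable_power comp) (use that in auto)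
    then show ?thesis unfolding smooth_norm_def by measurable
  qed
  \<comment> \<open>A predicate on arrays rather than a subset of one space, since it is read both
    on the extended array and on the matrix block.\<close>
  define B where "B v \<longleftrightarrow> (\<exists>k\<in>L. smooth_norm \<eta> m (\<lambda>i. \<Sum>j<N. v (i, j) * z k j) < 2 * \<eta>)" for v
  let ?i = "\<lambda>v. if B v then ?c else 0"
  have B_meas: "Measurable.pred (gauss A) B" if "?I1 \<subseteq> A" for A
  proof -
    have "(\<lambda>v. \<eta>\<^sup>2 + (\<Sum>i<m. (\<Sum>j<N. v (i, j) * z k j)\<^sup>2)) \<in> borel_measurable (gauss A)" for k
      by (intro borel_measurable_add borel_measurable_const borel_measurable_sum borel_measurable_power
        borel_measurable_times comp) (use that in auto)
    then have [measurable]: "(\<lambda>v. smooth_norm \<eta> m (\<lambda>i. \<Sum>j<N. v (i, j) * z k j)) \<in> borel_measurable (gauss A)" for k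
      unfolding smooth_norm_def by measurable
    show ?thesis unfolding B_def using L by measurable
  qed
  have zu: "z k \<in> unit_sphere N" if "k \<in> L" for k using z[OF that] by (simp add: descent_sphere_def)
  have D_ge: "- (\<Sum>j<N. v (m, j) * z k j) \<le> D v" if k: "k \<in> L" for v k
  proof -
    let ?c = "\<lambda>j. if j \<in> K1 \<union> Km1 then - \<bar>z k j\<bar> else \<bar>z k j\<bar>"
    have zk: "\<And>j. j \<in> K1 \<Longrightarrow> z k j \<le> 0" "\<And>j. j \<in> Km1 \<Longrightarrow> 0 \<le> z k j" "(\<Sum>j<N. ?c j) \<le> 0"
      using z[OF k] by (auto simp: descent_sphere_def)
    \<comment> \<open>Weak duality, with \<open>\<tau>\<close> as multiplier of the descent
      condition on the norm; the last term is at most 0.\<close>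
    have "- (\<Sum>j<N. v (m, j) * z k j) \<le> (\<Sum>j<N. f j (v (m, j)) * \<bar>z k j\<bar>) + \<tau> * (\<Sum>j<N. ?c j)"
      unfolding sum_negf[symmetric] sum_distrib_left sum.distrib[symmetric]
    proof (rule sum_mono)
      fix j
      define h where "h = v (m, j)"
      consider "j \<in> K1" | "j \<in> Km1" | "j \<notin> K1 \<union> Km1" by blast
      then show "- (v (m, j) * z k j) \<le> f j (v (m, j)) * \<bar>z k j\<bar> + \<tau> * ?c j"
        unfolding h_def[symmetric]
      proof cases
        case 1
        have "(\<tau> + h) * \<bar>z k j\<bar> \<le> f j h * \<bar>z k j\<bar>" using 1 by (intro mult_right_mono) (auto simp: f_def)
        then show "- (h * z k j) \<le> f j h * \<bar>z k j\<bar> + \<tau> * ?c j" using 1 zk(1)[OF 1] by (simp add: algebra_simps)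
      next
        case 2
        then have n1: "j \<notin> K1" using K by auto
        have "(\<tau> - h) * \<bar>z k j\<bar> \<le> f j h * \<bar>z k j\<bar>" using 2 n1 by (intro mult_right_mono) (auto simp: f_def)
        then show "- (h * z k j) \<le> f j h * \<bar>z k j\<bar> + \<tau> * ?c j" using 2 zk(2)[OF 2] by (simp add: algebra_simps)
      next
        case 3
        have "(\<bar>h\<bar> - \<tau>) * \<bar>z k j\<bar> \<le> f j h * \<bar>z k j\<bar>" using 3 by (intro mult_right_mono) (auto simp: f_def)
        moreover have "- (h * z k j) \<le> \<bar>h\<bar> * \<bar>z k j\<bar>" by (metis abs_ge_minus_self abs_mult)
        ultimately show "- (h * z k j) \<le> f j h * \<bar>z k j\<bar> + \<tau> * ?c j" using 3 by (simp add: algebra_simps)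
      qed
    qed
    also have "\<dots> \<le> (\<Sum>j<N. f j (v (m, j)) * \<bar>z k j\<bar>)"
      using pos(4) zk(3) by (simp add: mult_nonneg_nonpos)
    also have "\<dots> \<le> (\<Sum>j<N. \<sigma> / 2 * (z k j)\<^sup>2 + (f j (v (m, j)))\<^sup>2 / (2 * \<sigma>))"
    proof (rule sum_mono)
      fix j
      define p q where "p = f j (v (m, j))" and "q = \<bar>z k j\<bar>"
      have "0 \<le> (p - \<sigma> * q)\<^sup>2 / (2 * \<sigma>)" using \<sigma> by simp
      also have "\<dots> = \<sigma> / 2 * q\<^sup>2 + p\<^sup>2 / (2 * \<sigma>) - p * q"
        using \<sigma> by (simp add: power2_diff power_mult_distrib field_simps power2_eq_square)
      finally show "f j (v (m, j)) * \<bar>z k j\<bar> \<le> \<sigma> / 2 * (z k j)\<^sup>2 + (f j (v (m, j)))\<^sup>2 / (2 * \<sigma>)"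
        by (simp add: p_def q_def)
    qed
    also have "\<dots> = \<sigma> / 2 * (\<Sum>j<N. (z k j)\<^sup>2) + (\<Sum>j<N. (f j (v (m, j)))\<^sup>2) / (2 * \<sigma>)"
      by (simp add: sum.distrib sum_distrib_left sum_divide_distrib)
    also have "\<dots> = D v" using zu[OF k] by (simp add: D_def unit_sphere_def)
    finally show ?thesis .
  qed
  \<comment> \<open>Each side factorises over independent blocks: the matrix and the corner on the
    left, column \<open>N\<close> and row \<open>m\<close> on the right.\<close>
  have un1: "?I1 \<union> (?K - ?I1) = ?K" and un2: "?I2 \<union> (?K - ?I2) = ?K" by auto
  let ?P = "measure (gauss ?I1) {a \<in> space (gauss ?I1). B a}"
  interpret P1: prob_space "gauss ?I1" by (rule prob_space_gauss)
  have "(\<integral>\<^sup>+v. indicator {v \<in> space (gauss ?K). \<exists>k\<in>L. smooth_norm \<eta> m (\<lambda>i. \<Sum>j<N. v (i, j) * z k j) < 2 * \<eta>} v *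
        ennreal (exp (- l * (2 * \<eta> + v (m, N)))) \<partial>gauss ?K) =
    (\<integral>\<^sup>+v. ?i v * ?g v \<partial>gauss (?I1 \<union> (?K - ?I1)))"
    unfolding un1
    by (intro nn_integral_cong) (auto simp: B_def algebra_simps simp flip: ennreal_mult exp_add)
  also have "\<dots> = (\<integral>\<^sup>+v. ?i v \<partial>gauss ?I1) * (\<integral>\<^sup>+v. ?g v \<partial>gauss (?K - ?I1))"
  proof (rule nn_integral_gauss_Un)
    show "(if B x then ?c else 0) = (if B y then ?c else 0)"
      if "\<And>p. p \<in> ?I1 \<Longrightarrow> x p = y p" for x y
      using that by (simp add: B_def smooth_norm_def)
    show "ennreal (exp (- l * x (m, N))) = ennreal (exp (- l * y (m, N)))"
      if "\<And>p. p \<in> ?K - ?I1 \<Longrightarrow> x p = y p" for x y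
      using that[of "(m, N)"] by simp
    show "(\<lambda>v. ?i v) \<in> borel_measurable (gauss (?I1 \<union> (?K - ?I1)))"
      "(\<lambda>v. ?i v) \<in> borel_measurable (gauss ?I1)"
      by (intro measurable_If measurable_const B_meas[unfolded pred_def]; auto)+
    have "(\<lambda>v. exp (- l * v (m, N))) \<in> borel_measurable (gauss A)" if "(m, N) \<in> A" for A
      using comp[OF that] by measurable
    then show "(\<lambda>v. ?g v) \<in> borel_measurable (gauss (?I1 \<union> (?K - ?I1)))"
      "(\<lambda>v. ?g v) \<in> borel_measurable (gauss (?K - ?I1))"
      by (auto intro!: measurable_compose[OF _ measurable_ennreal])
  qed auto
  also have "(\<integral>\<^sup>+v. ?i v \<partial>gauss ?I1) = ennreal (exp (- 2 * l * \<eta>) * ?P)"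
  proof -
    have "{a \<in> space (gauss ?I1). B a} \<in> sets (gauss ?I1)" using B_meas[of ?I1] by (simp add: pred_def)
    then have "(\<integral>\<^sup>+v. ?c * indicator {a \<in> space (gauss ?I1). B a} v \<partial>gauss ?I1) = ?c * ennreal ?P"
      by (simp add: nn_integral_cmult_indicator P1.emeasure_eq_measure)
    moreover have "(\<integral>\<^sup>+v. ?i v \<partial>gauss ?I1) =
      (\<integral>\<^sup>+v. ?c * indicator {a \<in> space (gauss ?I1). B a} v \<partial>gauss ?I1)"
      by (intro nn_integral_cong) auto
    ultimately show ?thesis by (simp add: ennreal_mult)
  qed
  also have "(\<integral>\<^sup>+v. ?g v \<partial>gauss (?K - ?I1)) = ennreal (exp (l\<^sup>2 / 2))"
  proof -
    have meas: "(\<lambda>v. ?g v) \<in> borel_measurable (gauss A)" if "(m, N) \<in> A" for A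
      using comp[OF that] by measurable
    have "(\<integral>\<^sup>+v. ?g v \<partial>gauss (?K - ?I1)) = (\<integral>\<^sup>+v. ?g v \<partial>gauss {(m, N)})"
      by (rule nn_integral_gauss_subset) (auto intro!: meas)
    also have "\<dots> = (\<integral>\<^sup>+u. ennreal (exp (- l * u)) \<partial>std_gauss)"
      by (rule gauss.product_nn_integral_singleton) measurable
    finally show ?thesis by (simp only: nn_integral_std_gauss_exp)
  qed
  finally have LHS: "(\<integral>\<^sup>+v. indicator {v \<in> space (gauss ?K). \<exists>k\<in>L. smooth_norm \<eta> m (\<lambda>i. \<Sum>j<N. v (i, j) * z k j) < 2 * \<eta>} v *
        ennreal (exp (- l * (2 * \<eta> + v (m, N)))) \<partial>gauss ?K) = ennreal (exp (- 2 * l * \<eta>) * ?P) * ennreal (exp (l\<^sup>2 / 2))" .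
  define E where "E p u = ennreal (exp (\<mu> * (f (snd p) u)\<^sup>2))" for p :: "nat \<times> nat" and u
  have E_meas: "E p \<in> borel_measurable borel" for p unfolding E_def by measurable
  have "(\<integral>\<^sup>+v. ennreal (exp (- l * (?n v - D v))) \<partial>gauss ?K) =
    (\<integral>\<^sup>+v. ?e v * ?d v \<partial>gauss (?I2 \<union> (?K - ?I2)))"
    unfolding un2
    by (intro nn_integral_cong) (simp add: algebra_simps flip: ennreal_mult exp_add)
  also have "\<dots> = (\<integral>\<^sup>+v. ?e v \<partial>gauss ?I2) * (\<integral>\<^sup>+v. ?d v \<partial>gauss (?K - ?I2))"
  proof (rule nn_integral_gauss_Un)
    show "ennreal (exp (- l * smooth_norm \<eta> m (\<lambda>i. x (i, N)))) = ennreal (exp (- l * smooth_norm \<eta> m (\<lambda>i. y (i, N))))"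
      if "\<And>p. p \<in> ?I2 \<Longrightarrow> x p = y p" for x y
      using that by (simp add: smooth_norm_def)
    show "ennreal (exp (l * D x)) = ennreal (exp (l * D y))"
      if "\<And>p. p \<in> ?K - ?I2 \<Longrightarrow> x p = y p" for x y
      using that by (simp add: D_def)
    show "(\<lambda>v. ?e v) \<in> borel_measurable (gauss (?I2 \<union> (?K - ?I2)))"
      using n_meas[of "?I2 \<union> (?K - ?I2)"] by simp
    show "(\<lambda>v. ?e v) \<in> borel_measurable (gauss ?I2)"
      using n_meas[of ?I2] by simp
    show "(\<lambda>v. ?d v) \<in> borel_measurable (gauss (?I2 \<union> (?K - ?I2)))"
      using D_meas[of "?I2 \<union> (?K - ?I2)"] by (simp add: subset_iff)
    show "(\<lambda>v. ?d v) \<in> borel_measurable (gauss (?K - ?I2))"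
      using D_meas[of "?K - ?I2"] by (simp add: subset_iff)
  qed auto
  also have "\<dots> \<le> ennreal (?a) *
    ennreal (?b)"
  proof (rule mult_mono)
    have n_eq: "?n v = sqrt (\<eta>\<^sup>2 + (\<Sum>p\<in>?I2. (v p)\<^sup>2))" for v :: "nat \<times> nat \<Rightarrow> real"
      unfolding smooth_norm_def sum.cartesian_product' by simp
    have "(\<integral>\<^sup>+v. ?e v \<partial>gauss ?I2) =
      ennreal (\<integral>v. exp (- l * ?n v) \<partial>gauss ?I2)"
    proof (rule nn_integral_eq_integral)
      show "integrable (gauss ?I2) (\<lambda>v. exp (- l * ?n v))"
        by (rule integrable_gauss_bounded[where C=1])
          (use n_meas[of ?I2] pos smooth_norm_pos[OF pos(1)] in \<open>auto intro: less_imp_le\<close>)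
    qed auto
    also have "(\<integral>v. exp (- l * ?n v) \<partial>gauss ?I2) \<le> ?a"
      using gauss_norm_laplace_bound[of ?I2 \<eta> l] pos unfolding n_eq m'_def by simp
    finally show "(\<integral>\<^sup>+v. ?e v \<partial>gauss ?I2) \<le>
      ennreal (?a)" by (simp add: ennreal_leI)
    have "(\<integral>\<^sup>+v. ?d v \<partial>gauss (?K - ?I2)) = (\<integral>\<^sup>+v. ?d v \<partial>gauss ?H)"
    proof (rule nn_integral_gauss_subset)
      show "(\<lambda>v. ?d v) \<in> borel_measurable (gauss (?K - ?I2))"
        using D_meas[of "?K - ?I2"] by (simp add: subset_iff)
      show "(\<lambda>v. ?d v) \<in> borel_measurable (gauss ?H)"
        using D_meas[of ?H] by simp
      show "ennreal (exp (l * D x)) = ennreal (exp (l * D y))" if "\<And>p. p \<in> ?H \<Longrightarrow> x p = y p" for x y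
        using that by (simp add: D_def)
    qed auto
    also have "\<dots> = (\<integral>\<^sup>+v. ennreal (exp (l * \<sigma> / 2)) * (\<Prod>p\<in>?H. E p (v p)) \<partial>gauss ?H)"
    proof (rule nn_integral_cong)
      fix v :: "nat \<times> nat \<Rightarrow> real"
      have "l * D v = l * \<sigma> / 2 + (\<Sum>p\<in>?H. \<mu> * (f (snd p) (v p))\<^sup>2)"
        unfolding D_def \<mu> sum.cartesian_product' by (simp add: sum_distrib_left sum_divide_distrib distrib_left mult_ac)
      then show "?d v = ennreal (exp (l * \<sigma> / 2)) * (\<Prod>p\<in>?H. E p (v p))"
        unfolding E_def by (simp add: exp_add exp_sum ennreal_mult prod_nonneg flip: prod_ennreal)
    qed
    also have "\<dots> = ennreal (exp (l * \<sigma> / 2)) * (\<integral>\<^sup>+v. (\<Prod>p\<in>?H. E p (v p)) \<partial>gauss ?H)"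
      by (rule nn_integral_cmult)
        (intro borel_measurable_prod_ennreal measurable_compose[OF comp E_meas])
    also have "(\<integral>\<^sup>+v. (\<Prod>p\<in>?H. E p (v p)) \<partial>gauss ?H) = (\<Prod>p\<in>?H. \<integral>\<^sup>+u. E p u \<partial>std_gauss)"
      by (rule gauss.product_nn_integral_prod) (use E_meas in auto)
    also have "\<dots> = (\<Prod>j<N. \<integral>\<^sup>+u. ennreal (exp (\<mu> * (f j u)\<^sup>2)) \<partial>std_gauss)"
      unfolding prod.cartesian_product' E_def by simp
    also have "\<dots> \<le> (\<Prod>j<N. ennreal (exp ((x + x\<^sup>2) * (if j \<in> K1 \<union> Km1 then lower_sq \<tau> else 2 * upper_sq \<tau>))))"
    proof (rule prod_mono_ennreal)
      fix j
      have low: "(\<integral>\<^sup>+u. ennreal (exp (\<mu> * (max 0 (\<tau> - u))\<^sup>2)) \<partial>std_gauss) \<le> ennreal (exp ((x + x\<^sup>2) * lower_sq \<tau>))"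
        unfolding \<mu>_def using pos(4) x by (intro lower_tail_exp_bound) auto
      consider "j \<in> K1" | "j \<notin> K1" "j \<in> Km1" | "j \<notin> K1 \<union> Km1" by blast
      then show "(\<integral>\<^sup>+u. ennreal (exp (\<mu> * (f j u)\<^sup>2)) \<partial>std_gauss) \<le>
        ennreal (exp ((x + x\<^sup>2) * (if j \<in> K1 \<union> Km1 then lower_sq \<tau> else 2 * upper_sq \<tau>)))"
      proof cases
        case 1
        have "(\<integral>\<^sup>+u. ennreal (exp (\<mu> * (max 0 (\<tau> - - u))\<^sup>2)) \<partial>std_gauss) = (\<integral>\<^sup>+u. ennreal (exp (\<mu> * (max 0 (\<tau> - u))\<^sup>2)) \<partial>std_gauss)"
          by (rule nn_integral_std_gauss_minus) measurable
        then show ?thesis using low 1 by (simp add: f_def)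
      next
        case 2
        then show ?thesis using low by (simp add: f_def)
      next
        case 3
        then show ?thesis using soft_threshold_exp_bound[OF pos(4), of x] x by (simp add: f_def \<mu>_def)
      qed
    qed
    also have "\<dots> = ennreal (exp ((x + x\<^sup>2) * ?r))"
    proof -
      have "(\<Sum>j<N. if j \<in> K1 \<union> Km1 then lower_sq \<tau> else 2 * upper_sq \<tau>) =
        (\<Sum>j\<in>K1 \<union> Km1. lower_sq \<tau>) + (\<Sum>j\<in>{..<N} - (K1 \<union> Km1). 2 * upper_sq \<tau>)"
      proof -
        have "{..<N} \<inter> {j. j \<in> K1 \<union> Km1} = K1 \<union> Km1" "{..<N} \<inter> - {j. j \<in> K1 \<union> Km1} = {..<N} - (K1 \<union> Km1)"
          using K by auto
        then show ?thesis by (subst sum.If_cases) auto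
      qed
      also have "\<dots> = ?r"
      proof -
        have sub: "K1 \<union> Km1 \<subseteq> {..<N}" using K by auto
        then have "card (K1 \<union> Km1) \<le> N" using card_mono[of "{..<N}"] by simp
        moreover have "card ({..<N} - (K1 \<union> Km1)) = N - card (K1 \<union> Km1)"
          using sub by (subst card_Diff_subset) (auto intro: finite_subset)
        ultimately show ?thesis by (simp add: threshold_risk_def of_nat_diff)
      qed
      finally show ?thesis
        by (simp add: prod_ennreal flip: exp_sum sum_distrib_left)
    qed
    finally show "(\<integral>\<^sup>+v. ?d v \<partial>gauss (?K - ?I2)) \<le>
      ennreal (?b)"
      by (simp add: exp_add ennreal_mult mult_left_mono)
  qed auto
  finally have RHS: "(\<integral>\<^sup>+v. ennreal (exp (- l * (?n v - D v))) \<partial>gauss ?K) \<le> \<dots>" .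
  have DK: "D \<in> borel_measurable (gauss ?K)" by (rule D_meas) auto
  have "ennreal (exp (- 2 * l * \<eta>) * ?P) * ennreal (exp (l\<^sup>2 / 2)) \<le> ennreal (?a) *
    ennreal (?b)"
    unfolding LHS[symmetric]
    by (rule order_trans[OF gordon_exponential RHS])
      (use L zu pos DK D_ge in \<open>auto simp: unit_sphere_def\<close>)
  then have "ennreal (exp (- 2 * l * \<eta>) * ?P * exp (l\<^sup>2 / 2)) \<le>
    ennreal (?a * ?b)"
    by (simp add: ennreal_mult)
  then have le: "exp (- 2 * l * \<eta>) * ?P * exp (l\<^sup>2 / 2) \<le>
    ?a * ?b"
    by (simp add: ennreal_le_iff)
  have "?P = (exp (- 2 * l * \<eta>) * ?P * exp (l\<^sup>2 / 2)) * exp (2 * l * \<eta> - l\<^sup>2 / 2)"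
    by (simp add: mult_ac flip: exp_add)
  also have "\<dots> \<le> (?a * ?b) *
    exp (2 * l * \<eta> - l\<^sup>2 / 2)"
    using le by (intro mult_right_mono) auto
  also have "\<dots> = exp (2 * l * \<eta> - l\<^sup>2 / 2 - (real m / m') * (l * sqrt m' - l\<^sup>2 / 4) + l * (l + S) / 2 +
      (x + x\<^sup>2) * ?r)"
    by (simp add: \<sigma>_def algebra_simps flip: exp_add)
  finally show ?thesis by (simp add: B_def)
qed


text \<open>The bound for finite sets of vectors is independent of the set, so it survives the
  increasing union along a dense sequence. The union contains the kernel event: near a kernel vector
  the squared residual drops below \<open>\<eta>\<^sup>2\<close>, and
  \<open>\<eta>\<^sup>2 + \<eta>\<^sup>2 < (2 * \<eta>)\<^sup>2\<close>.\<close>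

lemma kernel_meets_descent_sphere_bound:
  fixes m N :: nat and \<eta> l S \<tau> :: real
  assumes K: "K1 \<subseteq> {..<N}" "Km1 \<subseteq> {..<N}" "K1 \<inter> Km1 = {}"
    and pos: "\<eta> > 0" "l > 0" "S > 0" "\<tau> \<ge> 0"
  defines "m' \<equiv> real m + 1 + \<eta>\<^sup>2 + l * \<eta>" and "x \<equiv> l / (2 * S)"
  shows "measure (gauss ({..<m} \<times> {..<N})) (kernel_meets m N (descent_sphere N K1 Km1)) \<le>
    exp (2 * l * \<eta> - l\<^sup>2 / 2 - (real m / m') * (l * sqrt m' - l\<^sup>2 / 4) + l * (l + S) / 2 +
      (x + x\<^sup>2) * threshold_risk N (card (K1 \<union> Km1)) \<tau>)" (is "_ \<le> ?R")
proof (cases "descent_sphere N K1 Km1 = {}")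
  case True
  then show ?thesis by (simp add: kernel_meets_def)
next
  case False
  then obtain d :: "nat \<Rightarrow> nat \<Rightarrow> real" where d: "range d \<subseteq> descent_sphere N K1 Km1"
    "descent_sphere N K1 Km1 \<subseteq> closure (range d)" by (rule dense_sequence)
  let ?G = "gauss ({..<m} \<times> {..<N})"
  interpret prob_space ?G by (rule prob_space_gauss)
  define A where "A q = {a \<in> space ?G. \<exists>k\<in>{..<q}. smooth_norm \<eta> m (\<lambda>i. \<Sum>j<N. a (i, j) * d k j) < 2 * \<eta>}" for q
  have "(\<lambda>a. \<eta>\<^sup>2 + (\<Sum>i<m. (\<Sum>j<N. a (i, j) * d k j)\<^sup>2)) \<in> borel_measurable ?G" for k
    by (intro borel_measurable_add borel_measurable_const borel_measurable_sum borel_measurable_power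
      borel_measurable_times measurable_gauss_component) auto
  then have [measurable]: "(\<lambda>a. smooth_norm \<eta> m (\<lambda>i. \<Sum>j<N. a (i, j) * d k j)) \<in> borel_measurable ?G" for k
    unfolding smooth_norm_def by measurable
  have A_sets: "range A \<subseteq> sets ?G" unfolding A_def by auto
  have "incseq A" by (auto simp: incseq_def A_def)
  have "measure ?G (A q) \<le> ?R" for q
    unfolding A_def m'_def x_def by (rule gordon_escape[OF K _ _ pos]) (use d in auto)
  then have "measure ?G (\<Union>q. A q) \<le> ?R"
    using finite_Lim_measure_incseq[OF A_sets \<open>incseq A\<close>] by (intro LIMSEQ_le_const2) auto
  moreover have "kernel_meets m N (descent_sphere N K1 Km1) \<subseteq> (\<Union>q. A q)"
  proof
    fix a assume "a \<in> kernel_meets m N (descent_sphere N K1 Km1)"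
    then obtain z where z: "z \<in> descent_sphere N K1 Km1" "\<forall>i<m. (\<Sum>j<N. a (i, j) * z j) = 0" "a \<in> space ?G"
      by (auto simp: kernel_meets_def)
    have "\<exists>k. (\<Sum>i<m. (\<Sum>j<N. a (i, j) * d k j)\<^sup>2) < \<eta>\<^sup>2"
      by (rule residual_near_zero[OF z(1) d(2) z(2)]) (use pos in simp)
    then obtain k where k: "(\<Sum>i<m. (\<Sum>j<N. a (i, j) * d k j)\<^sup>2) < \<eta>\<^sup>2" ..
    moreover have "(2 * \<eta>)\<^sup>2 = 4 * \<eta>\<^sup>2" by (simp add: power_mult_distrib)
    ultimately have "\<eta>\<^sup>2 + (\<Sum>i<m. (\<Sum>j<N. a (i, j) * d k j)\<^sup>2) < (2 * \<eta>)\<^sup>2"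
      using zero_le_power2[of \<eta>] by linarith
    then have "smooth_norm \<eta> m (\<lambda>i. \<Sum>j<N. a (i, j) * d k j) < 2 * \<eta>"
      unfolding smooth_norm_def using pos by (intro real_less_lsqrt) auto
    then show "a \<in> (\<Union>q. A q)" using z(3) by (auto simp: A_def intro!: exI[of _ "Suc k"])
  qed
  then have "measure ?G (kernel_meets m N (descent_sphere N K1 Km1)) \<le> measure ?G (\<Union>q. A q)"
    using A_sets by (intro finite_measure_mono) auto
  ultimately show ?thesis by linarith
qed

section \<open>Choice of the parameters and conclusion\<close>

lemma Delta_pm_ter_eq: "Delta_pm_ter N k = (INF \<tau>\<in>{0..}. threshold_risk N k \<tau>)"
  by (simp add: Delta_pm_ter_def threshold_risk_def lower_sq_def upper_sq_def)

text \<open>A support coordinate costs at least 1/2 at every threshold. This makes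
  \<open>\<Delta>\<close> positive for nonempty support, so that \<open>sqrt \<Delta>\<close> can
  serve as the parameter \<open>S\<close>.\<close>

lemma threshold_risk_ge:
  assumes "k \<le> N" "0 \<le> \<tau>" shows "real k / 2 \<le> threshold_risk N k \<tau>"
proof -
  have "1 / 2 \<le> lower_sq \<tau>"
    using normal_cdf_0_ge lower_sq_ge_normal_cdf_0[OF assms(2)] by linarith
  then have "real k * (1 / 2) \<le> real k * lower_sq \<tau>" by (intro mult_left_mono) auto
  moreover have "0 \<le> 2 * (real N - real k) * upper_sq \<tau>"
    using assms(1) nn_integral_upper_sq(2)[of \<tau>] by auto
  ultimately show ?thesis by (simp add: threshold_risk_def)
qed

text \<open>Optimises over \<open>\<tau>\<close> without a minimiser at hand: after taking
  logarithms the hypotheses become one common lower bound for all risks, which the infimum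
  inherits.\<close>

lemma le_exp_Delta:
  assumes "0 < B" "\<And>\<tau>. 0 \<le> \<tau> \<Longrightarrow> P \<le> exp (A + B * threshold_risk N k \<tau>)"
  shows "P \<le> exp (A + B * Delta_pm_ter N k)"
proof (cases "P \<le> 0")
  case True
  then show ?thesis by (rule order_trans) simp
next
  case False
  have "(ln P - A) / B \<le> threshold_risk N k \<tau>" if "0 \<le> \<tau>" for \<tau>
  proof -
    have "ln P \<le> ln (exp (A + B * threshold_risk N k \<tau>))"
      using assms(2)[OF that] False by (subst ln_le_cancel_iff) auto
    then have "ln P \<le> A + B * threshold_risk N k \<tau>" by simp
    then show ?thesis using assms(1) by (simp add: field_simps)
  qed
  then have "(ln P - A) / B \<le> Delta_pm_ter N k"
    unfolding Delta_pm_ter_eq by (intro cINF_greatest) auto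
  then have "ln P \<le> A + B * Delta_pm_ter N k" using assms(1) by (simp add: field_simps)
  then have "exp (ln P) \<le> exp (A + B * Delta_pm_ter N k)" by simp
  then show ?thesis using False by simp
qed

text \<open>The exponent comes out as at most \<open>9 / 8 - l\<^sup>2 / 2\<close>: 1 is lost by the
  gap between \<open>m\<close> and \<open>m'\<close>, and \<open>1 / 8\<close> by the tolerance
  \<open>2 * \<eta>\<close>. With \<open>l\<^sup>2 \<ge> 2 * ln (4 / \<epsilon>)\<close> it is at
  most \<open>ln \<epsilon> + 9 / 8 - ln 4\<close>, and \<open>ln 4 \<ge> 4 / 3\<close> exceeds
  \<open>9 / 8\<close>.\<close>

lemma escape_exponent:
  fixes m N \<Delta> \<epsilon> \<eta> l :: real
  assumes \<epsilon>: "0 < \<epsilon>" "\<epsilon> \<le> 1" and m: "1 \<le> m" "m \<le> N" and \<Delta>: "0 < \<Delta>"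
    and le: "\<Delta> + sqrt (8 * ln (4 / \<epsilon>) * N) \<le> m"
  defines "l \<equiv> sqrt m - sqrt \<Delta>" and "\<eta> \<equiv> 1 / (16 * (1 + l))"
  defines "m' \<equiv> m + 1 + \<eta>\<^sup>2 + l * \<eta>" and "x \<equiv> l / (2 * sqrt \<Delta>)"
  shows "0 < l" "0 < \<eta>"
    "exp (2 * l * \<eta> - l\<^sup>2 / 2 - (m / m') * (l * sqrt m' - l\<^sup>2 / 4) + l * (l + sqrt \<Delta>) / 2 + (x + x\<^sup>2) * \<Delta>) < \<epsilon>"
proof -
  define L where "L = ln (4 / \<epsilon>)"
  define q where "q = sqrt m"
  define s where "s = sqrt \<Delta>"
  have q: "q\<^sup>2 = m" "q \<ge> 1" using m by (auto simp: q_def)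
  have s: "s\<^sup>2 = \<Delta>" "s > 0" using \<Delta> by (auto simp: s_def)
  have ln4: "ln 4 \<ge> (4 / 3 :: real)"
  proof -
    have "ln (4::real) = 2 * ln 2" using ln_realpow[of "2::real" 2] by simp
    then show ?thesis using ln2_ge_two_thirds by simp
  qed
  have Leq: "L = ln 4 - ln \<epsilon>" using \<epsilon> by (simp add: L_def ln_div)
  have "ln \<epsilon> \<le> 0" using \<epsilon> by simp
  then have L: "L > 0" using ln4 Leq by linarith
  have "0 < 8 * L * N" using L m by auto
  then have "\<Delta> < m" using le real_sqrt_gt_zero[of "8 * L * N"] unfolding L_def by linarith
  then have l0: "0 < l" by (simp add: l_def)
  then show "0 < l" .
  show \<eta>0: "0 < \<eta>" using l0 by (simp add: \<eta>_def)
  have lqs: "l = q - s" by (simp add: l_def q_def s_def)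
  \<comment> \<open>The difference factors as \<open>l * (q + s)\<close>, and both roots are at most
    \<open>sqrt N\<close>; this is where \<open>m \<le> N\<close> enters. Squaring then gives
    \<open>2 * L \<le> l\<^sup>2\<close>.\<close>
  have "sqrt (8 * L * N) \<le> q\<^sup>2 - s\<^sup>2" using le q s by (simp add: L_def)
  also have "\<dots> = l * (q + s)" by (simp add: lqs power2_eq_square algebra_simps)
  also have "\<dots> \<le> l * (2 * sqrt N)"
  proof -
    have "q \<le> sqrt N" using m by (simp add: q_def)
    moreover have "s \<le> q" using l0 lqs by simp
    ultimately show ?thesis using l0 by (intro mult_left_mono) auto
  qed
  finally have "sqrt (8 * L * N) \<le> l * (2 * sqrt N)" .
  then have "(sqrt (8 * L * N))\<^sup>2 \<le> (l * (2 * sqrt N))\<^sup>2"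
    using \<open>0 < 8 * L * N\<close> by (intro power_mono) auto
  then have "8 * L * N \<le> l\<^sup>2 * 4 * N"
    using \<open>0 < 8 * L * N\<close> m by (simp add: power_mult_distrib)
  then have l2: "2 * L \<le> l\<^sup>2" using m by (simp add: mult_le_cancel_right)
  \<comment> \<open>Bounding both \<open>\<eta>\<close> and \<open>l * \<eta>\<close> is the purpose
    of the denominator \<open>1 + l\<close>; it keeps \<open>m'\<close> within 2 of
    \<open>m\<close>.\<close>
  have \<eta>1: "\<eta> \<le> 1 / 16" "l * \<eta> \<le> 1 / 16" using l0 by (auto simp: \<eta>_def field_simps)
  have "\<eta>\<^sup>2 \<le> \<eta> * 1" unfolding power2_eq_square using \<eta>0 \<eta>1 by (intro mult_left_mono) auto
  then have m': "m \<le> m'" "m' \<le> m + 2" using \<eta>0 \<eta>1 l0 by (auto simp: m'_def)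
  define r where "r = sqrt m'"
  have r: "r\<^sup>2 = m'" "r > 0" using m' m by (auto simp: r_def)
  \<comment> \<open>As \<open>(q + 1 / q)\<^sup>2 \<ge> m + 2\<close>, the excess of
    \<open>m'\<close> over \<open>m\<close> costs only \<open>1 / q\<close> in the root. Multiplied
    by \<open>l \<le> q\<close> this becomes the bounded loss 1.\<close>
  have r_le: "r \<le> q + 1 / q"
  proof (rule power2_le_imp_le)
    have "(q + 1 / q)\<^sup>2 = m + 2 + (1 / q)\<^sup>2" using q by (simp add: power2_sum)
    then show "r\<^sup>2 \<le> (q + 1 / q)\<^sup>2" using r m' zero_le_power2[of "1 / q"] by linarith
  qed (use q in auto)
  have "(q - 1 / q) * r \<le> (q - 1 / q) * (q + 1 / q)"
    using q by (intro mult_left_mono r_le) (auto simp: field_simps power2_eq_square intro: mult_ge1_I)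
  also have "\<dots> = q\<^sup>2 - (1 / q)\<^sup>2" by (simp add: power2_eq_square algebra_simps)
  also have "\<dots> \<le> m" using q by simp
  finally have mr: "q - 1 / q \<le> m / r" using r by (simp add: field_simps)
  have t1: "(m / m') * (l * sqrt m') = l * (m / r)"
    using r by (simp add: r_def[symmetric] power2_eq_square[symmetric] field_simps) (simp add: r(1)[symmetric] power2_eq_square)
  have t2: "(m / m') * (l\<^sup>2 / 4) \<le> l\<^sup>2 / 4"
    using m' m by (intro mult_left_le_one_le) (auto simp: divide_le_eq_1)
  have "l * (q - 1 / q) \<le> l * (m / r)" using mr l0 by (intro mult_left_mono) auto
  moreover have "l * (1 / q) \<le> 1" using lqs s q by (simp add: field_simps)
  ultimately have t3: "l * q - 1 \<le> l * (m / r)" by (simp add: right_diff_distrib)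
  have t4: "(x + x\<^sup>2) * \<Delta> = l * s / 2 + l\<^sup>2 / 4"
  proof -
    have xs: "x * s = l / 2" using s(2) by (simp add: x_def s_def)
    have "(x + x\<^sup>2) * \<Delta> = (x * s) * s + (x * s)\<^sup>2"
      unfolding s(1)[symmetric] by (simp add: power2_eq_square algebra_simps)
    then show ?thesis unfolding xs by (simp add: power_divide)
  qed
  have "2 * l * \<eta> - l\<^sup>2 / 2 - (m / m') * (l * sqrt m' - l\<^sup>2 / 4) + l * (l + sqrt \<Delta>) / 2 + (x + x\<^sup>2) * \<Delta>
    = 2 * (l * \<eta>) - l\<^sup>2 / 2 - l * (m / r) + (m / m') * (l\<^sup>2 / 4) + (l\<^sup>2 / 2 + l * s / 2) + (l * s / 2 + l\<^sup>2 / 4)"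
    unfolding right_diff_distrib t1 t4 by (simp add: s_def power2_eq_square distrib_left add_divide_distrib)
  also have "\<dots> \<le> 1 / 8 - l\<^sup>2 / 2 - (l * q - 1) + l\<^sup>2 / 4 + (l\<^sup>2 / 2 + l * s / 2) + (l * s / 2 + l\<^sup>2 / 4)"
    using \<eta>1(2) t2 t3 by linarith
  also have "\<dots> = 9 / 8 - l\<^sup>2 / 2"
    by (simp add: lqs power2_eq_square field_simps)
  also have "\<dots> < ln \<epsilon>" using l2 Leq ln4 by linarith
  finally have "exp (2 * l * \<eta> - l\<^sup>2 / 2 - (m / m') * (l * sqrt m' - l\<^sup>2 / 4) + l * (l + sqrt \<Delta>) / 2 + (x + x\<^sup>2) * \<Delta>) < exp (ln \<epsilon>)"
    by (rule exp_less_mono)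
  then show "exp (2 * l * \<eta> - l\<^sup>2 / 2 - (m / m') * (l * sqrt m' - l\<^sup>2 / 4) + l * (l + sqrt \<Delta>) / 2 + (x + x\<^sup>2) * \<Delta>) < \<epsilon>"
    by (simp only: exp_ln[OF \<epsilon>(1)])
qed

theorem theorem3p3:
  fixes \<epsilon> :: real and N m :: nat and K1 Km1 :: "nat set"
  assumes "\<epsilon> > 0"
    and "K1 \<subseteq> {..<N}" and "Km1 \<subseteq> {..<N}" and "K1 \<inter> Km1 = {}"
    and "real m \<ge> Delta_pm_ter N (card (K1 \<union> Km1)) + sqrt (8 * ln (4 / \<epsilon>) * real N)"
  shows "\<P>(a in gaussian_entries m N.
           unique_l1_box_solution m N (gauss_matrix m a)
             (mat_vec m N (gauss_matrix m a) (\<lambda>j. indic_vec K1 j - indic_vec Km1 j))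
             (\<lambda>j. indic_vec K1 j - indic_vec Km1 j)) > 1 - \<epsilon>"
proof -
  let ?G = "gauss ({..<m} \<times> {..<N})" and ?k = "card (K1 \<union> Km1)" and ?S = "descent_sphere N K1 Km1"
  let ?bad = "kernel_meets m N ?S"
  interpret prob_space ?G by (rule prob_space_gauss)
  have bad: "?bad \<in> sets ?G" by (rule kernel_meets_sets[OF compact_descent_sphere])
  have sub: "K1 \<union> Km1 \<subseteq> {..<N}" using assms by auto
  have k: "?k \<le> N" using card_mono[OF _ sub] by simp
  have "{a \<in> space ?G. unique_l1_box_solution m N (gauss_matrix m a)
             (mat_vec m N (gauss_matrix m a) (\<lambda>j. indic_vec K1 j - indic_vec Km1 j))
             (\<lambda>j. indic_vec K1 j - indic_vec Km1 j)} = space ?G - ?bad"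
    unfolding unique_l1_box_solution_iff[OF assms(2-4)] by (auto simp: kernel_meets_def)
  then have eq: "\<P>(a in gaussian_entries m N.
           unique_l1_box_solution m N (gauss_matrix m a)
             (mat_vec m N (gauss_matrix m a) (\<lambda>j. indic_vec K1 j - indic_vec Km1 j))
             (\<lambda>j. indic_vec K1 j - indic_vec Km1 j)) = 1 - prob ?bad"
    using prob_compl[OF bad] by (simp add: gaussian_entries_def)
  have "prob ?bad < \<epsilon>"
  \<comment> \<open>The exponential estimate works with \<open>\<epsilon> \<le> 1\<close>,
    \<open>\<Delta> > 0\<close> and \<open>m \<le> N\<close>. The excluded cases are settled
    directly: a trivial probability bound, an empty descent cone, an almost surely trivial
    kernel.\<close>
  proof (cases "\<epsilon> > 1 \<or> ?k = 0 \<or> N \<le> m")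
    case True
    moreover have "prob ?bad < \<epsilon>" if "\<epsilon> > 1" using that prob_le_1[of ?bad] by linarith
    \<comment> \<open>With empty support the descent condition would force the
      \<open>\<ell>\<^sub>1\<close> norm of a unit vector to be 0.\<close>
    moreover have "prob ?bad < \<epsilon>" if "?k = 0"
    proof -
      have "K1 \<union> Km1 = {}" using that sub by (auto simp: card_eq_0_iff dest: finite_subset)
      then have "?S = {}"
      proof (safe, goal_cases)
        case (1 z)
        then have z: "(\<Sum>j<N. \<bar>z j\<bar>) \<le> 0" "(\<Sum>j<N. (z j)\<^sup>2) = 1"
          by (auto simp: descent_sphere_def unit_sphere_def)
        then have "\<forall>j\<in>{..<N}. \<bar>z j\<bar> = 0"
          by (subst sum_nonneg_eq_0_iff[symmetric]) (auto intro: antisym sum_nonneg)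
        then show ?case using z(2) by simp
      qed
      then show ?thesis using assms(1) by (simp add: kernel_meets_def)
    qed
    moreover have "prob ?bad < \<epsilon>" if "N \<le> m"
    proof -
      have "?bad \<subseteq> kernel_meets m N (unit_sphere N)"
        by (auto simp: kernel_meets_def descent_sphere_def)
      then have "prob ?bad \<le> prob (kernel_meets m N (unit_sphere N))"
        by (intro finite_measure_mono kernel_meets_sets compact_unit_sphere)
      also have "\<dots> = 0" using emeasure_kernel_meets_sphere[OF that] by (simp add: measure_def)
      finally show ?thesis using assms(1) by simp
    qed
    ultimately show ?thesis by blast
  next
    case False
    define \<Delta> where "\<Delta> = Delta_pm_ter N ?k"
    have "real ?k / 2 \<le> \<Delta>"
      unfolding \<Delta>_def Delta_pm_ter_eq by (intro cINF_greatest threshold_risk_ge k) auto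
    then have \<Delta>: "0 < \<Delta>" using False by simp
    have "0 \<le> ln (4 / \<epsilon>)" using False assms(1) by (intro ln_ge_zero) (auto simp: field_simps)
    then have "0 \<le> sqrt (8 * ln (4 / \<epsilon>) * real N)" by simp
    then have "0 < real m" using assms(5) \<Delta> unfolding \<Delta>_def by linarith
    then have m: "1 \<le> real m" "real m \<le> real N" using False by auto
    define l where "l = sqrt (real m) - sqrt \<Delta>"
    define \<eta> where "\<eta> = 1 / (16 * (1 + l))"
    define m' where "m' = real m + 1 + \<eta>\<^sup>2 + l * \<eta>"
    define x where "x = l / (2 * sqrt \<Delta>)"
    have e: "0 < l" "0 < \<eta>" "exp (2 * l * \<eta> - l\<^sup>2 / 2 - (real m / m') * (l * sqrt m' - l\<^sup>2 / 4) + l * (l + sqrt \<Delta>) / 2 + (x + x\<^sup>2) * \<Delta>) < \<epsilon>"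
      unfolding l_def \<eta>_def m'_def x_def
      using False by (intro escape_exponent[OF assms(1) _ m \<Delta> assms(5)[folded \<Delta>_def]]; simp)+
    have "prob ?bad \<le> exp ((2 * l * \<eta> - l\<^sup>2 / 2 - (real m / m') * (l * sqrt m' - l\<^sup>2 / 4) + l * (l + sqrt \<Delta>) / 2) + (x + x\<^sup>2) * \<Delta>)"
      unfolding \<Delta>_def
    proof (rule le_exp_Delta, fold \<Delta>_def)
      show "0 < x + x\<^sup>2" using e(1) \<Delta> by (auto simp: x_def intro!: add_pos_pos)
      show "prob ?bad \<le> exp ((2 * l * \<eta> - l\<^sup>2 / 2 - (real m / m') * (l * sqrt m' - l\<^sup>2 / 4) + l * (l + sqrt \<Delta>) / 2) + (x + x\<^sup>2) * threshold_risk N ?k \<tau>)"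
        if "0 \<le> \<tau>" for \<tau>
        unfolding m'_def x_def
        by (rule kernel_meets_descent_sphere_bound[OF assms(2-4) e(2,1) _ that]) (use \<Delta> in simp)
    qed
    then show ?thesis using e(3) by linarith
  qed
  then show ?thesis unfolding eq by linarith
qed

end
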